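(* For any shifted skew diagram $D$ and any finite sets of positive integers $X,Y$, both the bipartite graph $G^{\mathrm{bip}}_{X,Y}(D)$ and the nonbipartite graph $G^{\mathrm{nonbip}}_X(D)$ obey the colex lower bound; that is, for $I=I(G^{\mathrm{bip}}_{X,Y}(D))$ and for $I=I(G^{\mathrm{nonbip}}_X(D))$ one has $\beta_i(I)\ge\beta_i(J)$ for all $i$, where $J$ is the unique colexsegment-generated squarefree monomial ideal generated in degree $2$ with the same number of minimal generators as $I$.
   Context: Given integers $\lambda_1>\dots>\lambda_\ell>0$ and $\mu_1>\dots>\mu_r>0$ with $r\le \ell$ and $\mu_i<\lambda_i$ for $1\le i\le \ell$ (where $\mu_i:=0$ for $i>r$), the associated shifted skew diagram is $D=\{(i,j)\in\mathbb Z^2: 1\le i\le \ell,\ i+\mu_i+1\le j\le i+\lambda_i\}$. Let $k$ be a field, $X=\{x_1<\dots<x_m\}$, $Y=\{y_1<\dots<y_n\}$ finite sets of positive integers; regard the $x_i$, $y_j$ also as distinct variables. $I(G^{\mathrm{bip}}_{X,Y}(D))\subset k[x_1,\dots,x_m,y_1,\dots,y_n]$ is the edge ideal generated by the monomials $x_iy_j$ for all $i,j$ with $(x_i,y_j)\in D$. $I(G^{\mathrm{nonbip}}_X(D))\subset k[x_1,\dots,x_m]$ is the edge ideal generated by the monomials $x_ix_j$ for all $i<j$ with $(x_i,x_j)\in D$. Colexicographic order on 2-subsets of $\{1,2,\dots\}$: $\{i_1<i_2\}<_{colex}\{i_1'<i_2'\}$ iff $i_2<i_2'$, or $i_2=i_2'$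 and $i_1<i_1'$. A colexsegment-generated ideal (in degree 2) is $J=(x_{i_1}x_{i_2}:\{i_1,i_2\}\in C)$, in a polynomial ring over $k$, with $C$ a finite initial segment of this order. $\beta_i(I)=\dim_k\mathrm{Tor}_i^S(I,k)$ over the ambient polynomial ring $S$. *)

theory Defs
  imports
    "HOL-Library.Poly_Mapping"
    "HOL-Algebra.Ideal"
    "Jordan_Normal_Form.Matrix_Kernel"
    "Jordan_Normal_Form.DL_Rank"
begin

section \<open>Polynomial rings\<close>

text \<open>A monomial is an exponent vector \<open>'v \<Rightarrow>\<^sub>0 nat\<close>, a polynomial is a finitely supported
  function from monomials to coefficients.\<close>

type_synonym ('v, 'k) mpol = "('v \<Rightarrow>\<^sub>0 nat) \<Rightarrow>\<^sub>0 'k"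

definition Mvar :: "'v \<Rightarrow> ('v, 'k::comm_ring_1) mpol" where
  "Mvar v = Poly_Mapping.single (Poly_Mapping.single v 1) 1"

text \<open>The ring \<open>k[x\<^sub>v : v \<in> V]\<close>.\<close>

definition poly_ring :: "'v set \<Rightarrow> ('v, 'k::comm_ring_1) mpol ring" where
  "poly_ring V =
     \<lparr>carrier = {p. \<forall>m \<in> Poly_Mapping.keys p. Poly_Mapping.keys m \<subseteq> V},
      mult = (*), one = 1, zero = 0, add = (+)\<rparr>"


section \<open>Betti numbers\<close>

text \<open>The elements of the free module \<open>S\<^sup>n\<close> over \<open>S = k[x\<^sub>v : v \<in> V]\<close>.\<close>

definition free_mod :: "'v set \<Rightarrow> nat \<Rightarrow> ('v, 'k::comm_ring_1) mpol vec set" where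
  "free_mod V n = {w \<in> carrier_vec n. set\<^sub>v w \<subseteq> carrier (poly_ring V)}"

text \<open>A resolution
  \<open>\<dots> \<longrightarrow> S\<^bsup>r 2\<^esup> \<longrightarrow> S\<^bsup>r 1\<^esup> \<longrightarrow> S\<^bsup>r 0\<^esup> \<longrightarrow> I \<longrightarrow> 0\<close> by finitely generated free \<open>S\<close>-modules. The
  matrix \<open>d i\<close>, for \<open>i \<ge> 1\<close>, is the differential \<open>S\<^bsup>r i\<^esup> \<longrightarrow> S\<^bsup>r (i - 1)\<^esup>\<close>; the value \<open>d 0\<close> is not
  used. The augmentation \<open>S\<^bsup>r 0\<^esup> \<longrightarrow> I\<close> is the scalar product with \<open>e\<close>. Neither minimality nor
  finite length is required.\<close>

definition free_resolution ::
  "'v set \<Rightarrow> ('v, 'k::comm_ring_1) mpol set \<Rightarrow> (nat \<Rightarrow> nat) \<Rightarrow>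
   ('v, 'k) mpol vec \<Rightarrow> (nat \<Rightarrow> ('v, 'k) mpol mat) \<Rightarrow> bool" where
  "free_resolution V I r e d \<longleftrightarrow>
     e \<in> free_mod V (r 0) \<and>
     (\<forall>i\<ge>1. d i \<in> carrier_mat (r (i - 1)) (r i) \<and> elements_mat (d i) \<subseteq> carrier (poly_ring V)) \<and>
     (\<lambda>w. e \<bullet> w) ` free_mod V (r 0) = I \<and>
     {w \<in> free_mod V (r 0). e \<bullet> w = 0} = (\<lambda>w. d 1 *\<^sub>v w) ` free_mod V (r 1) \<and>
     (\<forall>i\<ge>1. {w \<in> free_mod V (r i). d i *\<^sub>v w = 0\<^sub>v (r (i - 1))} =
             (\<lambda>w. d (i + 1) *\<^sub>v w) ` free_mod V (r (i + 1)))"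

text \<open>Here \<open>k\<close> is the quotient of \<open>S\<close> by the ideal of all variables, so tensoring a matrix with
  \<open>k\<close> replaces each entry by its constant term.\<close>

definition tensor_k :: "('v, 'k::comm_ring_1) mpol mat \<Rightarrow> 'k mat" where
  "tensor_k A = map_mat (\<lambda>p. Poly_Mapping.lookup p 0) A"

text \<open>The dimension of the homology at position \<open>i\<close> of the complex
  \<open>\<dots> \<longrightarrow> k\<^bsup>r 1\<^esup> \<longrightarrow> k\<^bsup>r 0\<^esup> \<longrightarrow> 0\<close> obtained by dropping the augmentation and tensoring with \<open>k\<close>:
  cycles modulo boundaries, where at position \<open>0\<close> everything is a cycle. The truncated subtraction
  is exact, as boundaries are cycles.\<close>

definition homology_dim :: "(nat \<Rightarrow> nat) \<Rightarrow> (nat \<Rightarrow> ('v, 'k::field) mpol mat) \<Rightarrow> nat \<Rightarrow> nat" where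
  "homology_dim r d i =
     (if i = 0 then r 0 else kernel_dim (tensor_k (d i)))
       - vec_space.rank (r i) (tensor_k (d (i + 1)))"

text \<open>\<open>betti V I i\<close> is the dimension of \<open>Tor\<^sub>i\<^sup>S(I, k)\<close>, \<open>S = k[x\<^sub>v : v \<in> V]\<close>. For finite \<open>V\<close> and
  an ideal \<open>I\<close> of \<open>S\<close>, a resolution as above exists and the homology does not depend on it.\<close>

definition betti :: "'v set \<Rightarrow> ('v, 'k::field) mpol set \<Rightarrow> nat \<Rightarrow> nat" where
  "betti V I i = (THE b. \<exists>r e d. free_resolution V I r e d \<and> b = homology_dim r d i)"


section \<open>Edge ideals\<close>

text \<open>An edge is a set of two vertices; sets of any other form in \<open>E\<close> contribute no generator.\<close>

definition edge_ideal :: "'v set \<Rightarrow> 'v set set \<Rightarrow> ('v, 'k::field) mpol set" where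
  "edge_ideal V E = genideal (poly_ring V) {Mvar u * Mvar v | u v. u \<noteq> v \<and> {u, v} \<in> E}"

text \<open>The minimal monomial generators of a monomial ideal: its monomials that are minimal with
  respect to divisibility.\<close>

definition min_gens :: "('v, 'k::field) mpol set \<Rightarrow> ('v \<Rightarrow>\<^sub>0 nat) set" where
  "min_gens I = {m. Poly_Mapping.single m 1 \<in> I \<and>
     (\<forall>m' s. Poly_Mapping.single m' 1 \<in> I \<and> m = m' + s \<longrightarrow> m' = m)}"


section \<open>Shifted skew diagrams and their graphs\<close>

text \<open>Only the values \<open>lam i\<close> and \<open>mu i\<close> for \<open>i \<ge> 1\<close> matter. All cells have positive coordinates,
  so nothing is lost by using natural numbers.\<close>

definition shifted_skew_diagram :: "(nat \<times> nat) set \<Rightarrow> bool" where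
  "shifted_skew_diagram D \<longleftrightarrow> (\<exists>(l::nat) (r::nat) (lam::nat \<Rightarrow> nat) (mu::nat \<Rightarrow> nat).
     (\<forall>i j. 1 \<le> i \<and> i < j \<and> j \<le> l \<longrightarrow> lam j < lam i) \<and>
     (\<forall>i. 1 \<le> i \<and> i \<le> l \<longrightarrow> 0 < lam i) \<and>
     (\<forall>i j. 1 \<le> i \<and> i < j \<and> j \<le> r \<longrightarrow> mu j < mu i) \<and>
     (\<forall>i. 1 \<le> i \<and> i \<le> r \<longrightarrow> 0 < mu i) \<and>
     r \<le> l \<and>
     (\<forall>i. r < i \<longrightarrow> mu i = 0) \<and>
     (\<forall>i. 1 \<le> i \<and> i \<le> l \<longrightarrow> mu i < lam i) \<and>
     D = {(i, j). 1 \<le> i \<and> i \<le> l \<and> i + mu i + 1 \<le> j \<and> j \<le> i + lam i})"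

text \<open>The vertex \<open>Inl x\<close> belongs to \<open>X\<close>, the vertex \<open>Inr y\<close> to \<open>Y\<close>; \<open>X\<close> and \<open>Y\<close> may overlap as sets
  of numbers.\<close>

definition bip_edges :: "nat set \<Rightarrow> nat set \<Rightarrow> (nat \<times> nat) set \<Rightarrow> (nat + nat) set set" where
  "bip_edges X Y D = {{Inl x, Inr y} | x y. x \<in> X \<and> y \<in> Y \<and> (x, y) \<in> D}"

definition nonbip_edges :: "nat set \<Rightarrow> (nat \<times> nat) set \<Rightarrow> nat set set" where
  "nonbip_edges X D = {{x, y} | x y. x \<in> X \<and> y \<in> X \<and> x < y \<and> (x, y) \<in> D}"


section \<open>The colex lower bound\<close>

definition pos_pairs :: "nat set set" where
  "pos_pairs = {A. A \<subseteq> {1..} \<and> card A = 2}"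

definition colex_less :: "nat set \<Rightarrow> nat set \<Rightarrow> bool" where
  "colex_less A B \<longleftrightarrow> Max A < Max B \<or> (Max A = Max B \<and> Min A < Min B)"

definition colexsegment :: "nat set set \<Rightarrow> bool" where
  "colexsegment C \<longleftrightarrow> finite C \<and> C \<subseteq> pos_pairs \<and>
     (\<forall>B\<in>C. \<forall>A\<in>pos_pairs. colex_less A B \<longrightarrow> A \<in> C)"

text \<open>The colexsegment-generated ideal may be taken in any polynomial ring in finitely many
  variables that contains its generators.\<close>

definition obeys_colex_lower_bound :: "'v set \<Rightarrow> ('v, 'k::field) mpol set \<Rightarrow> bool" where
  "obeys_colex_lower_bound V I \<longleftrightarrow>
     (\<forall>C W (J :: (nat, 'k) mpol set).
        colexsegment C \<and> finite W \<and> \<Union>C \<subseteq> W \<and> J = edge_ideal W C \<and>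
        card (min_gens J) = card (min_gens I) \<longrightarrow>
        (\<forall>i. betti W J i \<le> betti V I i))"

end

(* The Betti numbers are read off the Taylor complex of the edge ideal tensored with k. It splits into
   multigraded strands, in degree W spanned by the sets of edges with union W; adding or removing a
   single edge relates strands by long exact sequences, written out here in terms of cycles.

   The edges of G^nonbip_X(D) are those of G^bip_{X,X}(D) with a row x and a column x identified. This
   substitution keeps the Taylor complex exact, and does not change it after tensoring with k, so
   I(G^nonbip_X(D)) has the Betti numbers of I(G^bip_{X,X}(D)).

   For a colexsegment C, adding the edges one at a time, each colon ideal is generated by variables,
   which bounds the i-th Betti number by the sum over {a < b} in C of binomial(b - 2, i). For the
   bipartite graph of a skew shape, send a cell (x, y) to a pair {p, p + q}: q - 1 is the number of
   cells to the right of (x, y) in its row, and p - 1 counts the rows above x which end further right,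
   or end in the same column and contain y. This map is injective. Given i cells among the q - 1 cells
   and p - 1 rows, there is a set T of columns beyond the end of row x such that the strand in the degree
   made of x, y, the chosen rows and columns, and T has homology in degree i. So each cell contributes
   binomial(p + q - 2, i) distinct multidegrees, and since C is an initial segment the sum of
   binomial(b - 2, i) over the colexsegment is at most the sum over these pairs. *)

theory Submission
  imports Defs "HOL-Library.Function_Algebras"
begin

text \<open>Dimensions are avoided wherever possible: a bound on homology is expressed by saying
  that at most b vectors span the cycles modulo boundaries. This form travels along chain maps and
  long exact sequences.

  Splitting off an edge leaves two complexes on the remaining edges, and in one of them the vertices
  of the edge are already covered. The set \<open>Z\<close> of covered vertices makes the family of
  strands closed under this operation.

  The number b - 2 counts the variables x_c with c < b and c \<noteq> a; they generate the colon
  ideal of the edges before {a < b}. For the pair {p, p + q} it is (p - 1) + (q - 1), the number of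
  rows and cells to choose from.

  The columns T are there for the chosen rows that miss column y. They lie outside row x, so that
  the cell and the choice can be read off the degree.

  Identifying row x with column x can produce squares. The labels are then no longer least common
  multiples, and a generator dividing a degree need not be a cone point in that degree; a suitable
  cell has to be found.\<close>

section \<open>Linear algebra: bounding the dimension of cycles modulo boundaries\<close>

text \<open>Removes the truncated difference in favour of a condition that linear maps can
  transport. Both directions are the exchange lemma for a basis of the kernel and a maximal
  independent set of columns of \<open>B\<close>, whose size is the rank.\<close>

lemma (in vec_space) kernel_dim_minus_rank_le_iff_span:
  assumes A: "A \<in> carrier_mat m n" and B: "B \<in> carrier_mat n q" and AB: "A * B = 0\<^sub>m m q"
  shows "kernel_dim A - rank B \<le> b \<longleftrightarrow>
    (\<exists>C. finite C \<and> C \<subseteq> carrier_vec n \<and> card C \<le> b \<and> mat_kernel A \<subseteq> span (C \<union> set (cols B)))"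
proof -
  interpret K: kernel m n A by unfold_locales (rule A)
  obtain K where K: "finite K" "K.basis K" using kernel_basis_exists[OF A] by blast
  have K_ker: "K \<subseteq> mat_kernel A" using K unfolding K.Ker.basis_def by auto
  have ker_car: "mat_kernel A \<subseteq> carrier_vec n" by (rule mat_kernel_carrier[OF A])
  have K_car: "K \<subseteq> carrier_vec n" using K_ker ker_car by auto
  have K_li: "lin_indpt K" using K K.lindep_same[OF K_ker] unfolding K.Ker.basis_def by auto
  have K_span: "span K = mat_kernel A"
    using K K.span_same[OF K_ker] unfolding K.Ker.basis_def by auto
  have K_card: "kernel_dim A = card K"
    using K.Ker.dim_basis[OF K] by simp
  have B_car: "set (cols B) \<subseteq> carrier_vec n" using B cols_dim by blast
  obtain L where L: "maximal L (\<lambda>T. T \<subseteq> set (cols B) \<and> lin_indpt T)"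
    using maximal_exists_superset[of "set (cols B)" "\<lambda>T. T \<subseteq> set (cols B) \<and> lin_indpt T" "{}"]
      finite_lin_indpt2[of "{}"] by auto
  have L_card: "rank B = card L" by (rule rank_card_indpt[OF B L])
  have L_sub: "L \<subseteq> set (cols B)" and L_li: "lin_indpt L" using L unfolding maximal_def by auto
  have L_fin: "finite L" using L_sub finite_subset by blast
  have L_car: "L \<subseteq> carrier_vec n" using L_sub B_car by auto
  have B_L: "set (cols B) \<subseteq> span L"
  proof
    fix v assume v: "v \<in> set (cols B)"
    show "v \<in> span L"
    proof (rule ccontr)
      assume nv: "v \<notin> span L"
      hence "v \<notin> L" using L_car span_mem by auto
      hence "lin_indpt (L \<union> {v})"
        using lin_dep_iff_in_span[of L v] L_car L_li nv v B_car by auto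
      with L v L_sub have "L \<union> {v} = L" unfolding maximal_def by blast
      with \<open>v \<notin> L\<close> show False by auto
    qed
  qed
  have B_ker: "set (cols B) \<subseteq> mat_kernel A"
  proof
    fix v assume "v \<in> set (cols B)"
    then obtain j where j: "j < q" "v = col B j"
      using B by (metis carrier_matD(2) cols_length cols_nth in_set_conv_nth)
    have "A *\<^sub>v v = col (A * B) j" using j A B by (metis col_mult2)
    also have "\<dots> = 0\<^sub>v m" using j unfolding AB by simp
    finally show "v \<in> mat_kernel A" using A B j by (intro mat_kernelI) auto
  qed
  show ?thesis
  proof
    assume le: "kernel_dim A - rank B \<le> b"
    \<comment> \<open>The columns of \<open>B\<close> lie in the kernel, so exchange completes
      \<open>L\<close> by \<open>card K - card L\<close> vectors to a spanning set of the
      kernel.\<close>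
    have "L \<subseteq> span K" using L_sub B_ker K_span by auto
    from replacement[OF L_fin K(1) _ L_li this] K_car obtain C where
      C: "finite C" "C \<subseteq> carrier_vec n" "int (card C) \<le> int (card K) - int (card L)"
         "span (L \<union> C) = span K" by auto
    have "card C \<le> b" using C(3) le K_card L_card by linarith
    moreover have "mat_kernel A \<subseteq> span (C \<union> set (cols B))"
    proof -
      have "span (L \<union> C) \<subseteq> span (C \<union> set (cols B))"
        by (rule span_is_monotone) (use L_sub in auto)
      thus ?thesis using C(4) K_span by simp
    qed
    ultimately show "\<exists>C. finite C \<and> C \<subseteq> carrier_vec n \<and> card C \<le> b
        \<and> mat_kernel A \<subseteq> span (C \<union> set (cols B))"
      using C(1,2) by (intro exI[of _ C] conjI)
  next
    assume "\<exists>C. finite C \<and> C \<subseteq> carrier_vec n \<and> card C \<le> b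
        \<and> mat_kernel A \<subseteq> span (C \<union> set (cols B))"
    then obtain C where C: "finite C" "C \<subseteq> carrier_vec n" "card C \<le> b"
      "mat_kernel A \<subseteq> span (C \<union> set (cols B))" by auto
    have CL_car: "C \<union> L \<subseteq> carrier_vec n" using C L_car by auto
    have "C \<union> set (cols B) \<subseteq> span (C \<union> L)"
      using B_L span_is_monotone[of L "C \<union> L"] in_own_span[of "C \<union> L"] CL_car by auto
    hence "span (C \<union> set (cols B)) \<subseteq> span (C \<union> L)"
      using span_is_subset[OF _ span_is_submodule[of "C \<union> L"]] CL_car by auto
    hence "K \<subseteq> span (C \<union> L)" using C(4) K_ker by auto
    hence "card K \<le> card (C \<union> L)"
      using replacement[OF K(1) _ CL_car K_li] C(1) L_fin by fastforce
    also have "\<dots> \<le> card C + card L" by (rule card_Un_le)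
    finally show "kernel_dim A - rank B \<le> b" using K_card L_card C(3) by linarith
  qed
qed

text \<open>At position 0 everything is a cycle. Seeing this as the kernel of a matrix without rows
  lets position 0 share the general statement.\<close>

lemma kernel_dim_zero_rows: "kernel_dim (0\<^sub>m 0 n :: 'a::field mat) = n"
proof -
  let ?A = "0\<^sub>m 0 n :: 'a mat"
  have A: "?A \<in> carrier_mat 0 n" by simp
  interpret K: kernel 0 n ?A by unfold_locales (rule A)
  have eq: "mat_kernel ?A = carrier_vec n" unfolding mat_kernel[OF A] by auto
  obtain K where K: "finite K" "K.basis K" using kernel_basis_exists[OF A] by blast
  have K_ker: "K \<subseteq> mat_kernel ?A" using K unfolding K.Ker.basis_def by auto
  have "K.NC.basis K"
    using K K.lindep_same[OF K_ker] K.span_same[OF K_ker] eq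
    unfolding K.Ker.basis_def K.NC.basis_def by auto
  hence "K.NC.dim = card K" using K.NC.dim_basis K by blast
  thus ?thesis using K.Ker.dim_basis[OF K] K.NC.dim_is_n K.kernel_dim by metis
qed


lemma (in vec_space) span_Un_cols:
  assumes G: "G \<in> carrier_mat n b" and B: "B \<in> carrier_mat n q"
  shows "span (set (cols G) \<union> set (cols B)) =
    {G *\<^sub>v x + B *\<^sub>v y | x y. x \<in> carrier_vec b \<and> y \<in> carrier_vec q}"
proof -
  have car: "set (cols G) \<subseteq> carrier_vec n" "set (cols B) \<subseteq> carrier_vec n"
    using G B cols_dim by blast+
  have "span (set (cols B)) = {B *\<^sub>v y | y. y \<in> carrier_vec q}"
    using col_space_eq[OF B] B unfolding col_space_def by auto
  moreover have "span (set (cols G)) = {G *\<^sub>v y | y. y \<in> carrier_vec b}"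
    using col_space_eq[OF G] G unfolding col_space_def by auto
  ultimately show ?thesis
    using span_union_is_sum[of "set (cols G)" "set (cols B)"] car
    unfolding submodule_sum_def by (auto simp: image_def; blast)
qed

text \<open>The spanning vectors become the columns of \<open>G\<close>; \<open>b'\<close> is their
  number.\<close>

lemma kernel_dim_minus_rank_le_iff:
  fixes A B :: "'a::field mat"
  assumes A: "A \<in> carrier_mat m n" and B: "B \<in> carrier_mat n q" and AB: "A * B = 0\<^sub>m m q"
  shows "kernel_dim A - vec_space.rank n B \<le> b \<longleftrightarrow>
    (\<exists>b'\<le>b. \<exists>G\<in>carrier_mat n b'. \<forall>z\<in>mat_kernel A. \<exists>x\<in>carrier_vec b'. \<exists>y\<in>carrier_vec q.
       z = G *\<^sub>v x + B *\<^sub>v y)"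
    (is "_ \<longleftrightarrow> ?R")
proof -
  interpret vec_space "TYPE('a)" n .
  show ?thesis
    unfolding kernel_dim_minus_rank_le_iff_span[OF assms]
  proof
    assume "\<exists>C. finite C \<and> C \<subseteq> carrier_vec n \<and> card C \<le> b \<and> mat_kernel A \<subseteq> span (C \<union> set (cols B))"
    then obtain C where C: "finite C" "C \<subseteq> carrier_vec n" "card C \<le> b"
      "mat_kernel A \<subseteq> span (C \<union> set (cols B))" by auto
    obtain cs where cs: "set cs = C" "distinct cs" using finite_distinct_list[OF C(1)] by auto
    have len: "length cs \<le> b" using cs C(3) distinct_card by fastforce
    let ?G = "mat_of_cols n cs"
    have G: "?G \<in> carrier_mat n (length cs)" by simp
    have "set (cols ?G) = C" using cs C(2) by (simp add: cols_mat_of_cols)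
    with C(4) have "mat_kernel A \<subseteq> {?G *\<^sub>v x + B *\<^sub>v y | x y. x \<in> carrier_vec (length cs) \<and> y \<in> carrier_vec q}"
      using span_Un_cols[OF G B] by simp
    hence "\<forall>z\<in>mat_kernel A. \<exists>x\<in>carrier_vec (length cs). \<exists>y\<in>carrier_vec q. z = ?G *\<^sub>v x + B *\<^sub>v y"
      by blast
    thus ?R using len G by blast
  next
    assume ?R
    then obtain b' G where G: "b' \<le> b" "G \<in> carrier_mat n b'" and
      z: "\<And>z. z \<in> mat_kernel A \<Longrightarrow> \<exists>x\<in>carrier_vec b'. \<exists>y\<in>carrier_vec q. z = G *\<^sub>v x + B *\<^sub>v y" by blast
    have 1: "card (set (cols G)) \<le> b"
      using card_length[of "cols G"] G by simp
    have 2: "mat_kernel A \<subseteq> span (set (cols G) \<union> set (cols B))"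
    proof
      fix v assume "v \<in> mat_kernel A"
      from z[OF this] show "v \<in> span (set (cols G) \<union> set (cols B))"
        unfolding span_Un_cols[OF G(2) B] by blast
    qed
    have 3: "set (cols G) \<subseteq> carrier_vec n" using G(2) cols_dim by blast
    show "\<exists>C. finite C \<and> C \<subseteq> carrier_vec n \<and> card C \<le> b \<and> mat_kernel A \<subseteq> span (C \<union> set (cols B))"
      using 1 2 3 List.finite_set[of "cols G"] by metis
  qed
qed

section \<open>Reduction to constant terms\<close>

text \<open>Exponents are natural numbers, so a product of two monomials is 1 only if both are.
  Hence taking constant terms is a ring homomorphism, and tensoring with the field commutes with
  matrix products.\<close>

lemma lookup_mult_0:
  fixes p q :: "('v, 'k::comm_ring_1) mpol"
  shows "Poly_Mapping.lookup (p * q) 0 = Poly_Mapping.lookup p 0 * Poly_Mapping.lookup q 0"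
proof -
  have 0: "(0 = l + m) \<longleftrightarrow> l = 0 \<and> m = 0" for l m :: "'v \<Rightarrow>\<^sub>0 nat"
  proof
    assume "0 = l + m"
    hence "Poly_Mapping.lookup l k + Poly_Mapping.lookup m k = 0" for k
      by (metis lookup_add lookup_zero)
    thus "l = 0 \<and> m = 0" by (auto intro!: poly_mapping_eqI)
  qed simp
  have "Sum_any (\<lambda>m. Poly_Mapping.lookup q m when l = 0 \<and> m = 0) = (Poly_Mapping.lookup q 0 when l = 0)" for l :: "'v \<Rightarrow>\<^sub>0 nat"
    by (cases "l = 0") (simp_all add: when_def)
  then have "Poly_Mapping.lookup (p * q) 0 = Sum_any (\<lambda>l. Poly_Mapping.lookup p l * (Poly_Mapping.lookup q 0 when l = 0))"
    by (simp add: lookup_mult 0)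
  also have "\<dots> = Sum_any (\<lambda>l. Poly_Mapping.lookup p l * Poly_Mapping.lookup q 0 when l = 0)"
    by (simp add: mult_when)
  also have "\<dots> = Poly_Mapping.lookup p 0 * Poly_Mapping.lookup q 0"
    by simp
  finally show ?thesis .
qed

interpretation constant_term: comm_ring_hom "\<lambda>p :: ('v, 'k::comm_ring_1) mpol. Poly_Mapping.lookup p 0"
  by unfold_locales (simp_all add: lookup_mult_0 lookup_add)

lemma tensor_k_mult:
  "A \<in> carrier_mat a b \<Longrightarrow> B \<in> carrier_mat b c \<Longrightarrow> tensor_k (A * B) = tensor_k A * tensor_k B"
  unfolding tensor_k_def by (rule constant_term.mat_hom_mult)

lemma tensor_k_one: "tensor_k (1\<^sub>m n) = 1\<^sub>m n"
  unfolding tensor_k_def by (rule constant_term.mat_hom_one)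

lemma tensor_k_minus:
  "A \<in> carrier_mat a b \<Longrightarrow> B \<in> carrier_mat a b \<Longrightarrow> tensor_k (A - B) = tensor_k A - tensor_k B"
  unfolding tensor_k_def by (intro eq_matI) (auto simp: lookup_minus)

lemma tensor_k_zero: "tensor_k (0\<^sub>m a b) = 0\<^sub>m a b"
  unfolding tensor_k_def by (intro eq_matI) auto

lemma tensor_k_carrier [simp]: "tensor_k A \<in> carrier_mat a b \<longleftrightarrow> A \<in> carrier_mat a b"
  unfolding tensor_k_def by auto

section \<open>Independence of the resolution\<close>

definition ring_mat :: "'v set \<Rightarrow> nat \<Rightarrow> nat \<Rightarrow> ('v, 'k::comm_ring_1) mpol mat set" where
  "ring_mat V a b = {M \<in> carrier_mat a b. elements_mat M \<subseteq> carrier (poly_ring V)}"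

lemma ring_mat_iff:
  "M \<in> ring_mat V a b \<longleftrightarrow> M \<in> carrier_mat a b \<and> (\<forall>i<a. \<forall>j<b. M $$ (i,j) \<in> carrier (poly_ring V))"
  unfolding ring_mat_def elements_mat_def by fastforce

lemma ring_mat_carrier: "M \<in> ring_mat V a b \<Longrightarrow> M \<in> carrier_mat a b"
  by (simp add: ring_mat_iff)

lemma free_mod_iff:
  "w \<in> free_mod V n \<longleftrightarrow> w \<in> carrier_vec n \<and> (\<forall>i<n. w $ i \<in> carrier (poly_ring V))"
  unfolding free_mod_def vec_set_def by fastforce

lemma poly_ring_carrier_iff:
  "p \<in> carrier (poly_ring V) \<longleftrightarrow> (\<forall>m\<in>Poly_Mapping.keys p. Poly_Mapping.keys m \<subseteq> V)"
  by (simp add: poly_ring_def)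

lemma poly_ring_carrier_closed:
  fixes p q :: "('v, 'k::comm_ring_1) mpol"
  assumes "p \<in> carrier (poly_ring V)" "q \<in> carrier (poly_ring V)"
  shows "p + q \<in> carrier (poly_ring V)" "p * q \<in> carrier (poly_ring V)"
    "p - q \<in> carrier (poly_ring V)"
proof -
  have p: "\<And>m. m \<in> Poly_Mapping.keys p \<Longrightarrow> Poly_Mapping.keys m \<subseteq> V"
    and q: "\<And>m. m \<in> Poly_Mapping.keys q \<Longrightarrow> Poly_Mapping.keys m \<subseteq> V"
    using assms unfolding poly_ring_carrier_iff by blast+
  have "m \<in> Poly_Mapping.keys p \<or> m \<in> Poly_Mapping.keys q" if "m \<in> Poly_Mapping.keys (p + q)" for m
    using that Poly_Mapping.keys_add[of p q] by blast
  thus "p + q \<in> carrier (poly_ring V)" unfolding poly_ring_carrier_iff using p q by blast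
  have "m \<in> Poly_Mapping.keys p \<or> m \<in> Poly_Mapping.keys q" if "m \<in> Poly_Mapping.keys (p - q)" for m
    using that unfolding in_keys_iff lookup_minus by fastforce
  thus "p - q \<in> carrier (poly_ring V)" unfolding poly_ring_carrier_iff using p q by blast
  have "Poly_Mapping.keys m \<subseteq> V" if mk: "m \<in> Poly_Mapping.keys (p * q)" for m
  proof -
    obtain a b where ab: "m = a + b" "a \<in> Poly_Mapping.keys p" "b \<in> Poly_Mapping.keys q"
      using mk Poly_Mapping.keys_mult[of p q] by blast
    have "Poly_Mapping.keys m \<subseteq> Poly_Mapping.keys a \<union> Poly_Mapping.keys b"
      unfolding ab(1) by (rule Poly_Mapping.keys_add)
    thus ?thesis using p[OF ab(2)] q[OF ab(3)] by blast
  qed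
  thus "p * q \<in> carrier (poly_ring V)" unfolding poly_ring_carrier_iff by blast
qed

lemma poly_ring_zero_one: "0 \<in> carrier (poly_ring V)" "1 \<in> carrier (poly_ring V)"
  unfolding poly_ring_def by auto

lemma poly_ring_sum:
  "(\<And>i. i \<in> A \<Longrightarrow> f i \<in> carrier (poly_ring V)) \<Longrightarrow> sum f A \<in> carrier (poly_ring V)"
  by (induction A rule: infinite_finite_induct) (auto simp: poly_ring_zero_one poly_ring_carrier_closed)

lemma ring_mat_mult:
  assumes "A \<in> ring_mat V a b" "B \<in> ring_mat V b c"
  shows "A * B \<in> ring_mat V a c"
  using assms unfolding ring_mat_iff
  by (auto simp: scalar_prod_def intro!: poly_ring_sum poly_ring_carrier_closed)

lemma ring_mat_minus:
  assumes "A \<in> ring_mat V a b" "B \<in> ring_mat V a b"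
  shows "A - B \<in> ring_mat V a b"
  using assms unfolding ring_mat_iff by (auto intro!: poly_ring_carrier_closed)

lemma ring_mat_one: "1\<^sub>m n \<in> ring_mat V n n"
  unfolding ring_mat_iff by (auto simp: poly_ring_zero_one)

lemma ring_mat_mult_vec:
  assumes "A \<in> ring_mat V a b" "w \<in> free_mod V b"
  shows "A *\<^sub>v w \<in> free_mod V a"
  using assms unfolding ring_mat_iff free_mod_iff
  by (auto simp: scalar_prod_def intro!: poly_ring_sum poly_ring_carrier_closed)

text \<open>The augmentation as a one-row matrix in position 0: exactness at the last free module
  then reads like exactness everywhere else.\<close>

definition aug_diff :: "(nat \<Rightarrow> nat) \<Rightarrow> 'a vec \<Rightarrow> (nat \<Rightarrow> 'a mat) \<Rightarrow> nat \<Rightarrow> 'a mat" where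
  "aug_diff r e d i = (if i = 0 then mat 1 (r 0) (\<lambda>(_, j). e $ j) else d i)"

definition aug_rank :: "(nat \<Rightarrow> nat) \<Rightarrow> nat \<Rightarrow> nat" where
  "aug_rank r i = (if i = 0 then 1 else r (i - 1))"

lemma aug_simps [simp]: "aug_rank r 0 = 1" "aug_rank r (Suc i) = r i" "aug_diff r e d (Suc i) = d (Suc i)"
  by (auto simp: aug_rank_def aug_diff_def)

lemma aug_diff_0_mult:
  assumes "e \<in> carrier_vec (r 0)" "w \<in> carrier_vec (r 0)"
  shows "aug_diff r e d 0 *\<^sub>v w = vec 1 (\<lambda>_. e \<bullet> w)"
  using assms by (intro eq_vecI) (auto simp: aug_diff_def scalar_prod_def)

lemma free_resolution_aug:
  assumes "free_resolution V I r e d"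
  shows "aug_diff r e d i \<in> ring_mat V (aug_rank r i) (r i)"
    and "{w \<in> free_mod V (r i). aug_diff r e d i *\<^sub>v w = 0\<^sub>v (aug_rank r i)} =
          (\<lambda>w. d (Suc i) *\<^sub>v w) ` free_mod V (r (Suc i))"
    and "{vec 1 (\<lambda>_. x) | x. x \<in> I} = (\<lambda>w. aug_diff r e d 0 *\<^sub>v w) ` free_mod V (r 0)"
proof -
  note res = assms[unfolded free_resolution_def]
  show "aug_diff r e d i \<in> ring_mat V (aug_rank r i) (r i)"
  proof (cases i)
    case 0
    then show ?thesis using res by (auto simp: ring_mat_iff free_mod_iff aug_diff_def)
  next
    case (Suc j)
    have "1 \<le> i \<longrightarrow> d i \<in> carrier_mat (r (i - 1)) (r i) \<and> elements_mat (d i) \<subseteq> carrier (poly_ring V)"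
      using res by blast
    then show ?thesis using Suc by (simp add: ring_mat_def)
  qed
  have e: "e \<in> carrier_vec (r 0)" using res by (auto simp: free_mod_iff)
  have v1: "vec 1 (\<lambda>_. x) = vec 1 (\<lambda>_. y) \<longleftrightarrow> x = y" for x y :: "('a, 'b) mpol"
    by (metis index_vec less_one)
  have v0: "vec 1 (\<lambda>_. x) = 0\<^sub>v 1 \<longleftrightarrow> x = 0" for x :: "('a, 'b) mpol"
    unfolding zero_vec_def by (rule v1)
  show "{w \<in> free_mod V (r i). aug_diff r e d i *\<^sub>v w = 0\<^sub>v (aug_rank r i)} =
          (\<lambda>w. d (Suc i) *\<^sub>v w) ` free_mod V (r (Suc i))"
  proof (cases i)
    case 0
    have "aug_diff r e d 0 *\<^sub>v w = 0\<^sub>v 1 \<longleftrightarrow> e \<bullet> w = 0" if "w \<in> free_mod V (r 0)" for w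
      using that e aug_diff_0_mult[of e r w d] v0[of "e \<bullet> w"] by (simp add: free_mod_iff)
    hence "{w \<in> free_mod V (r 0). aug_diff r e d 0 *\<^sub>v w = 0\<^sub>v 1} = {w \<in> free_mod V (r 0). e \<bullet> w = 0}"
      by blast
    then show ?thesis using res 0 by simp
  next
    case (Suc j)
    have "1 \<le> i \<longrightarrow> {w \<in> free_mod V (r i). d i *\<^sub>v w = 0\<^sub>v (r (i - 1))} =
             (\<lambda>w. d (i + 1) *\<^sub>v w) ` free_mod V (r (i + 1))" using res by blast
    then show ?thesis using Suc by simp
  qed
  have "(\<lambda>w. aug_diff r e d 0 *\<^sub>v w) ` free_mod V (r 0) = (\<lambda>w. vec 1 (\<lambda>_. e \<bullet> w)) ` free_mod V (r 0)"
    using e by (intro image_cong) (auto simp: aug_diff_0_mult free_mod_iff)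
  also have "\<dots> = (\<lambda>x. vec 1 (\<lambda>_. x)) ` I" using res by (auto simp: image_image)
  finally show "{vec 1 (\<lambda>_. x) | x. x \<in> I} = (\<lambda>w. aug_diff r e d 0 *\<^sub>v w) ` free_mod V (r 0)"
    by auto
qed

text \<open>Projectivity of free modules: the columns are lifted separately and the preimages
  collected.\<close>

lemma mat_cols_lift:
  assumes A: "A \<in> ring_mat V a b" and M: "M \<in> carrier_mat a c"
    and col: "\<And>j. j < c \<Longrightarrow> col M j \<in> (\<lambda>w. A *\<^sub>v w) ` free_mod V b"
  shows "\<exists>N\<in>ring_mat V b c. A * N = M"
proof -
  have "\<forall>j. \<exists>w. j < c \<longrightarrow> w \<in> free_mod V b \<and> A *\<^sub>v w = col M j" using col by force
  then obtain w where w: "\<And>j. j < c \<Longrightarrow> w j \<in> free_mod V b" "\<And>j. j < c \<Longrightarrow> A *\<^sub>v w j = col M j"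
    by metis
  define N where "N = mat b c (\<lambda>(i,j). w j $ i)"
  have N: "N \<in> ring_mat V b c" using w by (auto simp: N_def ring_mat_iff free_mod_iff)
  have colN: "col N j = w j" if "j < c" for j
    using w(1)[OF that] that by (auto simp: N_def free_mod_iff)
  have "A * N = M"
  proof (rule eq_matI)
    fix i j assume ij: "i < dim_row M" "j < dim_col M"
    hence "j < c" "i < a" using M by auto
    hence "(A * N) $$ (i,j) = (A *\<^sub>v w j) $ i"
      using ring_mat_carrier[OF A] ring_mat_carrier[OF N] by (simp add: colN)
    also have "\<dots> = M $$ (i,j)" using w(2) \<open>j < c\<close> \<open>i < a\<close> M by simp
    finally show "(A * N) $$ (i,j) = M $$ (i,j)" .
  qed (use ring_mat_carrier[OF A] ring_mat_carrier[OF N] M in auto)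
  thus ?thesis using N by blast
qed

lemma col_ring_mat: "M \<in> ring_mat V a b \<Longrightarrow> j < b \<Longrightarrow> col M j \<in> free_mod V a"
  by (auto simp: ring_mat_iff free_mod_iff)

lemma resolution_lift:
  assumes res: "free_resolution V I r e d" and M: "M \<in> ring_mat V (r i) c"
    and 0: "aug_diff r e d i * M = 0\<^sub>m (aug_rank r i) c"
  shows "\<exists>N\<in>ring_mat V (r (Suc i)) c. d (Suc i) * N = M"
proof (rule mat_cols_lift)
  show "d (Suc i) \<in> ring_mat V (r i) (r (Suc i))"
    using free_resolution_aug(1)[OF res, of "Suc i"] by simp
  fix j assume j: "j < c"
  have "aug_diff r e d i *\<^sub>v col M j = col (aug_diff r e d i * M) j"
    using j ring_mat_carrier[OF M] ring_mat_carrier[OF free_resolution_aug(1)[OF res, of i]]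
    by (metis col_mult2)
  also have "\<dots> = 0\<^sub>v (aug_rank r i)" using j by (simp add: 0)
  finally show "col M j \<in> (\<lambda>w. d (Suc i) *\<^sub>v w) ` free_mod V (r (Suc i))"
    using free_resolution_aug(2)[OF res, of i] col_ring_mat[OF M j] by blast
qed (use ring_mat_carrier[OF M] in simp)

text \<open>Exactness speaks about images of vectors; unit vectors turn it into a matrix
  identity.\<close>

lemma resolution_diff_diff:
  assumes res: "free_resolution V I r e d"
  shows "aug_diff r e d i * d (Suc i) = 0\<^sub>m (aug_rank r i) (r (Suc i))"
proof -
  let ?E = "aug_diff r e d i"
  have E: "?E \<in> carrier_mat (aug_rank r i) (r i)"
    using ring_mat_carrier[OF free_resolution_aug(1)[OF res, of i]] .
  have d: "d (Suc i) \<in> ring_mat V (r i) (r (Suc i))"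
    using free_resolution_aug(1)[OF res, of "Suc i"] by simp
  have unit: "unit_vec n j \<in> free_mod V n" for n j and V :: "'a set"
    by (auto simp: free_mod_iff unit_vec_def poly_ring_zero_one)
  have col_eq: "col M j = M *\<^sub>v unit_vec n j" if "M \<in> carrier_mat m n" "j < n" for M :: "('a, 'b) mpol mat" and m n j
    using that by (intro eq_vecI) auto
  show ?thesis
  proof (rule eq_matI)
    fix k j assume kj: "k < dim_row (0\<^sub>m (aug_rank r i) (r (Suc i)))" "j < dim_col (0\<^sub>m (aug_rank r i) (r (Suc i)))"
    have "col (d (Suc i)) j = d (Suc i) *\<^sub>v unit_vec (r (Suc i)) j"
      using kj col_eq[OF ring_mat_carrier[OF d]] by simp
    hence "col (d (Suc i)) j \<in> {w \<in> free_mod V (r i). ?E *\<^sub>v w = 0\<^sub>v (aug_rank r i)}"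
      unfolding free_resolution_aug(2)[OF res, of i] using unit by blast
    hence "?E *\<^sub>v col (d (Suc i)) j = 0\<^sub>v (aug_rank r i)" by auto
    hence "(?E *\<^sub>v col (d (Suc i)) j) $ k = 0" using kj by simp
    thus "(?E * d (Suc i)) $$ (k,j) = 0\<^sub>m (aug_rank r i) (r (Suc i)) $$ (k,j)"
      using kj E ring_mat_carrier[OF d] by simp
  qed (use E ring_mat_carrier[OF d] in auto)
qed


text \<open>Comparison theorem, existence: the identity of \<open>I\<close> lifts degree by degree
  to a chain map.\<close>

lemma resolution_chain_map:
  assumes F: "free_resolution V I r e d" and F': "free_resolution V I r' e' d'"
  shows "\<exists>f. (\<forall>i. f i \<in> ring_mat V (r' i) (r i)) \<and>
    aug_diff r' e' d' 0 * f 0 = aug_diff r e d 0 \<and>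
    (\<forall>i. d' (Suc i) * f (Suc i) = f i * d (Suc i))"
proof -
  let ?E = "aug_diff r e d" and ?E' = "aug_diff r' e' d'"
  have d: "d (Suc i) \<in> ring_mat V (r i) (r (Suc i))" for i
    using free_resolution_aug(1)[OF F, of "Suc i"] by simp
  have d': "d' (Suc i) \<in> ring_mat V (r' i) (r' (Suc i))" for i
    using free_resolution_aug(1)[OF F', of "Suc i"] by simp
  have E: "?E i \<in> ring_mat V (aug_rank r i) (r i)" for i
    using free_resolution_aug(1)[OF F] .
  have E': "?E' i \<in> ring_mat V (aug_rank r' i) (r' i)" for i
    using free_resolution_aug(1)[OF F'] .
  \<comment> \<open>The middle condition says that \<open>g * d (Suc i)\<close> consists of cycles,
    which is what is needed to lift it one step further. For \<open>i = 0\<close> it follows from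
    the last condition, since consecutive maps compose to 0.\<close>
  define P where "P i g \<longleftrightarrow> g \<in> ring_mat V (r' i) (r i) \<and> (?E' i * g) * d (Suc i) = 0\<^sub>m (aug_rank r' i) (r (Suc i))
    \<and> (i = 0 \<longrightarrow> ?E' 0 * g = ?E 0)" for i g
  have unit: "unit_vec n j \<in> free_mod V n" for n j and V :: "'a set"
    by (auto simp: free_mod_iff unit_vec_def poly_ring_zero_one)
  have col_eq: "col M j = M *\<^sub>v unit_vec n j" if "M \<in> carrier_mat m n" "j < n" for M :: "('a, 'b) mpol mat" and m n j
    using that by (intro eq_vecI) auto
  have "\<exists>g. P 0 g"
  proof -
    have "\<exists>N\<in>ring_mat V (r' 0) (r 0). ?E' 0 * N = ?E 0"
    proof (rule mat_cols_lift)
      show "?E' 0 \<in> ring_mat V 1 (r' 0)" using E'[of 0] by simp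
      show E0: "?E 0 \<in> carrier_mat 1 (r 0)" using ring_mat_carrier[OF E[of 0]] by simp
      fix j assume "j < r 0"
      hence "col (?E 0) j \<in> (\<lambda>w. ?E 0 *\<^sub>v w) ` free_mod V (r 0)"
        using col_eq[OF E0] unit by blast
      thus "col (?E 0) j \<in> (\<lambda>w. ?E' 0 *\<^sub>v w) ` free_mod V (r' 0)"
        using free_resolution_aug(3)[OF F] free_resolution_aug(3)[OF F'] by simp
    qed
    then obtain N where "N \<in> ring_mat V (r' 0) (r 0)" "?E' 0 * N = ?E 0" by blast
    thus ?thesis using resolution_diff_diff[OF F, of 0] unfolding P_def by (intro exI[of _ N]) simp
  qed
  moreover have "\<exists>h. P (Suc i) h \<and> d' (Suc i) * h = g * d (Suc i)" if "P i g" for i g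
  proof -
    have g: "g \<in> ring_mat V (r' i) (r i)" using that P_def by auto
    have "\<exists>N\<in>ring_mat V (r' (Suc i)) (r (Suc i)). d' (Suc i) * N = g * d (Suc i)"
    proof (rule resolution_lift[OF F'])
      show "g * d (Suc i) \<in> ring_mat V (r' i) (r (Suc i))" using ring_mat_mult[OF g d] .
      show "?E' i * (g * d (Suc i)) = 0\<^sub>m (aug_rank r' i) (r (Suc i))"
        using that assoc_mult_mat[OF ring_mat_carrier[OF E'] ring_mat_carrier[OF g] ring_mat_carrier[OF d]]
        unfolding P_def by simp
    qed
    then obtain N where N: "N \<in> ring_mat V (r' (Suc i)) (r (Suc i))" "d' (Suc i) * N = g * d (Suc i)" by blast
    have "(g * d (Suc i)) * d (Suc (Suc i)) = g * (d (Suc i) * d (Suc (Suc i)))"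
      by (rule assoc_mult_mat[OF ring_mat_carrier[OF g] ring_mat_carrier[OF d] ring_mat_carrier[OF d]])
    also have "\<dots> = 0\<^sub>m (r' i) (r (Suc (Suc i)))"
      using resolution_diff_diff[OF F, of "Suc i"] ring_mat_carrier[OF g] by simp
    finally show ?thesis using N unfolding P_def by (intro exI[of _ N]) simp
  qed
  ultimately obtain f where f: "\<And>i. P i (f i)" "\<And>i. d' (Suc i) * f (Suc i) = f i * d (Suc i)"
    using dependent_nat_choice[of P "\<lambda>i g h. d' (Suc i) * h = g * d (Suc i)"] by metis
  show ?thesis using f(1) f(2) unfolding P_def by (intro exI[of _ f]) auto
qed

text \<open>Comparison theorem, uniqueness: a self-map of a resolution that lifts the zero map is
  null-homotopic. It is meant for \<open>p = g f - 1\<close>, where \<open>f\<close> and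
  \<open>g\<close> are chain maps between two resolutions.\<close>

lemma resolution_homotopy:
  assumes F: "free_resolution V I r e d"
    and p: "\<And>i. p i \<in> ring_mat V (r i) (r i)"
    and p0: "aug_diff r e d 0 * p 0 = 0\<^sub>m 1 (r 0)"
    and comm: "\<And>i. d (Suc i) * p (Suc i) = p i * d (Suc i)"
  shows "\<exists>h. (\<forall>i. h i \<in> ring_mat V (r (Suc i)) (r i)) \<and> d 1 * h 0 = p 0 \<and>
    (\<forall>i. d (Suc (Suc i)) * h (Suc i) = p (Suc i) - h i * d (Suc i))"
proof -
  let ?E = "aug_diff r e d"
  have d: "d (Suc i) \<in> ring_mat V (r i) (r (Suc i))" for i
    using free_resolution_aug(1)[OF F, of "Suc i"] by simp
  note dc = ring_mat_carrier[OF d] and pc = ring_mat_carrier[OF p]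
  \<comment> \<open>The condition on \<open>g\<close> makes \<open>p (Suc i) - g * d (Suc i)\<close>
    a matrix of cycles: \<open>d (Suc i)\<close> sends the first term to
    \<open>p i * d (Suc i)\<close> by commutation, and the second one to the same matrix.\<close>
  define P where "P i g \<longleftrightarrow> g \<in> ring_mat V (r (Suc i)) (r i) \<and> (d (Suc i) * g) * d (Suc i) = p i * d (Suc i)
    \<and> (i = 0 \<longrightarrow> d 1 * g = p 0)" for i g
  have "\<exists>g. P 0 g"
  proof -
    have "\<exists>N\<in>ring_mat V (r (Suc 0)) (r 0). d (Suc 0) * N = p 0"
      by (rule resolution_lift[OF F p]) (use p0 in simp)
    then obtain N where "N \<in> ring_mat V (r (Suc 0)) (r 0)" "d (Suc 0) * N = p 0" by blast
    thus ?thesis unfolding P_def by (intro exI[of _ N]) simp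
  qed
  moreover have "\<exists>h. P (Suc i) h \<and> d (Suc (Suc i)) * h = p (Suc i) - g * d (Suc i)" if "P i g" for i g
  proof -
    have g: "g \<in> ring_mat V (r (Suc i)) (r i)" using that P_def by auto
    note gc = ring_mat_carrier[OF g]
    have gd: "g * d (Suc i) \<in> ring_mat V (r (Suc i)) (r (Suc i))" using ring_mat_mult[OF g d] .
    note gdc = ring_mat_carrier[OF gd]
    have "\<exists>N\<in>ring_mat V (r (Suc (Suc i))) (r (Suc i)). d (Suc (Suc i)) * N = p (Suc i) - g * d (Suc i)"
    proof (rule resolution_lift[OF F])
      show "p (Suc i) - g * d (Suc i) \<in> ring_mat V (r (Suc i)) (r (Suc i))"
        by (rule ring_mat_minus[OF p gd])
      have "d (Suc i) * (p (Suc i) - g * d (Suc i)) = d (Suc i) * p (Suc i) - d (Suc i) * (g * d (Suc i))"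
        by (rule mult_minus_distrib_mat[OF dc pc gdc])
      also have "d (Suc i) * (g * d (Suc i)) = (d (Suc i) * g) * d (Suc i)"
        using assoc_mult_mat[OF dc gc dc] by simp
      also have "\<dots> = d (Suc i) * p (Suc i)" using that comm unfolding P_def by simp
      also have "d (Suc i) * p (Suc i) - d (Suc i) * p (Suc i) = 0\<^sub>m (r i) (r (Suc i))"
        using dc[of i] pc[of "Suc i"] by (intro eq_matI) auto
      finally show "aug_diff r e d (Suc i) * (p (Suc i) - g * d (Suc i)) = 0\<^sub>m (aug_rank r (Suc i)) (r (Suc i))"
        by simp
    qed
    then obtain N where N: "N \<in> ring_mat V (r (Suc (Suc i))) (r (Suc i))"
      "d (Suc (Suc i)) * N = p (Suc i) - g * d (Suc i)" by blast
    have "(p (Suc i) - g * d (Suc i)) * d (Suc (Suc i)) =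
        p (Suc i) * d (Suc (Suc i)) - (g * d (Suc i)) * d (Suc (Suc i))"
      by (rule minus_mult_distrib_mat[OF pc gdc dc])
    also have "(g * d (Suc i)) * d (Suc (Suc i)) = g * (d (Suc i) * d (Suc (Suc i)))"
      by (rule assoc_mult_mat[OF gc dc dc])
    also have "\<dots> = 0\<^sub>m (r (Suc i)) (r (Suc (Suc i)))"
      using resolution_diff_diff[OF F, of "Suc i"] gc by simp
    also have "p (Suc i) * d (Suc (Suc i)) - 0\<^sub>m (r (Suc i)) (r (Suc (Suc i))) = p (Suc i) * d (Suc (Suc i))"
      using pc[of "Suc i"] dc[of "Suc i"] by (intro eq_matI) auto
    finally show ?thesis using N unfolding P_def by (intro exI[of _ N]) simp
  qed
  ultimately obtain h where h: "\<And>i. P i (h i)" "\<And>i. d (Suc (Suc i)) * h (Suc i) = p (Suc i) - h i * d (Suc i)"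
    using dependent_nat_choice[of P "\<lambda>i g h. d (Suc (Suc i)) * h = p (Suc i) - g * d (Suc i)"] by metis
  show ?thesis using h unfolding P_def by (intro exI[of _ h]) auto
qed

text \<open>Generators of the homology after tensoring. Unlike a kernel dimension or a rank alone,
  this condition can be moved from one resolution to another.\<close>

definition homology_spanned :: "(nat \<Rightarrow> nat) \<Rightarrow> (nat \<Rightarrow> ('v, 'k::field) mpol mat) \<Rightarrow> nat \<Rightarrow> nat \<Rightarrow> bool" where
  "homology_spanned r d i b \<longleftrightarrow> (\<exists>b'\<le>b. \<exists>G\<in>carrier_mat (r i) b'. \<forall>z\<in>carrier_vec (r i).
     (i = 0 \<or> tensor_k (d i) *\<^sub>v z = 0\<^sub>v (r (i - 1))) \<longrightarrow>
     (\<exists>x\<in>carrier_vec b'. \<exists>y\<in>carrier_vec (r (Suc i)). z = G *\<^sub>v x + tensor_k (d (Suc i)) *\<^sub>v y))"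

lemma homology_dim_le_iff:
  assumes F: "free_resolution V I r e d"
  shows "homology_dim r d i \<le> b \<longleftrightarrow> homology_spanned r d i b"
proof -
  have d: "d (Suc i) \<in> carrier_mat (r i) (r (Suc i))" for i
    using ring_mat_carrier[OF free_resolution_aug(1)[OF F, of "Suc i"]] by simp
  have B: "tensor_k (d (Suc i)) \<in> carrier_mat (r i) (r (Suc i))" using d by simp
  show ?thesis
  proof (cases i)
    case 0
    have "homology_dim r d i = kernel_dim (0\<^sub>m 0 (r 0) :: 'b mat) - vec_space.rank (r 0) (tensor_k (d (Suc 0)))"
      by (simp add: homology_dim_def 0 kernel_dim_zero_rows)
    moreover have "mat_kernel (0\<^sub>m 0 (r 0) :: 'b mat) = carrier_vec (r 0)"
      by (subst mat_kernel[of _ 0 "r 0"]) auto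
    ultimately show ?thesis
      using kernel_dim_minus_rank_le_iff[of "0\<^sub>m 0 (r 0)" 0 "r 0" "tensor_k (d (Suc 0))" "r (Suc 0)" b] B 0
      by (auto simp: homology_spanned_def)
  next
    case (Suc j)
    have A: "tensor_k (d i) \<in> carrier_mat (r j) (r i)" using d Suc by simp
    have "tensor_k (d i) * tensor_k (d (Suc i)) = tensor_k (d i * d (Suc i))"
      using d[of j] d[of i] Suc by (simp add: tensor_k_mult)
    also have "d i * d (Suc i) = 0\<^sub>m (r j) (r (Suc i))" using resolution_diff_diff[OF F, of i] Suc by simp
    finally have AB: "tensor_k (d i) * tensor_k (d (Suc i)) = 0\<^sub>m (r j) (r (Suc i))"
      by (simp add: tensor_k_zero)
    show ?thesis
      using kernel_dim_minus_rank_le_iff[OF A B AB, of b] Suc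
      unfolding homology_dim_def homology_spanned_def mat_kernel[OF A] Ball_Collect[symmetric]
      by (simp add: Ball_def imp_conjL)
  qed
qed

text \<open>Take chain maps \<open>f\<close>, \<open>g\<close> over the identity and a homotopy
  \<open>h\<close> from \<open>g f\<close> to 1. A cycle \<open>z\<close> agrees with
  \<open>g f z\<close> up to a boundary, so generators \<open>G\<close> for the cycle
  \<open>f z\<close> yield generators \<open>g G\<close> for \<open>z\<close>.\<close>

lemma homology_spanned_transfer:
  assumes F: "free_resolution V I r e d" and F': "free_resolution V I r' e' d'"
    and sp: "homology_spanned r' d' i b"
  shows "homology_spanned r d i b"
proof -
  have d: "d (Suc i) \<in> ring_mat V (r i) (r (Suc i))" for i
    using free_resolution_aug(1)[OF F, of "Suc i"] by simp
  have d': "d' (Suc i) \<in> ring_mat V (r' i) (r' (Suc i))" for i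
    using free_resolution_aug(1)[OF F', of "Suc i"] by simp
  note dc = ring_mat_carrier[OF d] and dc' = ring_mat_carrier[OF d']
  obtain f where f: "\<And>i. f i \<in> ring_mat V (r' i) (r i)" "aug_diff r' e' d' 0 * f 0 = aug_diff r e d 0"
    "\<And>i. d' (Suc i) * f (Suc i) = f i * d (Suc i)" using resolution_chain_map[OF F F'] by blast
  obtain g where g: "\<And>i. g i \<in> ring_mat V (r i) (r' i)" "aug_diff r e d 0 * g 0 = aug_diff r' e' d' 0"
    "\<And>i. d (Suc i) * g (Suc i) = g i * d' (Suc i)" using resolution_chain_map[OF F' F] by blast
  note fc = ring_mat_carrier[OF f(1)] and gc = ring_mat_carrier[OF g(1)]
  define p where "p i = g i * f i - 1\<^sub>m (r i)" for i
  have p: "p i \<in> ring_mat V (r i) (r i)" for i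
    unfolding p_def by (intro ring_mat_minus ring_mat_mult[OF g(1) f(1)] ring_mat_one)
  note pc = ring_mat_carrier[OF p]
  have gf: "g i * f i \<in> carrier_mat (r i) (r i)" for i using gc fc by (rule mult_carrier_mat)
  have E0: "aug_diff r e d 0 \<in> carrier_mat 1 (r 0)"
    using ring_mat_carrier[OF free_resolution_aug(1)[OF F, of 0]] by simp
  have "aug_diff r e d 0 * p 0 = aug_diff r e d 0 * (g 0 * f 0) - aug_diff r e d 0 * 1\<^sub>m (r 0)"
    unfolding p_def by (rule mult_minus_distrib_mat[OF E0 gf one_carrier_mat])
  also have "aug_diff r e d 0 * (g 0 * f 0) = aug_diff r e d 0"
    using assoc_mult_mat[OF E0 gc fc] f(2) g(2) by simp
  also have "aug_diff r e d 0 * 1\<^sub>m (r 0) = aug_diff r e d 0" using E0 by simp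
  also have "aug_diff r e d 0 - aug_diff r e d 0 = 0\<^sub>m 1 (r 0)" using E0 by (intro eq_matI) auto
  finally have p0: "aug_diff r e d 0 * p 0 = 0\<^sub>m 1 (r 0)" .
  have comm: "d (Suc i) * p (Suc i) = p i * d (Suc i)" for i
  proof -
    have "d (Suc i) * p (Suc i) = d (Suc i) * (g (Suc i) * f (Suc i)) - d (Suc i) * 1\<^sub>m (r (Suc i))"
      unfolding p_def by (rule mult_minus_distrib_mat[OF dc gf one_carrier_mat])
    also have "d (Suc i) * (g (Suc i) * f (Suc i)) = (g i * d' (Suc i)) * f (Suc i)"
      using assoc_mult_mat[OF dc gc fc] g(3) by simp
    also have "\<dots> = g i * (f i * d (Suc i))" using assoc_mult_mat[OF gc dc' fc] f(3) by simp
    also have "\<dots> = (g i * f i) * d (Suc i)" using assoc_mult_mat[OF gc fc dc] by simp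
    also have "d (Suc i) * 1\<^sub>m (r (Suc i)) = 1\<^sub>m (r i) * d (Suc i)" using dc[of i] by simp
    also have "(g i * f i) * d (Suc i) - 1\<^sub>m (r i) * d (Suc i) = p i * d (Suc i)"
      unfolding p_def by (rule minus_mult_distrib_mat[OF gf one_carrier_mat dc, symmetric])
    finally show ?thesis .
  qed
  obtain h where h: "\<And>i. h i \<in> ring_mat V (r (Suc i)) (r i)" "d 1 * h 0 = p 0"
    "\<And>i. d (Suc (Suc i)) * h (Suc i) = p (Suc i) - h i * d (Suc i)"
    using resolution_homotopy[OF F p p0 comm] by blast
  note hc = ring_mat_carrier[OF h(1)]
  have fk: "tensor_k (f i) \<in> carrier_mat (r' i) (r i)" and gk: "tensor_k (g i) \<in> carrier_mat (r i) (r' i)"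
    and hk: "tensor_k (h i) \<in> carrier_mat (r (Suc i)) (r i)"
    and dk: "tensor_k (d (Suc i)) \<in> carrier_mat (r i) (r (Suc i))"
    and dk': "tensor_k (d' (Suc i)) \<in> carrier_mat (r' i) (r' (Suc i))" for i
    using fc gc hc dc dc' by auto
  from sp obtain b' G where bG: "b' \<le> b" "G \<in> carrier_mat (r' i) b'" and
    sp': "\<And>z. z \<in> carrier_vec (r' i) \<Longrightarrow> i = 0 \<or> tensor_k (d' i) *\<^sub>v z = 0\<^sub>v (r' (i - 1)) \<Longrightarrow>
     (\<exists>x\<in>carrier_vec b'. \<exists>y\<in>carrier_vec (r' (Suc i)). z = G *\<^sub>v x + tensor_k (d' (Suc i)) *\<^sub>v y)"
    unfolding homology_spanned_def by blast
  have "\<exists>x\<in>carrier_vec b'. \<exists>y\<in>carrier_vec (r (Suc i)).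
      z = (tensor_k (g i) * G) *\<^sub>v x + tensor_k (d (Suc i)) *\<^sub>v y"
    if z: "z \<in> carrier_vec (r i)" "i = 0 \<or> tensor_k (d i) *\<^sub>v z = 0\<^sub>v (r (i - 1))" for z
  proof -
    let ?fz = "tensor_k (f i) *\<^sub>v z"
    have fz: "?fz \<in> carrier_vec (r' i)" by (rule mult_mat_vec_carrier[OF fk[of i] z(1)])
    have "tensor_k (d' i) *\<^sub>v ?fz = 0\<^sub>v (r' (i - 1))" if i: "i \<noteq> 0"
    proof -
      obtain j where j: "i = Suc j" using not0_implies_Suc[OF i] by blast
      have "tensor_k (d' i) *\<^sub>v ?fz = (tensor_k (d' i) * tensor_k (f i)) *\<^sub>v z"
        using assoc_mult_mat_vec[OF dk'[of j] fk[of "Suc j"]] z j by simp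
      also have "tensor_k (d' i) * tensor_k (f i) = tensor_k (f j) * tensor_k (d i)"
        using tensor_k_mult[OF dc'[of j] fc[of "Suc j"]] tensor_k_mult[OF fc[of j] dc[of j]] f(3)[of j] j by simp
      also have "\<dots> *\<^sub>v z = tensor_k (f j) *\<^sub>v (tensor_k (d i) *\<^sub>v z)"
        using assoc_mult_mat_vec[OF fk[of j] dk[of j]] z j by simp
      also have "\<dots> = 0\<^sub>v (r' j)" using z(2) j fk[of j] by auto
      finally show ?thesis using j by simp
    qed
    with sp'[OF fz] obtain x y where xy: "x \<in> carrier_vec b'" "y \<in> carrier_vec (r' (Suc i))"
      "?fz = G *\<^sub>v x + tensor_k (d' (Suc i)) *\<^sub>v y" by blast
    \<comment> \<open>The summand \<open>h d z\<close> of the homotopy vanishes on a cycle, so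
      \<open>p z\<close> is a boundary.\<close>
    have pk: "tensor_k (p i) *\<^sub>v z = tensor_k (d (Suc i)) *\<^sub>v (tensor_k (h i) *\<^sub>v z)"
    proof (cases i)
      case 0
      then show ?thesis
        using h(2) tensor_k_mult[OF dc[of 0] hc[of 0]] assoc_mult_mat_vec[OF dk[of 0] hk[of 0]] z by simp
    next
      case (Suc j)
      have hd: "h j * d (Suc j) \<in> carrier_mat (r (Suc j)) (r (Suc j))" by (rule mult_carrier_mat[OF hc dc])
      have hdz: "tensor_k (h j * d (Suc j)) *\<^sub>v z = 0\<^sub>v (r i)"
      proof -
        have "tensor_k (h j * d (Suc j)) *\<^sub>v z = tensor_k (h j) *\<^sub>v (tensor_k (d i) *\<^sub>v z)"
          using tensor_k_mult[OF hc[of j] dc[of j]] assoc_mult_mat_vec[OF hk[of j] dk[of j]] z Suc by simp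
        thus ?thesis using z Suc hk[of j] by auto
      qed
      have "tensor_k (d (Suc i)) *\<^sub>v (tensor_k (h i) *\<^sub>v z) = tensor_k (d (Suc i) * h i) *\<^sub>v z"
        using tensor_k_mult[OF dc[of i] hc[of i]] assoc_mult_mat_vec[OF dk[of i] hk[of i]] z by simp
      also have "d (Suc i) * h i = p i - h j * d (Suc j)" using h(3)[of j] Suc by simp
      also have "tensor_k (p i - h j * d (Suc j)) = tensor_k (p i) - tensor_k (h j * d (Suc j))"
        using tensor_k_minus[OF pc[of i], of "h j * d (Suc j)"] hd Suc by simp
      also have "\<dots> *\<^sub>v z = tensor_k (p i) *\<^sub>v z - tensor_k (h j * d (Suc j)) *\<^sub>v z"
        using minus_mult_distrib_mat_vec[of "tensor_k (p i)" "r i" "r i" "tensor_k (h j * d (Suc j))" z]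
          pc[of i] hd Suc z by simp
      also have "\<dots> = tensor_k (p i) *\<^sub>v z" unfolding hdz using pc[of i] z by (intro eq_vecI) auto
      finally show ?thesis by simp
    qed
    have gfz: "tensor_k (g i) *\<^sub>v ?fz = tensor_k (p i) *\<^sub>v z + z"
    proof -
      have "tensor_k (p i) = tensor_k (g i) * tensor_k (f i) - 1\<^sub>m (r i)"
        unfolding p_def using tensor_k_minus[OF gf[of i] one_carrier_mat] tensor_k_mult[OF gc[of i] fc[of i]]
        by (simp add: tensor_k_one)
      hence "tensor_k (p i) *\<^sub>v z = (tensor_k (g i) * tensor_k (f i)) *\<^sub>v z - 1\<^sub>m (r i) *\<^sub>v z"
        using minus_mult_distrib_mat_vec[OF mult_carrier_mat[OF gk[of i] fk[of i]] one_carrier_mat z(1)] by simp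
      also have "\<dots> = tensor_k (g i) *\<^sub>v ?fz - z"
        using assoc_mult_mat_vec[OF gk[of i] fk[of i] z(1)] z(1) by simp
      finally show ?thesis using z(1) gk[of i] by (intro eq_vecI) auto
    qed
    \<comment> \<open>From \<open>z = g f z - p z\<close>, with both boundary parts collected under
      one differential.\<close>
    let ?y = "tensor_k (g (Suc i)) *\<^sub>v y - tensor_k (h i) *\<^sub>v z"
    have gy: "tensor_k (g (Suc i)) *\<^sub>v y \<in> carrier_vec (r (Suc i))"
      and hz: "tensor_k (h i) *\<^sub>v z \<in> carrier_vec (r (Suc i))"
      and Gx: "G *\<^sub>v x \<in> carrier_vec (r' i)" and dy: "tensor_k (d' (Suc i)) *\<^sub>v y \<in> carrier_vec (r' i)"
      using mult_mat_vec_carrier[OF gk[of "Suc i"] xy(2)] mult_mat_vec_carrier[OF hk[of i] z(1)]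
        mult_mat_vec_carrier[OF bG(2) xy(1)] mult_mat_vec_carrier[OF dk'[of i] xy(2)] by auto
    have "tensor_k (g i) *\<^sub>v ?fz = tensor_k (g i) *\<^sub>v (G *\<^sub>v x) + tensor_k (g i) *\<^sub>v (tensor_k (d' (Suc i)) *\<^sub>v y)"
      unfolding xy(3) by (rule mult_add_distrib_mat_vec[OF gk[of i] Gx dy])
    also have "tensor_k (g i) *\<^sub>v (G *\<^sub>v x) = (tensor_k (g i) * G) *\<^sub>v x"
      using assoc_mult_mat_vec[OF gk[of i] bG(2) xy(1)] by simp
    also have "tensor_k (g i) *\<^sub>v (tensor_k (d' (Suc i)) *\<^sub>v y) = tensor_k (d (Suc i)) *\<^sub>v (tensor_k (g (Suc i)) *\<^sub>v y)"
      using assoc_mult_mat_vec[OF gk[of i] dk'[of i] xy(2)] assoc_mult_mat_vec[OF dk[of i] gk[of "Suc i"] xy(2)]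
        tensor_k_mult[OF gc[of i] dc'[of i]] tensor_k_mult[OF dc[of i] gc[of "Suc i"]] g(3)[of i] by simp
    finally have 1: "tensor_k (d (Suc i)) *\<^sub>v (tensor_k (h i) *\<^sub>v z) + z =
        (tensor_k (g i) * G) *\<^sub>v x + tensor_k (d (Suc i)) *\<^sub>v (tensor_k (g (Suc i)) *\<^sub>v y)"
      using gfz pk by simp
    have 2: "tensor_k (d (Suc i)) *\<^sub>v ?y =
        tensor_k (d (Suc i)) *\<^sub>v (tensor_k (g (Suc i)) *\<^sub>v y) - tensor_k (d (Suc i)) *\<^sub>v (tensor_k (h i) *\<^sub>v z)"
      by (rule mult_minus_distrib_mat_vec[OF dk[of i] gy hz])
    have c: "tensor_k (d (Suc i)) *\<^sub>v (tensor_k (h i) *\<^sub>v z) \<in> carrier_vec (r i)"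
      "tensor_k (d (Suc i)) *\<^sub>v (tensor_k (g (Suc i)) *\<^sub>v y) \<in> carrier_vec (r i)"
      "(tensor_k (g i) * G) *\<^sub>v x \<in> carrier_vec (r i)"
      using mult_mat_vec_carrier[OF dk[of i] gy] mult_mat_vec_carrier[OF dk[of i] hz]
        mult_mat_vec_carrier[OF mult_carrier_mat[OF gk[of i] bG(2)] xy(1)] by auto
    have "z = (tensor_k (g i) * G) *\<^sub>v x + tensor_k (d (Suc i)) *\<^sub>v ?y"
      unfolding 2 using 1 c z(1) by (auto simp: vec_eq_iff algebra_simps)
    moreover have "?y \<in> carrier_vec (r (Suc i))" using gy hz by auto
    ultimately show ?thesis using xy(1) by blast
  qed
  thus ?thesis unfolding homology_spanned_def
    using bG(1) mult_carrier_mat[OF gk[of i] bG(2)] by blast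
qed

text \<open>Spanning bounds transfer in both directions, so all resolutions give the same number and
  the definite description is justified.\<close>

theorem betti_eq_homology_dim:
  assumes F: "free_resolution V I r e d"
  shows "betti V I i = homology_dim r d i"
proof -
  have le: "homology_dim r1 d1 i \<le> homology_dim r2 d2 i"
    if "free_resolution V I r1 e1 d1" "free_resolution V I r2 e2 d2" for r1 e1 r2 e2 and d1 d2 :: "nat \<Rightarrow> ('a,'b) mpol mat"
    using homology_dim_le_iff[OF that(1)] homology_dim_le_iff[OF that(2), of i "homology_dim r2 d2 i"]
      homology_spanned_transfer[OF that] by blast
  show ?thesis unfolding betti_def
  proof (rule the_equality)
    show "\<exists>r' e' d'. free_resolution V I r' e' d' \<and> homology_dim r d i = homology_dim r' d' i"
      using F by blast
    fix b assume "\<exists>r' e' d'. free_resolution V I r' e' d' \<and> b = homology_dim r' d' i"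
    then obtain r' e' d' where F': "free_resolution V I r' e' d'" "b = homology_dim r' d' i" by blast
    show "b = homology_dim r d i" unfolding F'(2) by (rule antisym[OF le[OF F'(1) F] le[OF F F'(1)]])
  qed
qed

section \<open>Complexes on subsets of a finite index set\<close>

text \<open>The sign of moving a factor \<open>e\<close> from the front to its place in the
  increasing product over \<open>s\<close>, as in an exterior algebra.\<close>

definition rsign :: "nat \<Rightarrow> nat set \<Rightarrow> 'r::comm_ring_1" where
  "rsign e s = (-1) ^ card {f \<in> s. f < e}"

lemma rsign_sq [simp]: "rsign e s * rsign e s = 1"
  unfolding rsign_def by (simp flip: power_add mult_2)

lemma rsign_sq' [simp]: "rsign e s * (rsign e s * x) = x"
  by (simp flip: mult.assoc)

text \<open>Anticommutativity of the exterior algebra: passing the smaller of the two elements flips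
  one sign and leaves the other.\<close>

lemma rsign_swap:
  assumes "finite s" "e \<notin> s" "f \<notin> s" "e \<noteq> f"
  shows "rsign e s * rsign f (insert e s) = - (rsign f s * rsign e (insert f s) :: 'r::comm_ring_1)"
proof -
  have main: "rsign a s * rsign b (insert a s) = - (rsign b s * rsign a (insert b s) :: 'r)"
    if "a < b" "a \<notin> s" for a b
  proof -
    have "{f \<in> insert a s. f < b} = insert a {f \<in> s. f < b}" using that by auto
    hence 1: "rsign b (insert a s) = - (rsign b s :: 'r)"
      unfolding rsign_def using assms(1) that by simp
    have "{f \<in> insert b s. f < a} = {f \<in> s. f < a}" using that by auto
    hence 2: "rsign a (insert b s) = (rsign a s :: 'r)" unfolding rsign_def by simp
    show ?thesis unfolding 1 2 by (simp add: mult.commute)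
  qed
  show ?thesis
  proof (cases "e < f")
    case True
    then show ?thesis using main[of e f] assms by simp
  next
    case False
    hence "f < e" using assms by simp
    from main[OF this assms(3)] show ?thesis by simp
  qed
qed

text \<open>A chain is stored as its coefficient function, so the value at \<open>s\<close> gathers
  the sets with one more element. The weights \<open>a\<close> stay free: monomials for the Taylor
  complex, 0 or 1 after tensoring, constantly 1 inside a single multidegree.\<close>

definition sdiff :: "nat \<Rightarrow> (nat \<Rightarrow> nat set \<Rightarrow> 'r) \<Rightarrow> (nat set \<Rightarrow> 'r) \<Rightarrow> nat set \<Rightarrow> 'r::comm_ring_1" where
  "sdiff N a c s = (\<Sum>e\<in>{..<N} - s. rsign e s * a e s * c (insert e s))"

text \<open>Exterior multiplication by \<open>e\<close>, the source of all contractions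
  below.\<close>

definition wedge :: "nat \<Rightarrow> (nat set \<Rightarrow> 'r) \<Rightarrow> nat set \<Rightarrow> 'r::comm_ring_1" where
  "wedge e c s = (if e \<in> s then rsign e (s - {e}) * c (s - {e}) else 0)"

text \<open>The terms for (e, f) and (f, e) cancel. The diagonal is absent, so nothing is divided by
  2 and characteristic 2 is covered.\<close>

lemma sum_antisym_pairs:
  fixes F :: "nat \<Rightarrow> nat \<Rightarrow> 'r::comm_ring_1"
  assumes "finite A" "\<And>e f. e \<in> A \<Longrightarrow> f \<in> A \<Longrightarrow> e \<noteq> f \<Longrightarrow> F e f = - F f e"
  shows "(\<Sum>e\<in>A. \<Sum>f\<in>A - {e}. F e f) = 0"
proof -
  have "(\<Sum>e\<in>A. \<Sum>f\<in>A - {e}. F e f) = (\<Sum>e\<in>A. (\<Sum>f\<in>{f \<in> A. f < e}. F e f) + (\<Sum>f\<in>{f \<in> A. e < f}. F e f))"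
  proof (rule sum.cong[OF refl])
    fix e assume "e \<in> A"
    have "A - {e} = {f \<in> A. f < e} \<union> {f \<in> A. e < f}" by auto
    moreover have "sum (F e) ({f \<in> A. f < e} \<union> {f \<in> A. e < f}) = sum (F e) {f \<in> A. f < e} + sum (F e) {f \<in> A. e < f}"
      using assms(1) by (intro sum.union_disjoint) auto
    ultimately show "(\<Sum>f\<in>A - {e}. F e f) = (\<Sum>f\<in>{f \<in> A. f < e}. F e f) + (\<Sum>f\<in>{f \<in> A. e < f}. F e f)" by simp
  qed
  also have "\<dots> = (\<Sum>e\<in>A. \<Sum>f\<in>{f \<in> A. f < e}. F e f) + (\<Sum>e\<in>A. \<Sum>f\<in>{f \<in> A. e < f}. F e f)"
    by (rule sum.distrib)
  also have "(\<Sum>e\<in>A. \<Sum>f\<in>{f \<in> A. e < f}. F e f) = (\<Sum>f\<in>A. \<Sum>e\<in>{e \<in> A. e < f}. F e f)"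
    using assms(1) by (rule sum.swap_restrict) (rule assms(1))
  also have "\<dots> = (\<Sum>f\<in>A. \<Sum>e\<in>{e \<in> A. e < f}. - F f e)"
  proof (intro sum.cong refl)
    fix f e assume "f \<in> A" "e \<in> {e \<in> A. e < f}"
    thus "F e f = - F f e" by (intro assms(2)) auto
  qed
  finally show ?thesis by (simp add: sum_negf)
qed

lemma sdiff_sdiff:
  fixes a :: "nat \<Rightarrow> nat set \<Rightarrow> 'r::comm_ring_1"
  assumes s: "finite s"
    and a: "\<And>e f. e \<notin> s \<Longrightarrow> f \<notin> s \<Longrightarrow> e \<noteq> f \<Longrightarrow> e < N \<Longrightarrow> f < N \<Longrightarrow> a e s * a f (insert e s) = a f s * a e (insert f s)"
  shows "sdiff N a (sdiff N a c) s = 0"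
proof -
  define F where "F e f = rsign e s * a e s * (rsign f (insert e s) * a f (insert e s) * c (insert f (insert e s)))" for e f
  have "sdiff N a (sdiff N a c) s = (\<Sum>e\<in>{..<N} - s. \<Sum>f\<in>{..<N} - s - {e}. F e f)"
    unfolding sdiff_def F_def sum_distrib_left by (intro sum.cong) auto
  also have "\<dots> = 0"
  proof (rule sum_antisym_pairs)
    fix e f assume ef: "e \<in> {..<N} - s" "f \<in> {..<N} - s" "e \<noteq> f"
    have "F e f = (rsign e s * rsign f (insert e s)) * (a e s * a f (insert e s)) * c (insert f (insert e s))"
      by (simp add: F_def mult_ac)
    also have "\<dots> = - ((rsign f s * rsign e (insert f s)) * (a f s * a e (insert f s)) * c (insert e (insert f s)))"
      using rsign_swap[of s e f, where 'r = 'r] a[of e f] ef s by (simp add: insert_commute)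
    also have "\<dots> = - F f e" by (simp add: F_def mult_ac)
    finally show "F e f = - F f e" .
  qed simp
  finally show ?thesis .
qed

lemma sdiff_wedge_notin:
  assumes "e < N" "e \<notin> s"
  shows "sdiff N a (wedge e c) s = a e s * c s"
proof -
  have "sdiff N a (wedge e c) s = (\<Sum>f\<in>{..<N} - s. if f = e then a e s * c s else 0)"
    unfolding sdiff_def wedge_def using assms
    by (intro sum.cong) (auto simp: insert_Diff_if mult_ac)
  also have "\<dots> = a e s * c s" using assms by simp
  finally show ?thesis .
qed

text \<open>The Leibniz rule. There are two weight functions because the weight of \<open>f\<close>
  may depend on whether \<open>e\<close> belongs to the set; in the strands, \<open>a'\<close>
  belongs to a \<open>Z\<close> enlarged by the vertices of \<open>e\<close>.\<close>

lemma sdiff_wedge_in: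
  fixes a a' :: "nat \<Rightarrow> nat set \<Rightarrow> 'r::comm_ring_1"
  assumes s: "finite s" "e \<in> s" and c: "\<And>t. e \<in> t \<Longrightarrow> c t = 0"
    and a: "\<And>f. f \<notin> s \<Longrightarrow> f < N \<Longrightarrow> a' f (s - {e}) = a f s"
  shows "sdiff N a (wedge e c) s = - wedge e (sdiff N a' c) s"
proof -
  have "sdiff N a' c (s - {e}) = (\<Sum>f\<in>{..<N} - s. rsign f (s - {e}) * a' f (s - {e}) * c (insert f (s - {e})))"
    unfolding sdiff_def using s c by (intro sum.mono_neutral_right) auto
  hence "wedge e (sdiff N a' c) s =
      (\<Sum>f\<in>{..<N} - s. rsign e (s - {e}) * (rsign f (s - {e}) * a' f (s - {e}) * c (insert f (s - {e}))))"
    using s by (simp add: wedge_def sum_distrib_left)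
  also have "\<dots> = (\<Sum>f\<in>{..<N} - s. - (rsign f s * a f s * wedge e c (insert f s)))"
  proof (rule sum.cong[OF refl])
    fix f assume f: "f \<in> {..<N} - s"
    have "rsign e (s - {e}) * rsign f (insert e (s - {e})) = - (rsign f (s - {e}) * rsign e (insert f (s - {e})) :: 'r)"
      using rsign_swap[of "s - {e}" e f] s f by auto
    hence sw: "rsign f s = - (rsign e (s - {e}) * (rsign f (s - {e}) * rsign e (insert f (s - {e}))) :: 'r)"
      using s by (metis insert_Diff mult_minus_right rsign_sq')
    have "f \<noteq> e" using f s by auto
    hence ins: "insert f s - {e} = insert f (s - {e})" by auto
    have "rsign f s * a f s * wedge e c (insert f s) =
        (rsign f s * rsign e (insert f (s - {e}))) * (a f s * c (insert f (s - {e})))"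
      using s ins by (simp add: wedge_def mult_ac)
    also have "rsign f s * rsign e (insert f (s - {e})) = - (rsign e (s - {e}) * rsign f (s - {e}) :: 'r)"
      unfolding sw by (simp add: mult_ac)
    finally have "rsign f s * a f s * wedge e c (insert f s) =
        - (rsign e (s - {e}) * rsign f (s - {e})) * (a f s * c (insert f (s - {e})))" .
    moreover have "a' f (s - {e}) = a f s" using a f by simp
    ultimately show "rsign e (s - {e}) * (rsign f (s - {e}) * a' f (s - {e}) * c (insert f (s - {e}))) =
        - (rsign f s * a f s * wedge e c (insert f s))" by (simp add: mult_ac)
  qed
  finally show ?thesis by (simp add: sdiff_def sum_negf)
qed

text \<open>With all weights 1, multiplication by \<open>e\<close> contracts the full simplex. If
  \<open>e\<close> is in \<open>s\<close>, the part of \<open>c\<close> on sets without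
  \<open>e\<close> cancels by the Leibniz rule, and the part on sets with \<open>e\<close> comes
  back by removing and reinserting \<open>e\<close>.\<close>

lemma sdiff_wedge_one:
  fixes c :: "nat set \<Rightarrow> 'r::comm_ring_1"
  assumes "finite s" "e < N"
  shows "sdiff N (\<lambda>_ _. 1) (wedge e c) s + wedge e (sdiff N (\<lambda>_ _. 1) c) s = c s"
proof (cases "e \<in> s")
  case False
  then show ?thesis using assms by (simp add: sdiff_wedge_notin) (simp add: wedge_def)
next
  case True
  define c0 where "c0 t = (if e \<in> t then 0 else c t)" for t
  define c1 where "c1 t = (if e \<in> t then c t else 0)" for t
  have w: "wedge e c = wedge e c0" by (auto simp: wedge_def c0_def fun_eq_iff)
  have "sdiff N (\<lambda>_ _. 1) c (s - {e}) = sdiff N (\<lambda>_ _. 1) c0 (s - {e}) + sdiff N (\<lambda>_ _. 1) c1 (s - {e})"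
    unfolding sdiff_def by (subst sum.distrib[symmetric], rule sum.cong) (simp_all add: c0_def c1_def)
  also have "sdiff N (\<lambda>_ _. 1) c1 (s - {e}) = (\<Sum>f\<in>{..<N} - (s - {e}). if f = e then rsign e (s - {e}) * c s else 0)"
    unfolding sdiff_def
  proof (rule sum.cong[OF refl])
    fix f assume "f \<in> {..<N} - (s - {e})"
    show "rsign f (s - {e}) * 1 * c1 (insert f (s - {e})) = (if f = e then rsign e (s - {e}) * c s else 0)"
    proof (cases "f = e")
      case f: True
      have "insert e (s - {e}) = s" using True by blast
      then show ?thesis using f True by (simp add: c1_def)
    qed (simp add: c1_def)
  qed
  also have "\<dots> = rsign e (s - {e}) * c s" using assms True by simp
  finally have "wedge e (sdiff N (\<lambda>_ _. 1) c) s = wedge e (sdiff N (\<lambda>_ _. 1) c0) s + c s"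
    using True by (simp add: wedge_def distrib_left)
  moreover have "sdiff N (\<lambda>_ _. 1) (wedge e c0) s = - wedge e (sdiff N (\<lambda>_ _. 1) c0) s"
    using assms True by (intro sdiff_wedge_in) (auto simp: c0_def)
  ultimately have "sdiff N (\<lambda>_ _. 1) (wedge e c0) s + wedge e (sdiff N (\<lambda>_ _. 1) c) s = c s"
    by (simp only: add.assoc[symmetric] add.left_inverse add_0_left)
  thus ?thesis unfolding w .
qed

subsection \<open>Matrices of the differentials\<close>

text \<open>Some enumeration of the basis; the signs do not refer to it but to the order of the
  numbers inside each set.\<close>

definition ksub :: "nat \<Rightarrow> nat \<Rightarrow> nat set list" where
  "ksub N n = (SOME xs. distinct xs \<and> set xs = {s. s \<subseteq> {..<N} \<and> card s = n})"

lemma ksub: "distinct (ksub N n)" "set (ksub N n) = {s. s \<subseteq> {..<N} \<and> card s = n}"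
proof -
  have "finite {s. s \<subseteq> {..<N} \<and> card s = n}" by (rule finite_subset[of _ "Pow {..<N}"]) auto
  hence "\<exists>xs. distinct xs \<and> set xs = {s. s \<subseteq> {..<N} \<and> card s = n}"
    using finite_distinct_list by metis
  hence "distinct (ksub N n) \<and> set (ksub N n) = {s. s \<subseteq> {..<N} \<and> card s = n}"
    unfolding ksub_def by (rule someI_ex)
  thus "distinct (ksub N n)" "set (ksub N n) = {s. s \<subseteq> {..<N} \<and> card s = n}"
    by blast+
qed

definition pos :: "nat \<Rightarrow> nat set \<Rightarrow> nat" where
  "pos N s = (SOME j. j < length (ksub N (card s)) \<and> ksub N (card s) ! j = s)"

lemma pos: assumes "s \<subseteq> {..<N}"
  shows "pos N s < length (ksub N (card s))" "ksub N (card s) ! pos N s = s"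
proof -
  have "s \<in> set (ksub N (card s))" unfolding ksub(2) using assms by blast
  hence "\<exists>j. j < length (ksub N (card s)) \<and> ksub N (card s) ! j = s" by (metis in_set_conv_nth)
  hence "pos N s < length (ksub N (card s)) \<and> ksub N (card s) ! pos N s = s"
    unfolding pos_def by (rule someI_ex)
  thus "pos N s < length (ksub N (card s))" "ksub N (card s) ! pos N s = s"
    by blast+
qed

lemma ksub_nth: assumes "j < length (ksub N n)"
  shows "ksub N n ! j \<subseteq> {..<N}" "card (ksub N n ! j) = n" "finite (ksub N n ! j)" "pos N (ksub N n ! j) = j"
proof -
  have "ksub N n ! j \<in> set (ksub N n)" using assms by (rule nth_mem)
  hence "ksub N n ! j \<in> {s. s \<subseteq> {..<N} \<and> card s = n}" unfolding ksub(2) .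
  thus 1: "ksub N n ! j \<subseteq> {..<N}" and 2: "card (ksub N n ! j) = n" by blast+
  show "finite (ksub N n ! j)" using 1 finite_subset by blast
  have "pos N (ksub N n ! j) < length (ksub N n)" "ksub N n ! pos N (ksub N n ! j) = ksub N n ! j"
    using pos[OF 1] unfolding 2 by blast+
  thus "pos N (ksub N n ! j) = j"
    using nth_eq_iff_index_eq[OF ksub(1)[of N n] _ assms] by blast
qed

definition chain_of :: "nat \<Rightarrow> 'r vec \<Rightarrow> nat set \<Rightarrow> 'r" where
  "chain_of N w s = w $ pos N s"

definition vec_of :: "nat \<Rightarrow> nat \<Rightarrow> (nat set \<Rightarrow> 'r) \<Rightarrow> 'r vec" where
  "vec_of N n c = vec (length (ksub N n)) (\<lambda>j. c (ksub N n ! j))"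

lemma chain_of_vec_of: "s \<subseteq> {..<N} \<Longrightarrow> card s = n \<Longrightarrow> chain_of N (vec_of N n c) s = c s"
  unfolding chain_of_def vec_of_def using pos[of s N] by (metis index_vec)

lemma vec_of_chain_of: "w \<in> carrier_vec (length (ksub N n)) \<Longrightarrow> vec_of N n (chain_of N w) = w"
  by (intro eq_vecI) (simp_all add: chain_of_def vec_of_def ksub_nth(4))

lemma vec_of_carrier [simp]: "vec_of N n c \<in> carrier_vec (length (ksub N n))"
  by (simp add: vec_of_def)

lemma vec_of_cong: "(\<And>s. s \<subseteq> {..<N} \<Longrightarrow> card s = n \<Longrightarrow> c s = c' s) \<Longrightarrow> vec_of N n c = vec_of N n c'"
  by (intro eq_vecI) (simp_all add: vec_of_def ksub_nth(1,2))

lemma vec_of_eq_iff: "vec_of N n c = vec_of N n c' \<longleftrightarrow> (\<forall>s. s \<subseteq> {..<N} \<and> card s = n \<longrightarrow> c s = c' s)"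
  using chain_of_vec_of[of _ N n c] chain_of_vec_of[of _ N n c'] vec_of_cong[of N n c c'] by metis

text \<open>At most one \<open>e\<close> takes the row set to the column set. The sum spares naming
  it and is 0 if there is none.\<close>

definition diff_mat :: "nat \<Rightarrow> (nat \<Rightarrow> nat set \<Rightarrow> 'r::comm_ring_1) \<Rightarrow> nat \<Rightarrow> 'r mat" where
  "diff_mat N a n = mat (length (ksub N n)) (length (ksub N (Suc n)))
     (\<lambda>(p, q). \<Sum>e\<in>{..<N} - ksub N n ! p.
        if insert e (ksub N n ! p) = ksub N (Suc n) ! q then rsign e (ksub N n ! p) * a e (ksub N n ! p) else 0)"

lemma diff_mat_carrier [simp]: "diff_mat N a n \<in> carrier_mat (length (ksub N n)) (length (ksub N (Suc n)))"
  by (simp add: diff_mat_def)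

lemma diff_mat_mult:
  assumes w: "w \<in> carrier_vec (length (ksub N (Suc n)))"
  shows "diff_mat N a n *\<^sub>v w = vec_of N n (sdiff N a (chain_of N w))"
proof (rule eq_vecI)
  fix p assume "p < dim_vec (vec_of N n (sdiff N a (chain_of N w)))"
  hence p: "p < length (ksub N n)" by (simp add: vec_of_def)
  let ?s = "ksub N n ! p"
  note s = ksub_nth[OF p]
  have "(diff_mat N a n *\<^sub>v w) $ p = (\<Sum>q<length (ksub N (Suc n)). (\<Sum>e\<in>{..<N} - ?s.
        if insert e ?s = ksub N (Suc n) ! q then rsign e ?s * a e ?s else 0) * w $ q)"
    using p w by (simp add: diff_mat_def scalar_prod_def lessThan_atLeast0)
  also have "\<dots> = (\<Sum>e\<in>{..<N} - ?s. \<Sum>q<length (ksub N (Suc n)).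
        (if insert e ?s = ksub N (Suc n) ! q then rsign e ?s * a e ?s else 0) * w $ q)"
    unfolding sum_distrib_right by (rule sum.swap)
  also have "\<dots> = (\<Sum>e\<in>{..<N} - ?s. rsign e ?s * a e ?s * chain_of N w (insert e ?s))"
  proof (rule sum.cong[OF refl])
    fix e assume e: "e \<in> {..<N} - ?s"
    hence ins: "insert e ?s \<subseteq> {..<N}" "card (insert e ?s) = Suc n" using s by auto
    have iff: "insert e ?s = ksub N (Suc n) ! q \<longleftrightarrow> q = pos N (insert e ?s)" if "q < length (ksub N (Suc n))" for q
      using pos[OF ins(1)] ins(2) ksub_nth(4)[OF that] by auto
    have "(\<Sum>q<length (ksub N (Suc n)). (if insert e ?s = ksub N (Suc n) ! q then rsign e ?s * a e ?s else 0) * w $ q)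
       = (\<Sum>q<length (ksub N (Suc n)). if q = pos N (insert e ?s) then rsign e ?s * a e ?s * w $ q else 0)"
      using iff by (intro sum.cong) auto
    also have "\<dots> = rsign e ?s * a e ?s * w $ pos N (insert e ?s)"
      using pos[OF ins(1)] ins(2) by simp
    finally show "(\<Sum>q<length (ksub N (Suc n)). (if insert e ?s = ksub N (Suc n) ! q then rsign e ?s * a e ?s else 0) * w $ q)
       = rsign e ?s * a e ?s * chain_of N w (insert e ?s)" by (simp add: chain_of_def)
  qed
  finally show "(diff_mat N a n *\<^sub>v w) $ p = vec_of N n (sdiff N a (chain_of N w)) $ p"
    using p by (simp add: vec_of_def sdiff_def)
qed (simp add: vec_of_def diff_mat_def)

lemma tensor_k_diff_mat:
  fixes a :: "nat \<Rightarrow> nat set \<Rightarrow> ('v, 'k::field) mpol"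
  shows "tensor_k (diff_mat N a n) = diff_mat N (\<lambda>e s. Poly_Mapping.lookup (a e s) 0) n"
proof -
  have sg: "Poly_Mapping.lookup (rsign e s :: ('v, 'k) mpol) 0 = rsign e s" for e s
    unfolding rsign_def by (simp add: constant_term.hom_power constant_term.hom_uminus)
  show ?thesis
    unfolding tensor_k_def diff_mat_def
    by (intro eq_matI) (auto simp: constant_term.hom_sum lookup_mult_0 sg intro!: sum.cong)
qed

lemma sdiff_cong:
  assumes "\<And>e. e < N \<Longrightarrow> e \<notin> s \<Longrightarrow> c (insert e s) = c' (insert e s)"
    and "\<And>e. e < N \<Longrightarrow> e \<notin> s \<Longrightarrow> a e s = a' e s"
  shows "sdiff N a c s = sdiff N a' c' s"
  unfolding sdiff_def using assms by (intro sum.cong) auto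

section \<open>Generalised Taylor resolutions\<close>

definition mdvd :: "('v \<Rightarrow>\<^sub>0 nat) \<Rightarrow> ('v \<Rightarrow>\<^sub>0 nat) \<Rightarrow> bool" where
  "mdvd s t \<longleftrightarrow> (\<exists>v. t = s + v)"

lemma mdvd_trans: "mdvd a b \<Longrightarrow> mdvd b c \<Longrightarrow> mdvd a c"
  unfolding mdvd_def by (metis add.assoc)

lemma mdvd_iff: "mdvd s t \<longleftrightarrow> (\<forall>v. Poly_Mapping.lookup s v \<le> Poly_Mapping.lookup t v)"
proof
  assume "\<forall>v. Poly_Mapping.lookup s v \<le> Poly_Mapping.lookup t v"
  hence "t = s + (t - s)" by (intro poly_mapping_eqI) (simp add: lookup_add lookup_minus)
  thus "mdvd s t" unfolding mdvd_def by blast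
qed (auto simp: mdvd_def lookup_add)

lemma mdvd_add [simp]: "mdvd s (s + t)" "mdvd s (t + s)"
  unfolding mdvd_iff by (auto simp: lookup_add)

lemma lookup_single_one_mult:
  fixes p :: "('v, 'k::comm_ring_1) mpol"
  shows "Poly_Mapping.lookup (Poly_Mapping.single d 1 * p) u = (if mdvd d u then Poly_Mapping.lookup p (u - d) else 0)"
proof -
  have "Poly_Mapping.lookup (Poly_Mapping.single d 1 * p) u =
      Sum_any (\<lambda>l. (1 when d = l) * Sum_any (\<lambda>q. Poly_Mapping.lookup p q when u = l + q))"
    by (simp add: lookup_mult lookup_single)
  also have "\<dots> = Sum_any (\<lambda>l. Sum_any (\<lambda>q. Poly_Mapping.lookup p q when u = d + q) when l = d)"
    by (intro Sum_any.cong) (auto simp: when_def)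
  also have "\<dots> = Sum_any (\<lambda>q. Poly_Mapping.lookup p q when u = d + q)"
    by simp
  also have "\<dots> = (if mdvd d u then Poly_Mapping.lookup p (u - d) else 0)"
  proof (cases "mdvd d u")
    case True
    then obtain v where u: "u = d + v" unfolding mdvd_def by blast
    have "Sum_any (\<lambda>q. Poly_Mapping.lookup p q when u = d + q) = Sum_any (\<lambda>q. Poly_Mapping.lookup p q when q = v)"
      unfolding u by (intro Sum_any.cong) (auto simp: when_def)
    then show ?thesis using True by (simp add: u)
  next
    case False
    have "Sum_any (\<lambda>q. Poly_Mapping.lookup p q when u = d + q) = Sum_any (\<lambda>q :: 'v \<Rightarrow>\<^sub>0 nat. 0 :: 'k)"
      using False unfolding mdvd_def by (intro arg_cong[of _ _ Sum_any]) (auto simp: when_def)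
    then show ?thesis using False by simp
  qed
  finally show ?thesis .
qed

lemma lookup_rsign_mult:
  fixes p :: "('v, 'k::comm_ring_1) mpol"
  shows "Poly_Mapping.lookup (rsign e s * p) u = rsign e s * Poly_Mapping.lookup p u"
  unfolding rsign_def by (cases "even (card {f \<in> s. f < e})") auto

lemma keys_subset_keys_add:
  fixes u v :: "'v \<Rightarrow>\<^sub>0 nat"
  shows "Poly_Mapping.keys u \<subseteq> Poly_Mapping.keys (u + v)"
  by (auto simp: in_keys_iff lookup_add)

text \<open>Labels need only multiply up along insertions, with quotients \<open>dl\<close>. Least
  common multiples give the Taylor complex; images of them under a substitution of variables also
  qualify, but there exactness depends on cone points.\<close>

locale labelled_subsets =
  fixes N :: nat and L :: "nat set \<Rightarrow> 'v \<Rightarrow>\<^sub>0 nat" and dl :: "nat \<Rightarrow> nat set \<Rightarrow> 'v \<Rightarrow>\<^sub>0 nat"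
  assumes L_insert: "\<And>e s. s \<subseteq> {..<N} \<Longrightarrow> e < N \<Longrightarrow> e \<notin> s \<Longrightarrow> L (insert e s) = L s + dl e s"
begin

text \<open>The sets whose label divides \<open>t\<close> form a simplicial complex, and
  \<open>e\<close> is a cone point of it; with the empty set included, its chain complex is
  contractible.\<close>

definition cone :: "('v \<Rightarrow>\<^sub>0 nat) \<Rightarrow> nat \<Rightarrow> bool" where
  "cone t e \<longleftrightarrow> e < N \<and> (\<forall>s. s \<subseteq> {..<N} \<and> mdvd (L s) t \<longrightarrow> mdvd (L (insert e s)) t)"

definition cf :: "nat \<Rightarrow> nat set \<Rightarrow> ('v, 'k::comm_ring_1) mpol" where
  "cf e s = Poly_Mapping.single (dl e s) 1"

definition coef :: "(nat set \<Rightarrow> ('v, 'k::comm_ring_1) mpol) \<Rightarrow> ('v \<Rightarrow>\<^sub>0 nat) \<Rightarrow> nat set \<Rightarrow> 'k" where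
  "coef c t s = (if mdvd (L s) t then Poly_Mapping.lookup (c s) (t - L s) else 0)"

text \<open>The basis element \<open>s\<close> has degree \<open>L s\<close>. In a fixed multidegree
  the monomial weights only shift exponents, so what remains is the differential of a simplicial
  complex.\<close>

lemma lookup_sdiff:
  fixes c :: "nat set \<Rightarrow> ('v, 'k::comm_ring_1) mpol"
  assumes s: "s \<subseteq> {..<N}"
  shows "Poly_Mapping.lookup (sdiff N cf c s) u = sdiff N (\<lambda>_ _. 1) (coef c (u + L s)) s"
proof -
  have "Poly_Mapping.lookup (rsign e s * cf e s * c (insert e s)) u = rsign e s * 1 * coef c (u + L s) (insert e s)"
    if e: "e \<in> {..<N} - s" for e
  proof -
    have L: "L (insert e s) = L s + dl e s" using L_insert[OF s] e by auto
    have iff: "mdvd (L (insert e s)) (u + L s) \<longleftrightarrow> mdvd (dl e s) u"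
      unfolding mdvd_iff L by (simp add: lookup_add add.commute)
    have sub: "u + L s - L (insert e s) = u - dl e s"
      unfolding L by (intro poly_mapping_eqI) (simp add: lookup_add lookup_minus)
    show ?thesis
      unfolding mult.assoc lookup_rsign_mult cf_def lookup_single_one_mult coef_def iff sub by simp
  qed
  thus ?thesis unfolding sdiff_def lookup_sum by (intro sum.cong) auto
qed

text \<open>A preimage is built in each multidegree by multiplication with a cone point, and the
  pieces are reassembled into polynomials. For \<open>n = 0\<close> the cycle condition is void,
  which gives surjectivity of the augmentation.\<close>

lemma sdiff_exact:
  fixes c :: "nat set \<Rightarrow> ('v, 'k::comm_ring_1) mpol"
  assumes cyc: "\<And>s. s \<subseteq> {..<N} \<Longrightarrow> Suc (card s) = n \<Longrightarrow> sdiff N cf c s = 0"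
    and cone: "\<And>s u. s \<subseteq> {..<N} \<Longrightarrow> card s = n \<Longrightarrow> u \<in> Poly_Mapping.keys (c s) \<Longrightarrow> \<exists>e. cone (u + L s) e"
    and V: "\<And>s. s \<subseteq> {..<N} \<Longrightarrow> card s = n \<Longrightarrow> c s \<in> carrier (poly_ring V)"
  shows "\<exists>b. (\<forall>s. s \<subseteq> {..<N} \<and> card s = Suc n \<longrightarrow> b s \<in> carrier (poly_ring V)) \<and>
    (\<forall>s. s \<subseteq> {..<N} \<and> card s = n \<longrightarrow> sdiff N cf b s = c s)"
proof -
  \<comment> \<open>One cone point per multidegree, the same for all \<open>s\<close>; only then is
    the multiplication a contraction.\<close>
  define pt where "pt t = (SOME e. cone t e)" for t
  have pt: "cone t (pt t)" if "\<exists>e. cone t e" for t unfolding pt_def by (rule someI_ex[OF that])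
  define bh where "bh t s = (if \<exists>e. cone t e then wedge (pt t) (coef c t) s else 0)" for t s
  define b where "b s = Abs_poly_mapping (\<lambda>u. bh (u + L s) s)" for s
  \<comment> \<open>Each term of the preimage comes from a term of \<open>c\<close>. This gives both
    the finite support and the containment of the variables in \<open>V\<close>.\<close>
  have bh_key: "\<exists>e\<in>s. u + dl e (s - {e}) \<in> Poly_Mapping.keys (c (s - {e}))"
    if s: "s \<subseteq> {..<N}" and nz: "bh (u + L s) s \<noteq> 0" for u s
  proof -
    have "wedge (pt (u + L s)) (coef c (u + L s)) s \<noteq> 0" using nz by (auto simp: bh_def split: if_splits)
    then obtain e where e: "e \<in> s" and cf: "coef c (u + L s) (s - {e}) \<noteq> 0"
      unfolding wedge_def by (metis mult_zero_right)
    have "insert e (s - {e}) = s" using e by auto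
    with L_insert[of "s - {e}" e] s e have L: "L s = L (s - {e}) + dl e (s - {e})" by auto
    have "u + L s - L (s - {e}) = u + dl e (s - {e})"
      unfolding L by (intro poly_mapping_eqI) (simp add: lookup_add lookup_minus)
    hence "u + dl e (s - {e}) \<in> Poly_Mapping.keys (c (s - {e}))"
      using cf by (auto simp: coef_def in_keys_iff split: if_splits)
    thus ?thesis using e by blast
  qed
  have fin: "finite {u. bh (u + L s) s \<noteq> 0}" if s: "s \<subseteq> {..<N}" for s
  proof (rule finite_subset)
    show "{u. bh (u + L s) s \<noteq> 0} \<subseteq> (\<Union>e\<in>s. (\<lambda>u. u + dl e (s - {e})) -` Poly_Mapping.keys (c (s - {e})))"
      using bh_key[OF s] by blast
    show "finite (\<Union>e\<in>s. (\<lambda>u. u + dl e (s - {e})) -` Poly_Mapping.keys (c (s - {e})))"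
      using s by (intro finite_UN_I finite_vimageI) (auto intro: finite_subset injI)
  qed
  have b: "Poly_Mapping.lookup (b s) u = bh (u + L s) s" if "s \<subseteq> {..<N}" for s u
    unfolding b_def using fin[OF that] by (simp add: lookup_Abs_poly_mapping)
  \<comment> \<open>The contraction must not leave the sets whose label divides \<open>t\<close>;
    here the cone property enters.\<close>
  have coef_b: "coef b t s = bh t s" if s: "s \<subseteq> {..<N}" for s t
  proof (cases "mdvd (L s) t")
    case True
    then obtain v where "t = L s + v" unfolding mdvd_def by blast
    then show ?thesis using True b[OF s] by (simp add: coef_def add.commute)
  next
    case False
    have "bh t s = 0"
    proof (rule ccontr)
      let ?e = "pt t"
      assume "bh t s \<noteq> 0"
      hence ex: "\<exists>e. cone t e" and "wedge ?e (coef c t) s \<noteq> 0"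
        by (auto simp: bh_def split: if_splits)
      hence e: "?e \<in> s" and cf: "coef c t (s - {?e}) \<noteq> 0"
        unfolding wedge_def by (metis, metis mult_zero_right)
      have "mdvd (L (s - {?e})) t" using cf by (auto simp: coef_def split: if_splits)
      hence "mdvd (L (insert ?e (s - {?e}))) t" using pt[OF ex] s unfolding cone_def by blast
      thus False using False e by (simp add: insert_absorb)
    qed
    then show ?thesis using False by (simp add: coef_def)
  qed
  have "sdiff N cf b s = c s" if s: "s \<subseteq> {..<N}" "card s = n" for s
  proof (rule poly_mapping_eqI)
    fix u
    let ?t = "u + L s"
    have fs: "finite s" using s finite_subset by blast
    have "Poly_Mapping.lookup (sdiff N cf b s) u = sdiff N (\<lambda>_ _. 1) (coef b ?t) s"
      by (rule lookup_sdiff[OF s(1)])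
    also have "\<dots> = sdiff N (\<lambda>_ _. 1) (bh ?t) s"
      using s coef_b by (intro sdiff_cong) auto
    also have "\<dots> = Poly_Mapping.lookup (c s) u"
    proof (cases "\<exists>e. cone ?t e")
      case True
      then obtain e where e: "cone ?t e" and bh: "bh ?t = wedge e (coef c ?t)"
        using pt[OF True] by (auto simp: bh_def fun_eq_iff)
      have "wedge e (sdiff N (\<lambda>_ _. 1) (coef c ?t)) s = 0"
      proof (cases "e \<in> s")
        case es: True
        let ?s = "s - {e}"
        have s': "?s \<subseteq> {..<N}" "Suc (card ?s) = n" using s card_Suc_Diff1[OF fs es] by (blast, simp only:)
        have "insert e ?s = s" using es by auto
        with L_insert[of ?s e] s es have L: "L s = L ?s + dl e ?s" by auto
        have "u + dl e ?s + L ?s = ?t" unfolding L by (simp add: add_ac)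
        hence "sdiff N (\<lambda>_ _. 1) (coef c ?t) ?s = Poly_Mapping.lookup (sdiff N cf c ?s) (u + dl e ?s)"
          using lookup_sdiff[OF s'(1), of c "u + dl e ?s"] by simp
        also have "\<dots> = 0" using cyc[OF s'] by simp
        finally show ?thesis by (simp add: wedge_def)
      qed (simp add: wedge_def)
      hence "sdiff N (\<lambda>_ _. 1) (wedge e (coef c ?t)) s = coef c ?t s"
        using sdiff_wedge_one[OF fs, of e N "coef c ?t"] e by (simp add: cone_def)
      then show ?thesis unfolding bh by (simp add: coef_def)
    next
      case False
      hence "Poly_Mapping.lookup (c s) u = 0" using cone[OF s] by (auto simp: in_keys_iff)
      then show ?thesis using False by (simp add: bh_def sdiff_def)
    qed
    finally show "Poly_Mapping.lookup (sdiff N cf b s) u = Poly_Mapping.lookup (c s) u" .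
  qed
  moreover have "b s \<in> carrier (poly_ring V)" if s: "s \<subseteq> {..<N}" "card s = Suc n" for s
    unfolding poly_ring_carrier_iff
  proof
    fix u assume "u \<in> Poly_Mapping.keys (b s)"
    hence "bh (u + L s) s \<noteq> 0" by (simp add: in_keys_iff b[OF s(1)])
    from bh_key[OF s(1) this] obtain e where e: "e \<in> s" "u + dl e (s - {e}) \<in> Poly_Mapping.keys (c (s - {e}))"
      by blast
    have "finite s" using s finite_subset by blast
    hence 1: "card (s - {e}) = n" using card_Suc_Diff1[OF _ e(1)] s(2) by simp
    have 2: "s - {e} \<subseteq> {..<N}" using s(1) by blast
    have "c (s - {e}) \<in> carrier (poly_ring V)" by (rule V[OF 2 1])
    hence "Poly_Mapping.keys (u + dl e (s - {e})) \<subseteq> V" using e(2) by (simp add: poly_ring_carrier_iff)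
    thus "Poly_Mapping.keys u \<subseteq> V" by (rule order_trans[OF keys_subset_keys_add])
  qed
  ultimately show ?thesis by blast
qed

lemma sdiff_cf_sdiff_cf:
  fixes c :: "nat set \<Rightarrow> ('v, 'k::comm_ring_1) mpol"
  assumes s: "s \<subseteq> {..<N}"
  shows "sdiff N cf (sdiff N cf c) s = 0"
proof (rule sdiff_sdiff)
  fix e f assume ef: "e \<notin> s" "f \<notin> s" "e \<noteq> f" "e < N" "f < N"
  have "L s + dl e s + dl f (insert e s) = L s + dl f s + dl e (insert f s)"
    using L_insert[of s e] L_insert[of s f] L_insert[of "insert e s" f] L_insert[of "insert f s" e] ef s
    by (simp add: insert_commute)
  hence "dl e s + dl f (insert e s) = dl f s + dl e (insert f s)" by (simp add: add.assoc)
  thus "(cf e s * cf f (insert e s) :: ('v, 'k) mpol) = cf f s * cf e (insert f s)"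
    by (simp add: cf_def mult_single)
qed (use s finite_subset in blast)

text \<open>Shifted by one because the ideal, not its quotient ring, is resolved: the empty set
  spans the target of the augmentation.\<close>

definition taylor_rank :: "nat \<Rightarrow> nat" where "taylor_rank i = length (ksub N (Suc i))"

definition taylor_aug :: "('v, 'k::comm_ring_1) mpol vec" where
  "taylor_aug = row (diff_mat N cf 0) 0"

definition taylor_diff :: "nat \<Rightarrow> ('v, 'k::comm_ring_1) mpol mat" where
  "taylor_diff i = diff_mat N cf i"

lemma ksub_0: "ksub N 0 = [{}]"
proof -
  have "{s. s \<subseteq> {..<N} \<and> card s = 0} = {{}}"
    by (auto dest: finite_subset)
  hence "set (ksub N 0) = {{}}" "distinct (ksub N 0)" using ksub[of N 0] by auto
  moreover from this have "length (ksub N 0) = 1" using distinct_card by fastforce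
  then obtain x where "ksub N 0 = [x]" by (auto simp: length_Suc_conv)
  ultimately show ?thesis by simp
qed

lemma diff_mat_ring_mat: "diff_mat N cf n \<in> ring_mat V (length (ksub N n)) (length (ksub N (Suc n)))"
  if V: "\<And>e s. e < N \<Longrightarrow> s \<subseteq> {..<N} \<Longrightarrow> Poly_Mapping.keys (dl e s) \<subseteq> V"
proof -
  have sg: "rsign e s \<in> carrier (poly_ring V)" for e s
    unfolding rsign_def by (cases "even (card {f \<in> s. f < e})") (auto simp: poly_ring_carrier_iff)
  have "cf e s \<in> carrier (poly_ring V)" if "e < N" "s \<subseteq> {..<N}" for e s
    using V[OF that] by (auto simp: poly_ring_carrier_iff cf_def)
  hence "rsign e s * cf e s \<in> carrier (poly_ring V)" if "e < N" "s \<subseteq> {..<N}" for e s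
    using that sg poly_ring_carrier_closed(2) by blast
  hence "rsign e (ksub N n ! i) * cf e (ksub N n ! i) \<in> carrier (poly_ring V)"
    if "e < N" "i < length (ksub N n)" for e i using that ksub_nth(1) by blast
  thus ?thesis unfolding ring_mat_iff diff_mat_def
    by (auto intro!: poly_ring_sum simp: poly_ring_zero_one)
qed

text \<open>In degrees divisible by no \<open>L {e}\<close> the ideal and the free modules of the
  resolution vanish; in all others a cone point makes the strand contractible.\<close>

theorem taylor_resolution:
  fixes V :: "'v set"
  assumes V: "\<And>e s. e < N \<Longrightarrow> s \<subseteq> {..<N} \<Longrightarrow> Poly_Mapping.keys (dl e s) \<subseteq> V"
    and L0: "L {} = 0"
    and cone: "\<And>t e. e < N \<Longrightarrow> mdvd (L {e}) t \<Longrightarrow> \<exists>e. cone t e"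
  shows "free_resolution V {p \<in> carrier (poly_ring V). \<forall>t\<in>Poly_Mapping.keys p. \<exists>e<N. mdvd (L {e}) t}
    taylor_rank (taylor_aug :: ('v, 'k::comm_ring_1) mpol vec) taylor_diff"
proof -
  let ?I = "{p \<in> carrier (poly_ring V :: ('v, 'k) mpol ring). \<forall>t\<in>Poly_Mapping.keys p. \<exists>e<N. mdvd (L {e}) t}"
  let ?D = "diff_mat N cf :: nat \<Rightarrow> ('v, 'k) mpol mat"
  let ?K = "\<lambda>n. length (ksub N n)"
  have D: "?D n \<in> ring_mat V (?K n) (?K (Suc n))" for n by (rule diff_mat_ring_mat[OF V])
  note Dc = ring_mat_carrier[OF D]
  \<comment> \<open>Labels are controlled only along insertions, so if \<open>e\<close> comes last
    it is first moved to the front of the insertion order.\<close>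
  have L_mono: "mdvd (L {e}) (L s)" if "s \<subseteq> {..<N}" "e \<in> s" for e s
  proof -
    have "finite s" using that finite_subset by blast
    thus ?thesis using that
    proof (induction s arbitrary: e)
      case (insert x s)
      have L: "L (insert x s) = L s + dl x s" using insert L_insert by auto
      show ?case
      proof (cases "e \<in> s")
        case True
        then show ?thesis unfolding L using insert mdvd_trans by (metis insert_subset mdvd_add(1))
      next
        case False
        hence e: "e = x" using insert by auto
        have "finite t \<Longrightarrow> t \<subseteq> {..<N} \<Longrightarrow> x \<notin> t \<Longrightarrow> x < N \<Longrightarrow> mdvd (L {x}) (L (insert x t))" for t
        proof (induction t rule: finite_induct)
          case (insert y t)
          have "L (insert y (insert x t)) = L (insert x t) + dl y (insert x t)"
            using insert by (intro L_insert) auto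
          hence "mdvd (L (insert x t)) (L (insert x (insert y t)))" by (simp add: insert_commute)
          then show ?case using insert mdvd_trans by blast
        qed (simp add: mdvd_iff)
        then show ?thesis unfolding e using insert by auto
      qed
    qed simp
  qed
  have free: "w \<in> free_mod V (?K n) \<longleftrightarrow> w \<in> carrier_vec (?K n) \<and>
      (\<forall>s. s \<subseteq> {..<N} \<and> card s = n \<longrightarrow> chain_of N w s \<in> carrier (poly_ring V))" for w :: "('v, 'k) mpol vec" and n
  proof -
    have "(\<forall>s. s \<subseteq> {..<N} \<and> card s = n \<longrightarrow> chain_of N w s \<in> carrier (poly_ring V)) \<longleftrightarrow>
       (\<forall>i<?K n. w $ i \<in> carrier (poly_ring V))" if "w \<in> carrier_vec (?K n)"
      using pos ksub_nth unfolding chain_of_def by metis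
    thus ?thesis unfolding free_mod_iff by blast
  qed
  \<comment> \<open>Surjectivity onto the ideal for \<open>n = 0\<close> and exactness for
    \<open>n > 0\<close> in one statement.\<close>
  have exact: "\<exists>w\<in>free_mod V (?K (Suc n)). ?D n *\<^sub>v w = z"
    if z: "z \<in> free_mod V (?K n)" and cyc: "n > 0 \<Longrightarrow> ?D (n - 1) *\<^sub>v z = 0\<^sub>v (?K (n - 1))"
      and I: "n = 0 \<Longrightarrow> z $ 0 \<in> ?I" for n z
  proof -
    let ?c = "chain_of N z"
    have zc: "z \<in> carrier_vec (?K n)" using z by (simp add: free_mod_iff)
    have "\<exists>b. (\<forall>s. s \<subseteq> {..<N} \<and> card s = Suc n \<longrightarrow> b s \<in> carrier (poly_ring V)) \<and>
      (\<forall>s. s \<subseteq> {..<N} \<and> card s = n \<longrightarrow> sdiff N cf b s = ?c s)"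
    proof (rule sdiff_exact)
      fix s assume s: "s \<subseteq> {..<N}" "Suc (card s) = n"
      have "vec_of N (n - 1) (sdiff N cf ?c) = 0\<^sub>v (?K (n - 1))"
        using diff_mat_mult[of z N "n - 1" cf] zc cyc s by auto
      also have "\<dots> = vec_of N (n - 1) (\<lambda>_. 0)" by (auto simp: vec_of_def)
      finally show "sdiff N cf ?c s = 0" using s unfolding vec_of_eq_iff by auto
    next
      fix s u assume s: "s \<subseteq> {..<N}" "card s = n" and u: "u \<in> Poly_Mapping.keys (?c s)"
      show "\<exists>e. cone (u + L s) e"
      proof (cases "s = {}")
        case True
        have "pos N {} = 0" using pos(1)[of "{}" N] ksub_0 by simp
        hence "u \<in> Poly_Mapping.keys (z $ 0)" using u True by (simp add: chain_of_def)
        then show ?thesis using I s True cone L0 by force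
      next
        case False
        then obtain e where e: "e \<in> s" by auto
        have "mdvd (L {e}) (u + L s)" by (rule mdvd_trans[OF L_mono[OF s(1) e] mdvd_add(2)])
        moreover have "e < N" using s e by auto
        ultimately show ?thesis using cone by blast
      qed
    next
      fix s assume "s \<subseteq> {..<N}" "card s = n"
      thus "?c s \<in> carrier (poly_ring V)" using z free by blast
    qed
    then obtain b where b: "\<And>s. s \<subseteq> {..<N} \<Longrightarrow> card s = Suc n \<Longrightarrow> b s \<in> carrier (poly_ring V)"
      "\<And>s. s \<subseteq> {..<N} \<Longrightarrow> card s = n \<Longrightarrow> sdiff N cf b s = ?c s" by blast
    have "vec_of N (Suc n) b \<in> free_mod V (?K (Suc n))"
      unfolding free using b(1) by (simp add: chain_of_vec_of)
    moreover have "?D n *\<^sub>v vec_of N (Suc n) b = vec_of N n (sdiff N cf (chain_of N (vec_of N (Suc n) b)))"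
      by (rule diff_mat_mult) simp
    moreover have "\<dots> = vec_of N n ?c"
    proof (rule vec_of_cong)
      fix s assume s: "s \<subseteq> {..<N}" "card s = n"
      have "finite s" using s finite_subset by blast
      hence "sdiff N cf (chain_of N (vec_of N (Suc n) b)) s = sdiff N cf b s"
        using s by (intro sdiff_cong chain_of_vec_of) auto
      thus "sdiff N cf (chain_of N (vec_of N (Suc n) b)) s = ?c s" using b(2) s by simp
    qed
    moreover have "\<dots> = z" by (rule vec_of_chain_of[OF zc])
    ultimately show ?thesis by metis
  qed
  have DD: "?D n *\<^sub>v (?D (Suc n) *\<^sub>v w) = 0\<^sub>v (?K n)" if w: "w \<in> free_mod V (?K (Suc (Suc n)))" for n w
  proof -
    have wc: "w \<in> carrier_vec (?K (Suc (Suc n)))" using w by (simp add: free_mod_iff)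
    have "?D n *\<^sub>v (?D (Suc n) *\<^sub>v w) = vec_of N n (sdiff N cf (chain_of N (?D (Suc n) *\<^sub>v w)))"
      using mult_mat_vec_carrier[OF Dc wc] by (rule diff_mat_mult)
    also have "\<dots> = vec_of N n (sdiff N cf (sdiff N cf (chain_of N w)))"
      unfolding diff_mat_mult[OF wc]
    proof (rule vec_of_cong)
      fix s assume s: "s \<subseteq> {..<N}" "card s = n"
      have "finite s" using s finite_subset by blast
      thus "sdiff N cf (chain_of N (vec_of N (Suc n) (sdiff N cf (chain_of N w)))) s =
         sdiff N cf (sdiff N cf (chain_of N w)) s"
        using s by (intro sdiff_cong chain_of_vec_of) auto
    qed
    also have "\<dots> = vec_of N n (\<lambda>_. 0)" by (intro vec_of_cong sdiff_cf_sdiff_cf)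
    finally show ?thesis by (auto simp: vec_of_def)
  qed
  have ex: "{w \<in> free_mod V (?K (Suc n)). ?D n *\<^sub>v w = 0\<^sub>v (?K n)} = (\<lambda>w. ?D (Suc n) *\<^sub>v w) ` free_mod V (?K (Suc (Suc n)))"
    for n
  proof (intro equalityI subsetI)
    fix w assume "w \<in> {w \<in> free_mod V (?K (Suc n)). ?D n *\<^sub>v w = 0\<^sub>v (?K n)}"
    hence "w \<in> free_mod V (?K (Suc n))" "?D n *\<^sub>v w = 0\<^sub>v (?K n)" by auto
    from exact[OF this(1)] this(2) show "w \<in> (\<lambda>w. ?D (Suc n) *\<^sub>v w) ` free_mod V (?K (Suc (Suc n)))" by auto
  next
    fix z assume "z \<in> (\<lambda>w. ?D (Suc n) *\<^sub>v w) ` free_mod V (?K (Suc (Suc n)))"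
    then obtain w where w: "w \<in> free_mod V (?K (Suc (Suc n)))" "z = ?D (Suc n) *\<^sub>v w" by blast
    show "z \<in> {w \<in> free_mod V (?K (Suc n)). ?D n *\<^sub>v w = 0\<^sub>v (?K n)}"
      using ring_mat_mult_vec[OF D w(1)] DD[OF w(1)] w(2) by blast
  qed
  have K0: "?K 0 = 1" using ksub_0 by simp
  have aug: "taylor_aug \<bullet> w = (?D 0 *\<^sub>v w) $ 0" for w :: "('v, 'k) mpol vec"
    using Dc[of 0] K0 unfolding taylor_aug_def by (simp add: mult_mat_vec_def)
  have D0w: "?D 0 *\<^sub>v w = 0\<^sub>v 1 \<longleftrightarrow> taylor_aug \<bullet> w = 0" for w :: "('v, 'k) mpol vec"
    using Dc[of 0] K0 unfolding aug vec_eq_iff by auto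
  have im: "(\<lambda>w. taylor_aug \<bullet> w) ` free_mod V (?K (Suc 0)) = ?I"
  proof (intro equalityI subsetI)
    fix p :: "('v, 'k) mpol" assume p: "p \<in> ?I"
    have "vec 1 (\<lambda>_. p) \<in> free_mod V (?K 0)" using p K0 by (auto simp: free_mod_iff)
    from exact[OF this] p obtain w where w: "w \<in> free_mod V (?K (Suc 0))" "?D 0 *\<^sub>v w = vec 1 (\<lambda>_. p)" by auto
    hence "taylor_aug \<bullet> w = p" by (simp add: aug)
    thus "p \<in> (\<lambda>w. taylor_aug \<bullet> w) ` free_mod V (?K (Suc 0))" using w(1) by blast
  next
    fix p :: "('v, 'k) mpol" assume "p \<in> (\<lambda>w. taylor_aug \<bullet> w) ` free_mod V (?K (Suc 0))"
    then obtain w where w: "w \<in> free_mod V (?K (Suc 0))" "p = taylor_aug \<bullet> w" by blast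
    have wc: "w \<in> carrier_vec (?K (Suc 0))" using w by (simp add: free_mod_iff)
    have "p = (?D 0 *\<^sub>v w) $ 0" using w aug by simp
    also have "\<dots> = sdiff N cf (chain_of N w) {}"
      unfolding diff_mat_mult[OF wc] vec_of_def using ksub_0 by simp
    finally have p: "p = sdiff N cf (chain_of N w) {}" .
    have "p \<in> carrier (poly_ring V)"
      using ring_mat_mult_vec[OF D[of 0] w(1)] w(2) K0 unfolding aug by (simp add: free_mod_iff)
    moreover have "\<exists>e<N. mdvd (L {e}) t" if "t \<in> Poly_Mapping.keys p" for t
    proof (rule ccontr)
      assume n: "\<not> (\<exists>e<N. mdvd (L {e}) t)"
      have "Poly_Mapping.lookup p t = sdiff N (\<lambda>_ _. 1) (coef (chain_of N w) (t + L {})) {}"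
        unfolding p by (rule lookup_sdiff) simp
      also have "\<dots> = 0" unfolding sdiff_def using n L0 by (intro sum.neutral) (auto simp: coef_def)
      finally show False using that by (simp add: in_keys_iff)
    qed
    ultimately show "p \<in> ?I" by blast
  qed
  have e: "(taylor_aug :: ('v, 'k) mpol vec) \<in> free_mod V (?K (Suc 0))"
    unfolding taylor_aug_def using D[of 0] K0 by (auto simp: free_mod_iff ring_mat_iff row_def)
  show ?thesis
    unfolding free_resolution_def taylor_rank_def taylor_diff_def
  proof (intro conjI allI impI)
    show "(taylor_aug :: ('v, 'k) mpol vec) \<in> free_mod V (?K (Suc 0))" by (rule e)
    show "(\<lambda>w. taylor_aug \<bullet> w) ` free_mod V (?K (Suc 0)) = ?I" by (rule im)
    show "{w \<in> free_mod V (?K (Suc 0)). taylor_aug \<bullet> w = 0} = (\<lambda>w. ?D 1 *\<^sub>v w) ` free_mod V (?K (Suc 1))"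
      using ex[of 0] D0w K0 by simp
    fix i :: nat assume i: "1 \<le> i"
    show "?D i \<in> carrier_mat (?K (Suc (i - 1))) (?K (Suc i))" "elements_mat (?D i) \<subseteq> carrier (poly_ring V)"
      using D[of i] i by (auto simp: ring_mat_def)
    show "{w \<in> free_mod V (?K (Suc i)). ?D i *\<^sub>v w = 0\<^sub>v (?K (Suc (i - 1)))} =
        (\<lambda>w. ?D (i + 1) *\<^sub>v w) ` free_mod V (?K (Suc (i + 1)))"
      using ex[of i] i by simp
  qed
qed

end

section \<open>Multigraded strands over the field\<close>

interpretation fv: vector_space "\<lambda>(k::'k::field) (c::'a \<Rightarrow> 'k) x. k * c x"
  by unfold_locales (simp_all add: fun_eq_iff algebra_simps)

locale covering_complex =
  fixes N :: nat and m :: "nat \<Rightarrow> 'w set" and type_k :: "'k::field itself"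
begin

definition U :: "nat set \<Rightarrow> 'w set" where "U s = (\<Union>e\<in>s. m e)"

lemma U_simps [simp]: "U {} = {}" "U (insert e s) = m e \<union> U s"
  by (auto simp: U_def)

text \<open>The constant term of the Taylor weight: the quotient of labels is 1 exactly if all
  vertices of \<open>e\<close> are covered already.\<close>

definition az :: "'w set \<Rightarrow> nat \<Rightarrow> nat set \<Rightarrow> 'k" where
  "az Z e s = (if m e \<subseteq> Z \<union> U s then 1 else 0)"

definition dz :: "'w set \<Rightarrow> (nat set \<Rightarrow> 'k) \<Rightarrow> nat set \<Rightarrow> 'k" where
  "dz Z = sdiff N (az Z)"

text \<open>The vertices of \<open>Z\<close> count as covered from the start. For \<open>Z = {}\<close> and the predicate \<open>\<lambda>V. V = W\<close>
  this is the strand in squarefree degree \<open>W\<close> of the Taylor complex tensored with the field.\<close>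

definition ch :: "('w set \<Rightarrow> bool) \<Rightarrow> nat set \<Rightarrow> 'w set \<Rightarrow> nat \<Rightarrow> (nat set \<Rightarrow> 'k) set" where
  "ch P E Z n = {c. \<forall>s. c s \<noteq> 0 \<longrightarrow> s \<subseteq> E \<and> card s = n \<and> P (U s \<union> Z)}"

lemma chI: "(\<And>s. c s \<noteq> 0 \<Longrightarrow> s \<subseteq> E \<and> card s = n \<and> P (U s \<union> Z)) \<Longrightarrow> c \<in> ch P E Z n"
  by (auto simp: ch_def)

lemma chD: "c \<in> ch P E Z n \<Longrightarrow> c s \<noteq> 0 \<Longrightarrow> s \<subseteq> E \<and> card s = n \<and> P (U s \<union> Z)"
  by (auto simp: ch_def)

lemma ch_0: "c \<in> ch P E Z n \<Longrightarrow> \<not> s \<subseteq> E \<Longrightarrow> c s = 0"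
  by (auto simp: ch_def)

lemma ch_mono: "E \<subseteq> E' \<Longrightarrow> ch P E Z n \<subseteq> ch P E' Z n"
  by (auto simp: ch_def)

lemma ch_zero: "(\<lambda>_. 0) \<in> ch P E Z n" "0 \<in> ch P E Z n"
  by (auto simp: ch_def)

lemma ch_lin:
  assumes "c \<in> ch P E Z n" "c' \<in> ch P E Z n"
  shows "(\<lambda>s. a * c s + b * c' s) \<in> ch P E Z n"
proof (rule chI)
  fix s assume "a * c s + b * c' s \<noteq> 0"
  hence "c s \<noteq> 0 \<or> c' s \<noteq> 0" by auto
  thus "s \<subseteq> E \<and> card s = n \<and> P (U s \<union> Z)" using assms chD by blast
qed

lemma ch_add: "c \<in> ch P E Z n \<Longrightarrow> c' \<in> ch P E Z n \<Longrightarrow> (\<lambda>s. c s + c' s) \<in> ch P E Z n"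
  using ch_lin[of c P E Z n c' 1 1] by simp

lemma ch_diff: "c \<in> ch P E Z n \<Longrightarrow> c' \<in> ch P E Z n \<Longrightarrow> (\<lambda>s. c s - c' s) \<in> ch P E Z n"
  using ch_lin[of c P E Z n c' 1 "-1"] by simp

lemma ch_uminus: "c \<in> ch P E Z n \<Longrightarrow> (\<lambda>s. - c s) \<in> ch P E Z n"
  using ch_lin[of c P E Z n c "-1" 0] by simp

lemma dz_lin: "dz Z (\<lambda>s. a * c s + b * c' s) = (\<lambda>s. a * dz Z c s + b * dz Z c' s)"
  unfolding dz_def sdiff_def sum_distrib_left
  by (rule ext, subst sum.distrib[symmetric], rule sum.cong) (simp_all add: algebra_simps)

lemma dz_add: "dz Z (\<lambda>s. c s + c' s) = (\<lambda>s. dz Z c s + dz Z c' s)"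
  using dz_lin[of Z 1 c 1 c'] by simp

lemma dz_diff: "dz Z (\<lambda>s. c s - c' s) = (\<lambda>s. dz Z c s - dz Z c' s)"
  using dz_lin[of Z 1 c "-1" c'] by simp

lemma dz_uminus: "dz Z (\<lambda>s. - c s) = (\<lambda>s. - dz Z c s)"
  using dz_lin[of Z "-1" c 0 c] by simp

lemma dz_zero: "dz Z (\<lambda>_. 0) = (\<lambda>_. 0)"
  by (rule ext) (simp add: dz_def sdiff_def)

lemma dz_ch:
  assumes c: "c \<in> ch P E Z (Suc n)" and E: "finite E"
  shows "dz Z c \<in> ch P E Z n"
proof (rule chI)
  fix s assume "dz Z c s \<noteq> 0"
  then obtain e where e: "e \<in> {..<N} - s" "rsign e s * az Z e s * c (insert e s) \<noteq> 0"
    unfolding dz_def sdiff_def by (meson sum.not_neutral_contains_not_neutral)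
  hence "c (insert e s) \<noteq> 0" and m: "m e \<subseteq> Z \<union> U s" by (auto simp: az_def split: if_splits)
  from chD[OF c this(1)] have *: "insert e s \<subseteq> E" "card (insert e s) = Suc n" "P (U (insert e s) \<union> Z)" by auto
  have "finite (insert e s)" using *(1) E by (rule finite_subset)
  hence "card s = n" using *(2) e by simp
  moreover have "U (insert e s) \<union> Z = U s \<union> Z" using m by auto
  hence "P (U s \<union> Z)" using *(3) by simp
  ultimately show "s \<subseteq> E \<and> card s = n \<and> P (U s \<union> Z)" using *(1) by simp
qed

lemma dz_dz:
  assumes c: "c \<in> ch P E Z n" and E: "finite E"
  shows "dz Z (dz Z c) = (\<lambda>_. 0)"
proof
  fix s
  show "dz Z (dz Z c) s = 0"
  proof (cases "finite s")
    case True
    show ?thesis unfolding dz_def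
      by (rule sdiff_sdiff[OF True]) (auto simp: az_def)
  next
    case False
    have "c (insert e (insert f s)) = 0" for e f
    proof (rule ch_0[OF c])
      show "\<not> insert e (insert f s) \<subseteq> E"
      proof
        assume "insert e (insert f s) \<subseteq> E"
        from finite_subset[OF this E] False show False by simp
      qed
    qed
    thus ?thesis by (simp add: dz_def sdiff_def)
  qed
qed

section \<open>Splitting off an edge\<close>

text \<open>A chain is \<open>rest\<close> plus \<open>e\<close> times \<open>top\<close>. Up to
  sign, the complex on \<open>E\<close> is the mapping cone of \<open>restr\<close>, which goes from
  the strand on \<open>E - {e}\<close> over \<open>Z \<union> m e\<close> to the one over
  \<open>Z\<close>.\<close>

definition rest :: "nat \<Rightarrow> (nat set \<Rightarrow> 'k) \<Rightarrow> nat set \<Rightarrow> 'k" where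
  "rest e c s = (if e \<in> s then 0 else c s)"

definition top :: "nat \<Rightarrow> (nat set \<Rightarrow> 'k) \<Rightarrow> nat set \<Rightarrow> 'k" where
  "top e c s = (if e \<in> s then 0 else rsign e s * c (insert e s))"

definition restr :: "'w set \<Rightarrow> nat \<Rightarrow> (nat set \<Rightarrow> 'k) \<Rightarrow> nat set \<Rightarrow> 'k" where
  "restr Z e c s = (if e \<in> s then 0 else az Z e s * c s)"

lemma rest_top: "c s = rest e c s + wedge e (top e c) s"
  by (simp add: rest_def top_def wedge_def insert_absorb)

lemma top_lin: "top e (\<lambda>s. a * c s + b * c' s) = (\<lambda>s. a * top e c s + b * top e c' s)"
  by (auto simp: top_def fun_eq_iff algebra_simps)

lemma rest_ch: "c \<in> ch P E Z n \<Longrightarrow> rest e c \<in> ch P (E - {e}) Z n"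
  by (rule chI) (auto simp: rest_def dest: chD split: if_splits)

lemma top_ch:
  assumes "c \<in> ch P E Z (Suc n)" "finite E"
  shows "top e c \<in> ch P (E - {e}) (Z \<union> m e) n"
proof (rule chI)
  fix s assume "top e c s \<noteq> 0"
  hence e: "e \<notin> s" and "c (insert e s) \<noteq> 0" by (auto simp: top_def split: if_splits)
  from chD[OF assms(1) this(2)] have *: "insert e s \<subseteq> E" "card (insert e s) = Suc n" "P (U (insert e s) \<union> Z)" by auto
  have "finite (insert e s)" using *(1) assms(2) by (rule finite_subset)
  hence "card s = n" using *(2) e by simp
  moreover have "U (insert e s) \<union> Z = U s \<union> (Z \<union> m e)" by auto
  hence "P (U s \<union> (Z \<union> m e))" using *(3) by simp
  moreover have "s \<subseteq> E - {e}" using *(1) e by auto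
  ultimately show "s \<subseteq> E - {e} \<and> card s = n \<and> P (U s \<union> (Z \<union> m e))" by simp
qed

lemma wedge_ch:
  assumes u: "u \<in> ch P (E - {e}) (Z \<union> m e) n" and E: "finite E" "e \<in> E"
  shows "wedge e u \<in> ch P E Z (Suc n)"
proof (rule chI)
  fix s assume "wedge e u s \<noteq> 0"
  hence e: "e \<in> s" and "u (s - {e}) \<noteq> 0" by (auto simp: wedge_def split: if_splits)
  from chD[OF u this(2)] have *: "s - {e} \<subseteq> E - {e}" "card (s - {e}) = n" "P (U (s - {e}) \<union> (Z \<union> m e))" by auto
  have Us: "U s = m e \<union> U (s - {e})" by (metis U_simps(2) insert_Diff e)
  have sE: "s \<subseteq> E" using *(1) E(2) by auto
  hence "finite s" using E(1) by (rule finite_subset)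
  hence "card s = Suc n" using *(2) e card_Suc_Diff1 by metis
  moreover have "U s \<union> Z = U (s - {e}) \<union> (Z \<union> m e)"
    using Us by auto
  hence "P (U s \<union> Z)" using *(3) by simp
  ultimately show "s \<subseteq> E \<and> card s = Suc n \<and> P (U s \<union> Z)" using sE by simp
qed

lemma restr_ch:
  assumes u: "u \<in> ch P (E - {e}) (Z \<union> m e) n"
  shows "restr Z e u \<in> ch P (E - {e}) Z n"
proof (rule chI)
  fix s assume "restr Z e u s \<noteq> 0"
  hence "u s \<noteq> 0" and "m e \<subseteq> Z \<union> U s" by (auto simp: restr_def az_def split: if_splits)
  moreover from this(2) have "U s \<union> (Z \<union> m e) = U s \<union> Z" by auto
  ultimately show "s \<subseteq> E - {e} \<and> card s = n \<and> P (U s \<union> Z)" using chD[OF u, of s] by auto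
qed

lemma dz_wedge:
  assumes u: "u \<in> ch P (E - {e}) Z' n" and E: "E \<subseteq> {..<N}" "e \<in> E"
  shows "dz Z (wedge e u) = (\<lambda>s. restr Z e u s - wedge e (dz (Z \<union> m e) u) s)"
proof
  fix s
  have u0: "u t = 0" if "e \<in> t" for t using that by (intro ch_0[OF u]) auto
  have eN: "e < N" using E by auto
  show "dz Z (wedge e u) s = restr Z e u s - wedge e (dz (Z \<union> m e) u) s"
  proof (cases "e \<in> s")
    case False
    then show ?thesis using eN by (simp add: dz_def sdiff_wedge_notin restr_def) (simp add: wedge_def)
  next
    case e: True
    show ?thesis
    proof (cases "finite s")
      case True
      have eq: "U s = m e \<union> U (s - {e})" using e U_simps(2)[of e "s - {e}"] by (simp add: insert_absorb)
      have "az (Z \<union> m e) f (s - {e}) = az Z f s" for f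
        unfolding az_def eq by (simp add: Un_ac)
      then show ?thesis
        using sdiff_wedge_in[OF True e, of u N "az (Z \<union> m e)" "az Z"] u0 e by (simp add: dz_def restr_def)
    next
      case False
      have fE: "finite E" using E finite_subset by blast
      have "u t = 0" if "infinite t" for t
        using that finite_subset[OF _ finite_Diff[OF fE], of t] by (intro ch_0[OF u]) blast
      hence "wedge e u (insert f s) = 0" "u (insert f (s - {e})) = 0" for f
        using False by (auto simp: wedge_def)
      then show ?thesis using e by (simp add: dz_def sdiff_def restr_def wedge_def)
    qed
  qed
qed

lemma dz_notin:
  assumes "c \<in> ch P (E - {e}) Z n" "e \<in> s"
  shows "dz Z' c s = 0"
  unfolding dz_def sdiff_def using assms by (intro sum.neutral) (auto simp: ch_def)

text \<open>Multiplication by \<open>e\<close> forgets the values on sets containing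
  \<open>e\<close>; these are compared by the second hypothesis.\<close>

lemma wedge_cancel:
  assumes "\<And>s. e \<in> s \<Longrightarrow> wedge e c s = wedge e c' s" "\<And>s. e \<in> s \<Longrightarrow> c s = c' s"
  shows "c = (c' :: nat set \<Rightarrow> 'k)"
proof
  fix s
  show "c s = c' s"
  proof (cases "e \<in> s")
    case False
    hence "rsign e s * c s = rsign e s * c' s" using assms(1)[of "insert e s"] by (simp add: wedge_def)
    hence "rsign e s * (rsign e s * c s) = rsign e s * (rsign e s * c' s)" by (rule arg_cong)
    then show ?thesis unfolding rsign_sq' .
  qed (rule assms)
qed

lemma dz_split:
  assumes c: "c \<in> ch P E Z (Suc n)" and E: "E \<subseteq> {..<N}" "e \<in> E"
  shows "dz Z c s = dz Z (rest e c) s + restr Z e (top e c) s - wedge e (dz (Z \<union> m e) (top e c)) s"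
proof -
  have fE: "finite E" using E finite_subset by blast
  have "c = (\<lambda>s. rest e c s + wedge e (top e c) s)" using rest_top[of c _ e] by auto
  hence "dz Z c = dz Z (\<lambda>s. rest e c s + wedge e (top e c) s)" by simp
  also have "\<dots> = (\<lambda>s. dz Z (rest e c) s + dz Z (wedge e (top e c)) s)" by (rule dz_add)
  finally show ?thesis unfolding dz_wedge[OF top_ch[OF c fE] E] by simp
qed

text \<open>The component of the differential on sets containing \<open>e\<close> involves
  \<open>top\<close> alone. Assuming no more than its vanishing lets the lemma apply to chains whose
  boundary merely avoids \<open>e\<close>.\<close>

lemma dz_top_cycle:
  assumes c: "c \<in> ch P E Z (Suc n)" and E: "E \<subseteq> {..<N}" "e \<in> E"
    and z: "\<And>s. e \<in> s \<Longrightarrow> dz Z c s = 0"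
  shows "dz (Z \<union> m e) (top e c) = (\<lambda>_. 0)"
proof (rule wedge_cancel[where e = e])
  have fE: "finite E" using E finite_subset by blast
  fix s assume e: "e \<in> s"
  show "dz (Z \<union> m e) (top e c) s = 0" by (rule dz_notin[OF top_ch[OF c fE] e])
  have "restr Z e (top e c) s = 0" using e by (simp add: restr_def)
  moreover have "dz Z (rest e c) s = 0" by (rule dz_notin[OF rest_ch[OF c] e])
  ultimately show "wedge e (dz (Z \<union> m e) (top e c)) s = wedge e (\<lambda>_. 0) s"
    using dz_split[OF c E, of s] z[OF e] by (simp add: wedge_def)
qed

text \<open>If the class of \<open>top\<close> vanishes, a boundary moves the chain off
  \<open>e\<close>. This is the step of the long exact sequence that the following proofs
  share.\<close>

lemma push_off:
  assumes c: "c \<in> ch P E Z (Suc n)" and E: "E \<subseteq> {..<N}" "e \<in> E"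
    and u: "u \<in> ch P (E - {e}) (Z \<union> m e) (Suc n)" "top e c = dz (Z \<union> m e) u"
  shows "(\<lambda>s. c s + dz Z (wedge e u) s) \<in> ch P (E - {e}) Z (Suc n)"
proof -
  have "c s + dz Z (wedge e u) s = rest e c s + restr Z e u s" for s
    using rest_top[of c s e] dz_wedge[OF u(1) E, of Z] u(2) by simp
  hence "(\<lambda>s. c s + dz Z (wedge e u) s) = (\<lambda>s. rest e c s + restr Z e u s)" by simp
  thus ?thesis using ch_add[OF rest_ch[OF c] restr_ch[OF u(1)]] by simp
qed

section \<open>Acyclicity, non-vanishing and generator bounds along the long exact sequence\<close>

definition acyc :: "('w set \<Rightarrow> bool) \<Rightarrow> nat set \<Rightarrow> 'w set \<Rightarrow> bool" where
  "acyc P E Z \<longleftrightarrow> (\<forall>n. \<forall>z\<in>ch P E Z n. dz Z z = (\<lambda>_. 0) \<longrightarrow> (\<exists>y\<in>ch P E Z (Suc n). z = dz Z y))"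

definition nonzero :: "('w set \<Rightarrow> bool) \<Rightarrow> nat set \<Rightarrow> 'w set \<Rightarrow> nat \<Rightarrow> bool" where
  "nonzero P E Z n \<longleftrightarrow> (\<exists>z\<in>ch P E Z n. dz Z z = (\<lambda>_. 0) \<and> \<not> (\<exists>y\<in>ch P E Z (Suc n). z = dz Z y))"

text \<open>The elements of \<open>G\<close> may be arbitrary functions, not only cycles: an upper
  bound just counts them.\<close>

definition spanned :: "('w set \<Rightarrow> bool) \<Rightarrow> nat set \<Rightarrow> 'w set \<Rightarrow> nat \<Rightarrow> nat \<Rightarrow> bool" where
  "spanned P E Z n b \<longleftrightarrow> (\<exists>G. finite G \<and> card G \<le> b \<and> (\<forall>z\<in>ch P E Z n. dz Z z = (\<lambda>_. 0) \<longrightarrow>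
     (\<exists>g\<in>fv.span G. \<exists>y\<in>ch P E Z (Suc n). z = (\<lambda>s. g s + dz Z y s))))"

lemma acycD: "acyc P E Z \<Longrightarrow> z \<in> ch P E Z n \<Longrightarrow> dz Z z = (\<lambda>_. 0) \<Longrightarrow> \<exists>y\<in>ch P E Z (Suc n). z = dz Z y"
  unfolding acyc_def by blast

lemma acyc_uncovered: "(\<And>s. s \<subseteq> E \<Longrightarrow> \<not> P (U s \<union> Z)) \<Longrightarrow> acyc P E Z"
  unfolding acyc_def
proof (intro allI ballI impI)
  fix n z assume P: "\<And>s. s \<subseteq> E \<Longrightarrow> \<not> P (U s \<union> Z)" and z: "z \<in> ch P E Z n"
  have "z = (\<lambda>_. 0)"
  proof
    fix s show "z s = 0" using P[of s] chD[OF z, of s] by blast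
  qed
  thus "\<exists>y\<in>ch P E Z (Suc n). z = dz Z y" using dz_zero ch_zero(1) by metis
qed

text \<open>An edge inside \<open>Z\<close> has weight 1 over every set, so multiplication by it
  contracts the complex.\<close>

lemma acyc_covered:
  assumes E: "E \<subseteq> {..<N}" "e \<in> E" and e: "m e \<subseteq> Z"
  shows "acyc P E Z"
  unfolding acyc_def
proof (intro allI ballI impI)
  fix n z assume z: "z \<in> ch P E Z n" and cyc: "dz Z z = (\<lambda>_. 0)"
  have fE: "finite E" using E finite_subset by blast
  have Z: "Z \<union> m e = Z" using e by auto
  \<comment> \<open>Multiplication by \<open>e\<close> depends only on \<open>rest e z\<close>, and
    the formula for its boundary wants a chain that avoids \<open>e\<close>.\<close>
  have rz: "rest e z \<in> ch P (E - {e}) (Z \<union> m e) n" using rest_ch[OF z] Z by simp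
  have restr: "restr Z e c = rest e c" for c using e by (auto simp: restr_def rest_def az_def fun_eq_iff)
  have "dz Z (wedge e (rest e z)) = z"
  proof
    fix s
    have r: "dz Z (wedge e (rest e z)) s = rest e z s - wedge e (dz Z (rest e z)) s"
      using dz_wedge[OF rz E, of Z] Z by (simp add: restr rest_def)
    show "dz Z (wedge e (rest e z)) s = z s"
    proof (cases n)
      case 0
      have "z s = 0" if "s \<noteq> {}" for s using chD[OF z, of s] that 0 fE finite_subset by fastforce
      hence "rest e z = z" "dz Z (rest e z) = (\<lambda>_. 0)"
        by (auto simp: rest_def dz_def sdiff_def fun_eq_iff)
      then show ?thesis unfolding r by (simp add: wedge_def)
    next
      case (Suc k)
      hence z': "z \<in> ch P E Z (Suc k)" using z by simp
      have "dz (Z \<union> m e) (top e z) = (\<lambda>_. 0)" using dz_top_cycle[OF z' E] cyc by simp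
      hence "dz Z (rest e z) t + top e z t = 0" for t
        using dz_split[OF z' E, of t] cyc Z by (simp add: restr wedge_def rest_def top_def split: if_splits)
      hence "wedge e (dz Z (rest e z)) s = - wedge e (top e z) s"
        by (auto simp: wedge_def eq_neg_iff_add_eq_0 simp flip: distrib_left)
      then show ?thesis unfolding r using rest_top[of z s e] by simp
    qed
  qed
  moreover have "wedge e (rest e z) \<in> ch P E Z (Suc n)" by (rule wedge_ch[OF rz fE E(2)])
  ultimately show "\<exists>y\<in>ch P E Z (Suc n). z = dz Z y" by metis
qed

text \<open>The outer terms of the long exact sequence vanish, hence so does the middle one.\<close>

lemma acyc_split:
  assumes E: "E \<subseteq> {..<N}" "e \<in> E" and a: "acyc P (E - {e}) Z" "acyc P (E - {e}) (Z \<union> m e)"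
  shows "acyc P E Z"
  unfolding acyc_def
proof (intro allI ballI impI)
  fix n z assume z: "z \<in> ch P E Z n" and cyc: "dz Z z = (\<lambda>_. 0)"
  have fE: "finite E" using E finite_subset by blast
  have sub: "ch P (E - {e}) Z k \<subseteq> ch P E Z k" for k by (rule ch_mono) auto
  show "\<exists>y\<in>ch P E Z (Suc n). z = dz Z y"
  proof (cases n)
    case 0
    have "z \<in> ch P (E - {e}) Z n"
      using z fE finite_subset 0 by (fastforce simp: ch_def)
    then show ?thesis using acycD[OF a(1) _ cyc] sub by blast
  next
    case (Suc k)
    hence z': "z \<in> ch P E Z (Suc k)" using z by simp
    have "dz (Z \<union> m e) (top e z) = (\<lambda>_. 0)" using dz_top_cycle[OF z' E] cyc by simp
    from acycD[OF a(2) top_ch[OF z' fE] this] obtain u where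
      u: "u \<in> ch P (E - {e}) (Z \<union> m e) (Suc k)" "top e z = dz (Z \<union> m e) u" by blast
    have w: "wedge e u \<in> ch P E Z (Suc n)" using wedge_ch[OF u(1) fE E(2)] Suc by simp
    have "(\<lambda>s. z s + dz Z (wedge e u) s) \<in> ch P (E - {e}) Z n" using push_off[OF z' E u] Suc by simp
    moreover have "dz Z (\<lambda>s. z s + dz Z (wedge e u) s) = (\<lambda>_. 0)"
      unfolding dz_add cyc dz_dz[OF w fE] by simp
    ultimately obtain y where y: "y \<in> ch P (E - {e}) Z (Suc n)" "(\<lambda>s. z s + dz Z (wedge e u) s) = dz Z y"
      using acycD[OF a(1)] by blast
    have "z = dz Z (\<lambda>s. y s - wedge e u s)"
      unfolding dz_diff y(2)[symmetric] by simp
    moreover have "(\<lambda>s. y s - wedge e u s) \<in> ch P E Z (Suc n)" using ch_diff[OF _ w] y(1) sub by blast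
    ultimately show ?thesis by blast
  qed
qed

text \<open>The inclusion of the strand without \<open>e\<close> is injective on homology, as its
  kernel comes from the homology over \<open>Z \<union> m e\<close>, which vanishes.\<close>

lemma nonzero_drop:
  assumes E: "E \<subseteq> {..<N}" "e \<in> E" and a: "acyc P (E - {e}) (Z \<union> m e)" and nz: "nonzero P (E - {e}) Z n"
  shows "nonzero P E Z n"
proof -
  have fE: "finite E" using E finite_subset by blast
  obtain z where z: "z \<in> ch P (E - {e}) Z n" "dz Z z = (\<lambda>_. 0)" "\<not> (\<exists>y\<in>ch P (E - {e}) Z (Suc n). z = dz Z y)"
    using nz unfolding nonzero_def by blast
  have "\<not> (\<exists>y\<in>ch P E Z (Suc n). z = dz Z y)"
  proof
    assume "\<exists>y\<in>ch P E Z (Suc n). z = dz Z y"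
    then obtain y where y: "y \<in> ch P E Z (Suc n)" "z = dz Z y" by blast
    have "dz (Z \<union> m e) (top e y) = (\<lambda>_. 0)"
    proof (rule dz_top_cycle[OF y(1) E])
      fix s assume "e \<in> s"
      thus "dz Z y s = 0" unfolding y(2)[symmetric] by (intro ch_0[OF z(1)]) auto
    qed
    from acycD[OF a top_ch[OF y(1) fE] this] obtain u where
      u: "u \<in> ch P (E - {e}) (Z \<union> m e) (Suc n)" "top e y = dz (Z \<union> m e) u" by blast
    have w: "wedge e u \<in> ch P E Z (Suc (Suc n))" using wedge_ch[OF u(1) fE E(2)] .
    have "(\<lambda>s. y s + dz Z (wedge e u) s) \<in> ch P (E - {e}) Z (Suc n)" using push_off[OF y(1) E u] .
    moreover have "z = dz Z (\<lambda>s. y s + dz Z (wedge e u) s)"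
      unfolding dz_add dz_dz[OF w fE] y(2)[symmetric] by simp
    ultimately show False using z(3) by blast
  qed
  moreover have "z \<in> ch P E Z n" using z(1) ch_mono[of "E - {e}" E] by auto
  ultimately show ?thesis unfolding nonzero_def using z(2) by blast
qed

text \<open>Here the other outer term vanishes, so every class over \<open>Z \<union> m e\<close>
  lifts: \<open>restr Z e u\<close> bounds some \<open>v\<close>, and \<open>wedge e u - v\<close>
  is a cycle with top part \<open>u\<close>.\<close>

lemma nonzero_wedge:
  assumes E: "E \<subseteq> {..<N}" "e \<in> E" and a: "acyc P (E - {e}) Z" and nz: "nonzero P (E - {e}) (Z \<union> m e) n"
  shows "nonzero P E Z (Suc n)"
proof -
  have fE: "finite E" and fE': "finite (E - {e})" using E finite_subset by blast+
  obtain u where u: "u \<in> ch P (E - {e}) (Z \<union> m e) n" "dz (Z \<union> m e) u = (\<lambda>_. 0)"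
    "\<not> (\<exists>y\<in>ch P (E - {e}) (Z \<union> m e) (Suc n). u = dz (Z \<union> m e) y)"
    using nz unfolding nonzero_def by blast
  have w: "wedge e u \<in> ch P E Z (Suc n)" using wedge_ch[OF u(1) fE E(2)] .
  have dw: "dz Z (wedge e u) = restr Z e u" unfolding dz_wedge[OF u(1) E] u(2) by (auto simp: wedge_def)
  have "dz Z (restr Z e u) = (\<lambda>_. 0)" using dz_dz[OF w fE] dw by simp
  from acycD[OF a restr_ch[OF u(1)] this] obtain v where
    v: "v \<in> ch P (E - {e}) Z (Suc n)" "restr Z e u = dz Z v" by blast
  define z where "z s = wedge e u s - v s" for s
  have z: "z \<in> ch P E Z (Suc n)" unfolding z_def using ch_diff[OF w] v(1) ch_mono[of "E - {e}" E] by blast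
  have "dz Z z = (\<lambda>_. 0)" unfolding z_def dz_diff dw v(2) by simp
  moreover have "\<not> (\<exists>y\<in>ch P E Z (Suc (Suc n)). z = dz Z y)"
  proof
    assume "\<exists>y\<in>ch P E Z (Suc (Suc n)). z = dz Z y"
    then obtain y where y: "y \<in> ch P E Z (Suc (Suc n))" "z = dz Z y" by blast
    have ty: "top e y \<in> ch P (E - {e}) (Z \<union> m e) (Suc n)" by (rule top_ch[OF y(1) fE])
    have "u = (\<lambda>s. - dz (Z \<union> m e) (top e y) s)"
    proof (rule wedge_cancel[where e = e])
      fix s assume e: "e \<in> s"
      have "u s = 0" using e by (intro ch_0[OF u(1)]) auto
      thus "u s = - dz (Z \<union> m e) (top e y) s" using dz_notin[OF ty e] by simp
      have "v s = 0" using e by (intro ch_0[OF v(1)]) auto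
      hence "wedge e u s = dz Z y s" using y(2) by (simp add: z_def fun_eq_iff) (metis diff_zero)
      also have "\<dots> = - wedge e (dz (Z \<union> m e) (top e y)) s"
        using dz_split[OF y(1) E, of s] dz_notin[OF rest_ch[OF y(1)] e] e by (simp add: restr_def)
      finally show "wedge e u s = wedge e (\<lambda>s. - dz (Z \<union> m e) (top e y) s) s" using e by (simp add: wedge_def)
    qed
    also have "\<dots> = dz (Z \<union> m e) (\<lambda>s. - top e y s)" by (simp add: dz_uminus)
    finally show False using u(3) ch_uminus[OF ty] by blast
  qed
  ultimately show ?thesis unfolding nonzero_def using z by blast
qed

lemma nonzero_empty:
  assumes "P Z"
  shows "nonzero P {} Z 0"
proof -
  let ?z = "\<lambda>s. if s = {} then 1 else 0 :: 'k"
  have 1: "?z \<in> ch P {} Z 0" using assms by (intro chI) (auto split: if_splits)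
  have 2: "dz Z ?z = (\<lambda>_. 0)" by (rule ext) (simp add: dz_def sdiff_def)
  have 3: "?z \<noteq> dz Z y" if y: "y \<in> ch P {} Z (Suc 0)" for y
  proof
    assume eq: "?z = dz Z y"
    have "y (insert e {}) = 0" for e by (rule ch_0[OF y]) simp
    hence "dz Z y {} = 0" by (simp add: dz_def sdiff_def)
    thus False using fun_cong[OF eq, of "{}"] by simp
  qed
  show ?thesis unfolding nonzero_def using 1 2 3 by (intro bexI[of _ ?z]) auto
qed

lemma spanned_acyc: "acyc P E Z \<Longrightarrow> spanned P E Z n 0"
  unfolding spanned_def by (intro exI[of _ "{}"]) (auto dest: acycD)

lemma spanned_mono: "spanned P E Z n b \<Longrightarrow> b \<le> b' \<Longrightarrow> spanned P E Z n b'"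
  unfolding spanned_def using le_trans by blast

text \<open>In degree 0 only the empty set occurs, so a further edge adds boundaries but no
  chains.\<close>

lemma spanned_0_drop:
  assumes E: "E \<subseteq> {..<N}" and sp: "spanned P (E - {e}) Z 0 b"
  shows "spanned P E Z 0 b"
proof -
  have fE: "finite E" using E finite_subset by blast
  have "ch P E Z 0 \<subseteq> ch P (E - {e}) Z 0"
    using fE finite_subset by (fastforce simp: ch_def)
  moreover have "ch P (E - {e}) Z (Suc 0) \<subseteq> ch P E Z (Suc 0)" by (rule ch_mono) auto
  ultimately show ?thesis using sp unfolding spanned_def by (meson subsetD)
qed

text \<open>Subadditivity of dimension in the long exact sequence, in terms of generators.\<close>

lemma spanned_split:
  assumes E: "E \<subseteq> {..<N}" "e \<in> E"
    and s1: "spanned P (E - {e}) Z (Suc k) b1" and s2: "spanned P (E - {e}) (Z \<union> m e) k b2"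
  shows "spanned P E Z (Suc k) (b1 + b2)"
proof -
  let ?E = "E - {e}" and ?Z = "Z \<union> m e"
  have fE: "finite E" using E finite_subset by blast
  have sub: "ch P ?E Z n \<subseteq> ch P E Z n" for n by (rule ch_mono) auto
  obtain G1 where G1: "finite G1" "card G1 \<le> b1"
    "\<And>z. z \<in> ch P ?E Z (Suc k) \<Longrightarrow> dz Z z = (\<lambda>_. 0) \<Longrightarrow>
       \<exists>g\<in>fv.span G1. \<exists>y\<in>ch P ?E Z (Suc (Suc k)). z = (\<lambda>s. g s + dz Z y s)"
    using s1 unfolding spanned_def by blast
  obtain G2 where G2: "finite G2" "card G2 \<le> b2"
    "\<And>z. z \<in> ch P ?E ?Z k \<Longrightarrow> dz ?Z z = (\<lambda>_. 0) \<Longrightarrow>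
       \<exists>g\<in>fv.span G2. \<exists>y\<in>ch P ?E ?Z (Suc k). z = (\<lambda>s. g s + dz ?Z y s)"
    using s2 unfolding spanned_def by blast
  define lifts where "lifts g zz \<longleftrightarrow> zz \<in> ch P E Z (Suc k) \<and> dz Z zz = (\<lambda>_. 0) \<and>
    (\<exists>y\<in>ch P ?E ?Z (Suc k). top e zz = (\<lambda>s. g s + dz ?Z y s))" for g zz
  \<comment> \<open>Not every class over \<open>Z \<union> m e\<close> lifts to a cycle. Only the
    liftable part of the span of \<open>G2\<close> counts, and a basis of what it spans has at most
    \<open>card G2\<close> elements.\<close>
  define V where "V = {g \<in> fv.span G2. \<exists>zz. lifts g zz}"
  obtain B where B: "B \<subseteq> V" "fv.independent B" "V \<subseteq> fv.span B"
    using fv.maximal_independent_subset[of V] by blast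
  have "B \<subseteq> fv.span G2" using B(1) V_def by auto
  with B(2) G2(1) have fB: "finite B" and cB: "card B \<le> card G2"
    using fv.independent_span_bound by blast+
  have "\<forall>g\<in>B. \<exists>zz. lifts g zz" using B(1) V_def by auto
  then obtain Z1 where Z1: "\<And>g. g \<in> B \<Longrightarrow> lifts g (Z1 g)" by metis
  have lifts_lin: "lifts (\<lambda>s. a * g s + b * g' s) (\<lambda>s. a * z s + b * z' s)" if l: "lifts g z" "lifts g' z'" for g g' z z' a b
  proof -
    obtain y y' where y: "y \<in> ch P ?E ?Z (Suc k)" "top e z = (\<lambda>s. g s + dz ?Z y s)"
      "y' \<in> ch P ?E ?Z (Suc k)" "top e z' = (\<lambda>s. g' s + dz ?Z y' s)"
      using l unfolding lifts_def by blast
    have "top e (\<lambda>s. a * z s + b * z' s) = (\<lambda>s. (a * g s + b * g' s) + dz ?Z (\<lambda>s. a * y s + b * y' s) s)"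
      unfolding top_lin dz_lin y(2,4) by (auto simp: algebra_simps)
    moreover have "(\<lambda>s. a * y s + b * y' s) \<in> ch P ?E ?Z (Suc k)" using ch_lin y(1,3) by blast
    moreover have "(\<lambda>s. a * z s + b * z' s) \<in> ch P E Z (Suc k)" using ch_lin l unfolding lifts_def by blast
    moreover have "dz Z (\<lambda>s. a * z s + b * z' s) = (\<lambda>_. 0)" unfolding dz_lin using l unfolding lifts_def by simp
    ultimately show ?thesis unfolding lifts_def by blast
  qed
  \<comment> \<open>Lifting is linear: the elements with a lift in the span of the chosen lifts form
    a subspace that contains \<open>B\<close>, hence \<open>V\<close>.\<close>
  define T where "T = {g. \<exists>zz\<in>fv.span (Z1 ` B). lifts g zz}"
  have "fv.subspace T"
    unfolding fv.subspace_def
  proof (intro conjI ballI allI)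
    have "top e (\<lambda>_. 0) = (\<lambda>s. 0 s + dz ?Z (\<lambda>_. 0) s)" unfolding dz_zero by (auto simp: top_def)
    hence "lifts 0 0" unfolding lifts_def using ch_zero(1) dz_zero
      by (auto simp: zero_fun_def intro!: bexI[of _ "\<lambda>_. 0"])
    thus "0 \<in> T" unfolding T_def using fv.span_zero by blast
    fix g g' assume "g \<in> T" "g' \<in> T"
    then obtain z z' where z: "z \<in> fv.span (Z1 ` B)" "z' \<in> fv.span (Z1 ` B)" "lifts g z" "lifts g' z'"
      unfolding T_def by blast
    have "lifts (g + g') (z + z')" using lifts_lin[OF z(3,4), of 1 1] by (simp add: plus_fun_def)
    thus "g + g' \<in> T" unfolding T_def using fv.span_add[OF z(1,2)] by blast
  next
    fix a g assume "g \<in> T"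
    then obtain z where z: "z \<in> fv.span (Z1 ` B)" "lifts g z" unfolding T_def by blast
    have "lifts (\<lambda>s. a * g s) (\<lambda>s. a * z s)" using lifts_lin[OF z(2,2), of a 0] by simp
    thus "(\<lambda>s. a * g s) \<in> T" unfolding T_def using fv.span_scale[OF z(1), of a] by blast
  qed
  moreover have "B \<subseteq> T" unfolding T_def using Z1 fv.span_base by blast
  ultimately have T: "fv.span B \<subseteq> T" using fv.span_minimal by blast
  define G where "G = G1 \<union> Z1 ` B"
  have "card G \<le> card G1 + card (Z1 ` B)" unfolding G_def by (rule card_Un_le)
  also have "\<dots> \<le> b1 + b2" using card_image_le[OF fB, of Z1] cB G1(2) G2(2) by linarith
  finally have cG: "card G \<le> b1 + b2" .
  have fG: "finite G" unfolding G_def using fB G1(1) by blast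
  have "\<exists>g\<in>fv.span G. \<exists>y\<in>ch P E Z (Suc (Suc k)). z = (\<lambda>s. g s + dz Z y s)"
    if z: "z \<in> ch P E Z (Suc k)" and cyc: "dz Z z = (\<lambda>_. 0)" for z
  proof -
    have "dz ?Z (top e z) = (\<lambda>_. 0)" using dz_top_cycle[OF z E] cyc by simp
    from G2(3)[OF top_ch[OF z fE] this] obtain g y where
      g: "g \<in> fv.span G2" and y: "y \<in> ch P ?E ?Z (Suc k)" "top e z = (\<lambda>s. g s + dz ?Z y s)" by blast
    have lz: "lifts g z" unfolding lifts_def using z cyc y by blast
    hence "g \<in> V" unfolding V_def using g by blast
    hence "g \<in> T" using B(3) T by blast
    then obtain zz where zz: "zz \<in> fv.span (Z1 ` B)" "lifts g zz" unfolding T_def by blast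
    \<comment> \<open>Two lifts of the same \<open>g\<close> differ by a cycle whose top part is a
      boundary; it can be pushed off \<open>e\<close> and is then spanned by
      \<open>G1\<close>.\<close>
    have "lifts (\<lambda>s. 1 * g s + (-1) * g s) (\<lambda>s. 1 * z s + (-1) * zz s)" by (rule lifts_lin[OF lz zz(2)])
    hence "lifts (\<lambda>_. 0) (\<lambda>s. z s - zz s)" by simp
    then obtain u where u: "u \<in> ch P ?E ?Z (Suc k)" "top e (\<lambda>s. z s - zz s) = dz ?Z u"
      and z': "(\<lambda>s. z s - zz s) \<in> ch P E Z (Suc k)" "dz Z (\<lambda>s. z s - zz s) = (\<lambda>_. 0)"
      unfolding lifts_def by auto
    have w: "wedge e u \<in> ch P E Z (Suc (Suc k))" by (rule wedge_ch[OF u(1) fE E(2)])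
    have c: "(\<lambda>s. (z s - zz s) + dz Z (wedge e u) s) \<in> ch P ?E Z (Suc k)" by (rule push_off[OF z'(1) E u])
    have "dz Z (\<lambda>s. (z s - zz s) + dz Z (wedge e u) s) = (\<lambda>_. 0)"
      unfolding dz_add z'(2) dz_dz[OF w fE] by simp
    from G1(3)[OF c this] obtain g1 y1 where g1: "g1 \<in> fv.span G1" and y1: "y1 \<in> ch P ?E Z (Suc (Suc k))"
      "(\<lambda>s. (z s - zz s) + dz Z (wedge e u) s) = (\<lambda>s. g1 s + dz Z y1 s)" by blast
    have "z s = (g1 + zz) s + dz Z (\<lambda>s. y1 s - wedge e u s) s" for s
      using fun_cong[OF y1(2), of s] unfolding dz_diff by (simp add: algebra_simps)
    moreover have "g1 + zz \<in> fv.span G"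
      using fv.span_add[of g1 G zz] fv.span_mono[of G1 G] fv.span_mono[of "Z1 ` B" G] g1 zz(1)
      unfolding G_def by blast
    moreover have "(\<lambda>s. y1 s - wedge e u s) \<in> ch P E Z (Suc (Suc k))" using ch_diff[OF _ w] y1(1) sub by blast
    ultimately show ?thesis by blast
  qed
  thus ?thesis unfolding spanned_def using fG cG by blast
qed

lemma spanned_drop:
  assumes E: "E \<subseteq> {..<N}" "e \<in> E" and a: "acyc P (E - {e}) (Z \<union> m e)" and sp: "spanned P (E - {e}) Z n b"
  shows "spanned P E Z n b"
proof (cases n)
  case 0
  then show ?thesis using spanned_0_drop[OF E(1)] sp by simp
next
  case (Suc k)
  then show ?thesis using spanned_split[OF E, of P Z k b 0] spanned_acyc[OF a] sp by simp
qed

text \<open>The number of chains is the bound; Pascal's rule matches the two terms of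
  \<open>spanned_split\<close>.\<close>

lemma spanned_choose:
  assumes "E \<subseteq> {..<N}"
  shows "spanned P E Z n (card E choose n)"
proof -
  have "finite E" using assms finite_subset by blast
  thus ?thesis using assms
  proof (induction E arbitrary: Z n rule: finite_induct)
    case empty
    show ?case
    proof (cases n)
      case 0
      let ?g = "\<lambda>s. if s = {} then 1 else 0 :: 'k"
      have "\<exists>g\<in>fv.span {?g}. \<exists>y\<in>ch P {} Z (Suc 0). z = (\<lambda>s. g s + dz Z y s)" if z: "z \<in> ch P {} Z 0" for z
      proof -
        have "z = (\<lambda>s. z {} * ?g s)"
        proof
          fix s show "z s = z {} * ?g s" using ch_0[OF z, of s] by (cases "s = {}") auto
        qed
        hence "z = (\<lambda>s. (\<lambda>s. z {} * ?g s) s + dz Z (\<lambda>_. 0) s)" by (simp add: dz_zero)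
        moreover have "(\<lambda>s. z {} * ?g s) \<in> fv.span {?g}" using fv.span_scale[OF fv.span_base[of ?g "{?g}"]] by simp
        ultimately show ?thesis by (intro bexI[of _ "\<lambda>s. z {} * ?g s"] bexI[of _ "\<lambda>_. 0"] ch_zero(1))
      qed
      then show ?thesis unfolding spanned_def 0 by (intro exI[of _ "{?g}"]) auto
    next
      case (Suc k)
      have "z = (\<lambda>s. 0 s + dz Z (\<lambda>_. 0) s)" if z: "z \<in> ch P {} Z (Suc k)" for z
        using z by (auto simp: ch_def dz_zero fun_eq_iff)
      then show ?thesis unfolding spanned_def Suc
        using fv.span_zero ch_zero(1) by (intro exI[of _ "{}"]) fastforce
    qed
  next
    case (insert e E)
    hence E: "insert e E \<subseteq> {..<N}" "e \<in> insert e E" and del: "insert e E - {e} = E" by auto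
    show ?case
    proof (cases n)
      case 0
      then show ?thesis using spanned_0_drop[OF E(1), of P e Z] insert.IH[of Z 0] insert.prems del by simp
    next
      case (Suc k)
      have "spanned P (insert e E) Z (Suc k) ((card E choose Suc k) + (card E choose k))"
        using insert.IH insert.prems del by (intro spanned_split[OF E]) auto
      then show ?thesis using insert.hyps Suc by (simp add: add.commute)
    qed
  qed
qed

text \<open>If \<open>m g\<close> lies in \<open>Z \<union> m f\<close>, then splitting off
  \<open>f\<close> covers \<open>g\<close> and the outer term becomes acyclic, so \<open>f\<close>
  can be added without harm. The predicate \<open>Q\<close> lets three properties share the
  induction.\<close>

lemma dominated_induct:
  assumes E: "E \<subseteq> {..<N}" "E' \<subseteq> E" and dom: "\<And>f. f \<in> E - E' \<Longrightarrow> \<exists>g\<in>E'. m g \<subseteq> Z \<union> m f"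
    and step: "\<And>A f. A \<subseteq> {..<N} \<Longrightarrow> f \<in> A \<Longrightarrow> acyc P (A - {f}) (Z \<union> m f) \<Longrightarrow> Q (A - {f}) \<Longrightarrow> Q A"
    and Q: "Q E'"
  shows "Q E"
proof -
  have "finite (E - E')" using E finite_subset by blast
  have "F \<subseteq> E - E' \<Longrightarrow> Q (E' \<union> F)" if "finite F" for F
    using that
  proof (induction F rule: finite_induct)
    case (insert f F)
    have f: "f \<in> E - E'" using insert by auto
    then obtain g where g: "g \<in> E'" "m g \<subseteq> Z \<union> m f" using dom by blast
    have del: "E' \<union> insert f F - {f} = E' \<union> F" using insert f by auto
    show ?case
    proof (rule step)
      show A: "E' \<union> insert f F \<subseteq> {..<N}" using E insert by auto
      show "acyc P (E' \<union> insert f F - {f}) (Z \<union> m f)"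
        unfolding del using A g by (intro acyc_covered[of _ g]) auto
      show "Q (E' \<union> insert f F - {f})" unfolding del using insert by auto
    qed simp
  qed (use Q in simp)
  from this[OF \<open>finite (E - E')\<close> order.refl] show ?thesis using E(2) by (simp add: Un_absorb1)
qed

lemma spanned_dominated:
  assumes "E \<subseteq> {..<N}" "E' \<subseteq> E" "\<And>f. f \<in> E - E' \<Longrightarrow> \<exists>g\<in>E'. m g \<subseteq> Z \<union> m f" "spanned P E' Z n b"
  shows "spanned P E Z n b"
  using dominated_induct[of E E' Z P "\<lambda>A. spanned P A Z n b"] assms spanned_drop by blast

lemma nonzero_dominated:
  assumes "E \<subseteq> {..<N}" "E' \<subseteq> E" "\<And>f. f \<in> E - E' \<Longrightarrow> \<exists>g\<in>E'. m g \<subseteq> Z \<union> m f" "nonzero P E' Z n"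
  shows "nonzero P E Z n"
  using dominated_induct[of E E' Z P "\<lambda>A. nonzero P A Z n"] assms nonzero_drop by blast

lemma acyc_dominated:
  assumes "E \<subseteq> {..<N}" "E' \<subseteq> E" "\<And>f. f \<in> E - E' \<Longrightarrow> \<exists>g\<in>E'. m g \<subseteq> Z \<union> m f" "acyc P E' Z"
  shows "acyc P E Z"
  using dominated_induct[of E E' Z P "\<lambda>A. acyc P A Z"] assms acyc_split by blast

end

section \<open>From strands to Betti numbers\<close>

lemma sum_fun_app: "(\<Sum>i\<in>A. f i) x = (\<Sum>i\<in>A. f i x :: 'b::comm_monoid_add)"
  by (induction A rule: infinite_finite_induct) auto

lemma diff_mat_cong:
  assumes "\<And>e s. s \<subseteq> {..<N} \<Longrightarrow> e < N \<Longrightarrow> a e s = a' e s"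
  shows "diff_mat N a n = diff_mat N a' n"
  unfolding diff_mat_def using assms by (intro eq_matI) (auto simp: ksub_nth intro!: sum.cong)

text \<open>The label of a set of vertices is the monomial obtained after the substitution \<open>sp\<close> of
  variables. For \<open>sp = id\<close> this gives the Taylor complex of an edge ideal; in general it is the image
  of that complex under the substitution.\<close>

locale edge_labels = covering_complex N m type_k
  for N :: nat and m :: "nat \<Rightarrow> 'w set" and type_k :: "'k::field itself" +
  fixes sp :: "'w \<Rightarrow> 'v"
  assumes fin_m: "\<And>e. e < N \<Longrightarrow> finite (m e)" and ne_m: "\<And>e. e < N \<Longrightarrow> m e \<noteq> {}"
begin

definition lab :: "'w set \<Rightarrow> 'v \<Rightarrow>\<^sub>0 nat" where
  "lab A = (\<Sum>w\<in>A. Poly_Mapping.single (sp w) 1)"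

lemma fin_U: "s \<subseteq> {..<N} \<Longrightarrow> finite (U s)"
  unfolding U_def using fin_m finite_subset[of s "{..<N}"] by auto

lemma lab_Un: "finite A \<Longrightarrow> finite B \<Longrightarrow> lab (A \<union> B) = lab B + lab (A - B)"
  unfolding lab_def using sum.union_disjoint[of B "A - B"] by (simp add: Un_commute)

lemma lookup_lab: "finite A \<Longrightarrow> Poly_Mapping.lookup (lab A) v = card {w \<in> A. sp w = v}"
proof -
  assume A: "finite A"
  have "Poly_Mapping.lookup (lab A) v = (\<Sum>w\<in>A. if sp w = v then 1 else 0)"
    unfolding lab_def lookup_sum lookup_single by (auto simp: when_def intro!: sum.cong)
  also have "\<dots> = card {w \<in> A. sp w = v}" using A by (simp add: sum.If_cases Int_def)
  finally show ?thesis .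
qed

lemma lab_eq_0: assumes A: "finite A" shows "lab A = 0 \<longleftrightarrow> A = {}"
proof
  assume 0: "lab A = 0"
  show "A = {}"
  proof (rule ccontr)
    assume "A \<noteq> {}"
    then obtain w where w: "w \<in> A" by auto
    have "card {x \<in> A. sp x = sp w} = 0" using lookup_lab[OF A, of "sp w"] 0 by simp
    thus False using A w by auto
  qed
qed (simp add: lab_def)

lemma keys_lab: "finite A \<Longrightarrow> Poly_Mapping.keys (lab A) = sp ` A"
  using lookup_lab[of A] by (auto simp: in_keys_iff card_eq_0_iff)

sublocale labelled_subsets N "\<lambda>s. lab (U s)" "\<lambda>e s. lab (m e - U s)"
proof
  fix e s assume "s \<subseteq> {..<N}" "e < N" "e \<notin> s"
  thus "lab (U (insert e s)) = lab (U s) + lab (m e - U s)"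
    using lab_Un[of "m e" "U s"] fin_m fin_U by simp
qed

text \<open>A label is trivial only for the empty set of vertices, whatever \<open>sp\<close> is.
  After tensoring, the substitution has left no trace, so it does not affect the homology.\<close>

lemma tensor_k_taylor:
  "tensor_k (taylor_diff n :: ('v, 'k) mpol mat) = diff_mat N (az {}) n"
  unfolding taylor_diff_def tensor_k_diff_mat
proof (rule diff_mat_cong)
  fix e s assume s: "s \<subseteq> {..<N}" "e < N"
  have "finite (m e - U s)" using fin_m s by auto
  thus "Poly_Mapping.lookup (cf e s :: ('v, 'k) mpol) 0 = az {} e s"
    by (auto simp: cf_def az_def lookup_single when_def lab_eq_0)
qed

text \<open>The function read off a vector has meaningless values outside the sets of the right
  size; cutting them off yields a chain.\<close>

definition cut :: "nat \<Rightarrow> (nat set \<Rightarrow> 'k) \<Rightarrow> nat set \<Rightarrow> 'k" where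
  "cut n c s = (if s \<subseteq> {..<N} \<and> card s = n then c s else 0)"

lemma cut_ch: "cut n c \<in> ch (\<lambda>_. True) {..<N} Z n"
  by (rule chI) (auto simp: cut_def split: if_splits)

lemma dz_cut:
  assumes "s \<subseteq> {..<N}" "card s = n"
  shows "dz Z (cut (Suc n) c) s = sdiff N (az Z) c s"
proof -
  have "finite s" using assms finite_subset by blast
  thus ?thesis unfolding dz_def using assms by (intro sdiff_cong) (auto simp: cut_def)
qed

lemma dz_cut_outside:
  assumes "\<not> (s \<subseteq> {..<N} \<and> card s = n)"
  shows "dz Z (cut (Suc n) c) s = 0"
proof -
  have "dz Z (cut (Suc n) c) \<in> ch (\<lambda>_. True) {..<N} Z n" by (rule dz_ch[OF cut_ch]) simp
  thus ?thesis using assms chD[of "dz Z (cut (Suc n) c)" _ _ _ _ s] by blast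
qed

lemma kernel_iff:
  assumes z: "z \<in> carrier_vec (taylor_rank i)"
  shows "i = 0 \<or> tensor_k (taylor_diff i :: ('v, 'k) mpol mat) *\<^sub>v z = 0\<^sub>v (taylor_rank (i - 1)) \<longleftrightarrow>
    dz {} (cut (Suc i) (chain_of N z)) = (\<lambda>_. 0)"
proof (cases i)
  case 0
  \<comment> \<open>Edges are not empty, so a single edge has weight 0 over the empty set. Hence all
    chains of single edges are cycles, in accordance with the convention at position 0.\<close>
  have "dz {} (cut (Suc 0) (chain_of N z)) s = 0" for s
  proof (cases "s = {}")
    case True
    then show ?thesis using ne_m unfolding dz_def sdiff_def by (intro sum.neutral) (auto simp: az_def)
  next
    case False
    hence "\<not> (s \<subseteq> {..<N} \<and> card s = 0)" using finite_subset by fastforce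
    then show ?thesis by (rule dz_cut_outside)
  qed
  then show ?thesis using 0 by (auto simp: fun_eq_iff)
next
  case (Suc k)
  have "tensor_k (taylor_diff i :: ('v, 'k) mpol mat) *\<^sub>v z = vec_of N i (sdiff N (az {}) (chain_of N z))"
    unfolding tensor_k_taylor using z by (intro diff_mat_mult) (simp add: taylor_rank_def)
  moreover have "0\<^sub>v (taylor_rank (i - 1)) = (vec_of N i (\<lambda>_. 0) :: 'k vec)"
    using Suc by (auto simp: vec_of_def taylor_rank_def)
  moreover have "(\<forall>s. s \<subseteq> {..<N} \<and> card s = i \<longrightarrow> sdiff N (az {}) (chain_of N z) s = 0) \<longleftrightarrow>
     dz {} (cut (Suc i) (chain_of N z)) = (\<lambda>_. 0)"
    unfolding fun_eq_iff using dz_cut[of _ i "{}" "chain_of N z"] dz_cut_outside[of _ i "{}" "chain_of N z"] by metis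
  ultimately show ?thesis using Suc by (simp add: vec_of_eq_iff)
qed

lemma homology_spanned_if_spanned:
  assumes sp: "spanned (\<lambda>_. True) {..<N} {} (Suc i) b"
  shows "homology_spanned taylor_rank (taylor_diff :: nat \<Rightarrow> ('v, 'k) mpol mat) i b"
proof -
  obtain S where S: "finite S" "card S \<le> b"
    "\<And>z. z \<in> ch (\<lambda>_. True) {..<N} {} (Suc i) \<Longrightarrow> dz {} z = (\<lambda>_. 0) \<Longrightarrow>
       \<exists>g\<in>fv.span S. \<exists>y\<in>ch (\<lambda>_. True) {..<N} {} (Suc (Suc i)). z = (\<lambda>s. g s + dz {} y s)"
    using sp unfolding spanned_def by blast
  obtain gs where gs: "set gs = S" "distinct gs" using finite_distinct_list[OF S(1)] by blast
  define G where "G = mat (taylor_rank i) (length gs) (\<lambda>(p, j). (gs ! j) (ksub N (Suc i) ! p))"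
  have len: "length gs \<le> b" using S(2) gs distinct_card by metis
  have G: "G \<in> carrier_mat (taylor_rank i) (length gs)" by (simp add: G_def)
  have "\<exists>x\<in>carrier_vec (length gs). \<exists>y\<in>carrier_vec (taylor_rank (Suc i)).
      z = G *\<^sub>v x + tensor_k (taylor_diff (Suc i) :: ('v, 'k) mpol mat) *\<^sub>v y"
    if z: "z \<in> carrier_vec (taylor_rank i)"
      "i = 0 \<or> tensor_k (taylor_diff i :: ('v, 'k) mpol mat) *\<^sub>v z = 0\<^sub>v (taylor_rank (i - 1))" for z
  proof -
    have "dz {} (cut (Suc i) (chain_of N z)) = (\<lambda>_. 0)" using z kernel_iff by blast
    from S(3)[OF cut_ch this] obtain g y where g: "g \<in> fv.span S"
      and y: "y \<in> ch (\<lambda>_. True) {..<N} {} (Suc (Suc i))"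
        "cut (Suc i) (chain_of N z) = (\<lambda>s. g s + dz {} y s)" by blast
    obtain u where u: "g = (\<Sum>v\<in>S. (\<lambda>x. u v * v x))"
      using g unfolding fv.span_finite[OF S(1)] by auto
    let ?x = "vec (length gs) (\<lambda>j. u (gs ! j))" and ?y = "vec_of N (Suc (Suc i)) y"
    have yc: "?y \<in> carrier_vec (length (ksub N (Suc (Suc i))))" by simp
    have "z = G *\<^sub>v ?x + diff_mat N (az {}) (Suc i) *\<^sub>v ?y"
    proof (rule eq_vecI)
      fix p assume "p < dim_vec (G *\<^sub>v ?x + diff_mat N (az {}) (Suc i) *\<^sub>v ?y)"
      hence p: "p < taylor_rank i" by (simp add: taylor_rank_def diff_mat_def)
      hence pk: "p < length (ksub N (Suc i))" by (simp add: taylor_rank_def)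
      let ?s = "ksub N (Suc i) ! p"
      note s = ksub_nth[OF pk]
      have "(G *\<^sub>v ?x) $ p = (\<Sum>j<length gs. (gs ! j) ?s * u (gs ! j))"
        using p G by (simp add: scalar_prod_def lessThan_atLeast0 G_def)
      also have "\<dots> = (\<Sum>v\<in>set gs. v ?s * u v)"
        by (simp add: sum.distinct_set_conv_list[OF gs(2)] sum_list_sum_nth lessThan_atLeast0)
      also have "\<dots> = g ?s" unfolding u sum_fun_app gs by (simp add: mult.commute)
      finally have 1: "(G *\<^sub>v ?x) $ p = g ?s" .
      have "(diff_mat N (az {}) (Suc i) *\<^sub>v ?y) $ p = sdiff N (az {}) (chain_of N ?y) ?s"
        unfolding diff_mat_mult[OF yc] using pk by (simp add: vec_of_def)
      also have "\<dots> = dz {} y ?s" unfolding dz_def using s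
        by (intro sdiff_cong chain_of_vec_of) auto
      finally have 2: "(diff_mat N (az {}) (Suc i) *\<^sub>v ?y) $ p = dz {} y ?s" .
      have "z $ p = cut (Suc i) (chain_of N z) ?s" using s pk by (simp add: cut_def chain_of_def)
      also have "\<dots> = g ?s + dz {} y ?s" using y(2) by simp
      finally show "z $ p = (G *\<^sub>v ?x + diff_mat N (az {}) (Suc i) *\<^sub>v ?y) $ p"
        using 1 2 pk by (simp add: diff_mat_def)
    qed (use z in \<open>simp add: taylor_rank_def diff_mat_def\<close>)
    thus ?thesis unfolding tensor_k_taylor
      by (intro bexI[of _ ?x] bexI[of _ ?y]) (simp_all add: taylor_rank_def)
  qed
  thus ?thesis unfolding homology_spanned_def using len G by blast
qed

text \<open>A nonzero weight means that adding \<open>e\<close> does not enlarge the union, so the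
  differential preserves the squarefree degree.\<close>

lemma dz_graded: "dz {} (\<lambda>s. if U s = W then c s else 0) = (\<lambda>s. if U s = W then dz {} c s else 0)"
  unfolding dz_def sdiff_def
proof (rule ext, goal_cases)
  case (1 s)
  have "rsign e s * az {} e s * (if U (insert e s) = W then c (insert e s) else 0) =
      (if U s = W then rsign e s * az {} e s * c (insert e s) else 0)" for e
    by (auto simp: az_def Un_absorb1)
  then show ?case by simp
qed

text \<open>Strands in distinct degrees are direct summands, so nonzero classes, one from each, are
  independent modulo boundaries and cannot outnumber a generating set.\<close>

lemma card_le_if_homology_spanned:
  assumes sp: "homology_spanned taylor_rank (taylor_diff :: nat \<Rightarrow> ('v, 'k) mpol mat) i b"
    and fin: "finite \<W>"
    and nz: "\<And>W. W \<in> \<W> \<Longrightarrow> nonzero (\<lambda>X. X = W) {e. e < N \<and> m e \<subseteq> W} {} (Suc i)"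
  shows "card \<W> \<le> b"
proof -
  obtain b' G where bG: "b' \<le> b" "G \<in> carrier_mat (taylor_rank i) b'" and
    span: "\<And>z. z \<in> carrier_vec (taylor_rank i) \<Longrightarrow>
      i = 0 \<or> tensor_k (taylor_diff i :: ('v, 'k) mpol mat) *\<^sub>v z = 0\<^sub>v (taylor_rank (i - 1)) \<Longrightarrow>
      \<exists>x\<in>carrier_vec b'. \<exists>y\<in>carrier_vec (taylor_rank (Suc i)).
        z = G *\<^sub>v x + tensor_k (taylor_diff (Suc i) :: ('v, 'k) mpol mat) *\<^sub>v y"
    using sp unfolding homology_spanned_def by blast
  define gj where "gj j = cut (Suc i) (\<lambda>s. G $$ (pos N s, j))" for j
  define S where "S = gj ` {..<b'}"
  have S: "finite S" "card S \<le> b" unfolding S_def using card_image_le[of "{..<b'}" gj] bG(1) by auto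
  let ?E = "\<lambda>W. {e. e < N \<and> m e \<subseteq> W}"
  \<comment> \<open>A class \<open>z\<close> of degree \<open>W\<close> together with its expansion.
    The counting is done with the parts \<open>g\<close>, which lie in the span of the finite set
    \<open>S\<close>.\<close>
  define R where "R W z g y \<longleftrightarrow> z \<in> ch (\<lambda>X. X = W) (?E W) {} (Suc i) \<and>
      \<not> (\<exists>y\<in>ch (\<lambda>X. X = W) (?E W) {} (Suc (Suc i)). z = dz {} y) \<and>
      g \<in> fv.span S \<and> y \<in> ch (\<lambda>_. True) {..<N} {} (Suc (Suc i)) \<and> z = (\<lambda>s. g s + dz {} y s)" for W z g y
  have ex: "\<exists>z g y. R W z g y" if W: "W \<in> \<W>" for W
  proof -
    obtain z where z: "z \<in> ch (\<lambda>X. X = W) (?E W) {} (Suc i)" "dz {} z = (\<lambda>_. 0)"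
      "\<not> (\<exists>y\<in>ch (\<lambda>X. X = W) (?E W) {} (Suc (Suc i)). z = dz {} y)"
      using nz[OF W] unfolding nonzero_def by blast
    let ?v = "vec_of N (Suc i) z"
    have cutz: "cut (Suc i) (chain_of N ?v) = z"
    proof
      fix s show "cut (Suc i) (chain_of N ?v) s = z s"
      proof (cases "s \<subseteq> {..<N} \<and> card s = Suc i")
        case False
        hence "z s = 0" using chD[OF z(1), of s] by auto
        then show ?thesis using False by (auto simp: cut_def)
      qed (simp add: cut_def chain_of_vec_of)
    qed
    have v: "?v \<in> carrier_vec (taylor_rank i)" by (simp add: taylor_rank_def)
    have "i = 0 \<or> tensor_k (taylor_diff i :: ('v, 'k) mpol mat) *\<^sub>v ?v = 0\<^sub>v (taylor_rank (i - 1))"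
      using kernel_iff[OF v] cutz z(2) by simp
    from span[OF v this] obtain x y where x: "x \<in> carrier_vec b'" and y: "y \<in> carrier_vec (taylor_rank (Suc i))"
      and eq: "?v = G *\<^sub>v x + diff_mat N (az {}) (Suc i) *\<^sub>v y" unfolding tensor_k_taylor by blast
    have yc: "y \<in> carrier_vec (length (ksub N (Suc (Suc i))))" using y by (simp add: taylor_rank_def)
    define g where "g = (\<Sum>j<b'. (\<lambda>s. x $ j * gj j s))"
    have g: "g \<in> fv.span S" unfolding g_def S_def
      by (intro fv.span_sum fv.span_scale fv.span_base) auto
    let ?y = "cut (Suc (Suc i)) (chain_of N y)"
    have "z = (\<lambda>s. g s + dz {} ?y s)"
    proof
      fix s show "z s = g s + dz {} ?y s"
      proof (cases "s \<subseteq> {..<N} \<and> card s = Suc i")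
        case True
        hence p: "pos N s < length (ksub N (Suc i))" "ksub N (Suc i) ! pos N s = s" using pos[of s N] by auto
        have "z s = ?v $ pos N s" using p by (simp add: vec_of_def)
        also have "\<dots> = (G *\<^sub>v x) $ pos N s + (diff_mat N (az {}) (Suc i) *\<^sub>v y) $ pos N s"
          unfolding eq using p by (simp add: diff_mat_def)
        also have "(G *\<^sub>v x) $ pos N s = (\<Sum>j<b'. G $$ (pos N s, j) * x $ j)"
          using p bG(2) x by (simp add: scalar_prod_def lessThan_atLeast0 taylor_rank_def)
        also have "\<dots> = g s" unfolding g_def sum_fun_app gj_def using True by (simp add: cut_def mult.commute)
        also have "(diff_mat N (az {}) (Suc i) *\<^sub>v y) $ pos N s = sdiff N (az {}) (chain_of N y) s"
          unfolding diff_mat_mult[OF yc] using p by (simp add: vec_of_def)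
        also have "\<dots> = dz {} ?y s" using True by (simp add: dz_cut)
        finally show ?thesis .
      next
        case False
        hence "z s = 0" using chD[OF z(1), of s] by auto
        moreover have "g s = 0" unfolding g_def sum_fun_app gj_def using False
          by (intro sum.neutral) (auto simp: cut_def)
        moreover have "dz {} ?y s = 0" using False by (rule dz_cut_outside)
        ultimately show ?thesis by simp
      qed
    qed
    hence "R W z g ?y" unfolding R_def using z(1,3) g cut_ch by blast
    thus ?thesis by blast
  qed
  have "\<forall>W\<in>\<W>. \<exists>t. R W (fst t) (fst (snd t)) (snd (snd t))"
  proof
    fix W assume "W \<in> \<W>"
    from ex[OF this] obtain z g y where "R W z g y" by blast
    thus "\<exists>t. R W (fst t) (fst (snd t)) (snd (snd t))" by (intro exI[of _ "(z, g, y)"]) simp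
  qed
  from bchoice[OF this] obtain T where T: "\<forall>W\<in>\<W>. R W (fst (T W)) (fst (snd (T W))) (snd (snd (T W)))" by blast
  define z g y where "z W = fst (T W)" and "g W = fst (snd (T W))" and "y W = snd (snd (T W))" for W
  have R: "R W (z W) (g W) (y W)" if "W \<in> \<W>" for W using T that unfolding z_def g_def y_def by blast
  have
    z: "\<And>W. W \<in> \<W> \<Longrightarrow> z W \<in> ch (\<lambda>X. X = W) (?E W) {} (Suc i)"
       "\<And>W. W \<in> \<W> \<Longrightarrow> \<not> (\<exists>y\<in>ch (\<lambda>X. X = W) (?E W) {} (Suc (Suc i)). z W = dz {} y)" and
    g: "\<And>W. W \<in> \<W> \<Longrightarrow> g W \<in> fv.span S" and
    y: "\<And>W. W \<in> \<W> \<Longrightarrow> y W \<in> ch (\<lambda>_. True) {..<N} {} (Suc (Suc i))" and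
    eq: "\<And>W. W \<in> \<W> \<Longrightarrow> z W = (\<lambda>s. g W s + dz {} (y W) s)"
    using R unfolding R_def by blast+
  \<comment> \<open>A relation among the \<open>g W\<close> makes the same combination of the cycles
    \<open>z W\<close> a boundary; its part in degree \<open>W\<close> would exhibit
    \<open>z W\<close> as a boundary there.\<close>
  have indep: "c W = 0" if c: "\<And>s. (\<Sum>W\<in>\<W>. c W * g W s) = 0" and W: "W \<in> \<W>" for c W
  proof (rule ccontr)
    assume nz: "c W \<noteq> 0"
    define Y where "Y s = (\<Sum>V\<in>\<W>. c V * y V s)" for s
    have dY: "dz {} Y s = (\<Sum>V\<in>\<W>. c V * dz {} (y V) s)" for s
    proof -
      have "dz {} Y s = (\<Sum>e\<in>{..<N} - s. \<Sum>V\<in>\<W>. c V * (rsign e s * az {} e s * y V (insert e s)))"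
        unfolding dz_def sdiff_def Y_def sum_distrib_left by (intro sum.cong refl) (rule mult.left_commute)
      also have "\<dots> = (\<Sum>V\<in>\<W>. \<Sum>e\<in>{..<N} - s. c V * (rsign e s * az {} e s * y V (insert e s)))"
        by (rule sum.swap)
      also have "\<dots> = (\<Sum>V\<in>\<W>. c V * dz {} (y V) s)"
        unfolding dz_def sdiff_def sum_distrib_left ..
      finally show ?thesis .
    qed
    have sum: "(\<Sum>V\<in>\<W>. c V * z V s) = dz {} Y s" for s
    proof -
      have "(\<Sum>V\<in>\<W>. c V * z V s) = (\<Sum>V\<in>\<W>. c V * g V s + c V * dz {} (y V) s)"
        using eq by (intro sum.cong refl) (simp add: distrib_left)
      thus ?thesis unfolding sum.distrib dY using c by simp
    qed
    have zV: "z V s = 0" if "V \<in> \<W>" "U s \<noteq> V" for V s using chD[OF z(1)[OF that(1)], of s] that(2) by auto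
    have cz: "c W * z W s = (if U s = W then dz {} Y s else 0)" for s
    proof (cases "U s = W")
      case True
      have "(\<Sum>V\<in>\<W>. c V * z V s) = (\<Sum>V\<in>\<W>. if V = W then c W * z W s else 0)"
        using zV True by (intro sum.cong) auto
      then show ?thesis using True sum[of s] fin W by simp
    qed (use zV W in auto)
    have zi: "z W s = inverse (c W) * (if U s = W then dz {} Y s else 0)" for s
    proof -
      have "inverse (c W) * (c W * z W s) = z W s" using nz by simp
      thus ?thesis unfolding cz by (rule sym)
    qed
    have "z W = (\<lambda>s. inverse (c W) * dz {} (\<lambda>s. if U s = W then Y s else 0) s + 0 * dz {} Y s)"
      unfolding dz_graded by (rule ext) (simp add: zi)
    also have "\<dots> = dz {} (\<lambda>s. inverse (c W) * (if U s = W then Y s else 0) + 0 * Y s)"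
      by (rule dz_lin[symmetric])
    finally have zd: "z W = dz {} (\<lambda>s. inverse (c W) * (if U s = W then Y s else 0))" by simp
    have "(\<lambda>s. inverse (c W) * (if U s = W then Y s else 0)) \<in> ch (\<lambda>X. X = W) (?E W) {} (Suc (Suc i))"
    proof (rule chI)
      fix s assume "inverse (c W) * (if U s = W then Y s else 0) \<noteq> 0"
      hence Us: "U s = W" and "Y s \<noteq> 0" by (auto split: if_splits)
      then obtain V where V: "V \<in> \<W>" "c V * y V s \<noteq> 0" unfolding Y_def
        by (meson sum.not_neutral_contains_not_neutral)
      hence "y V s \<noteq> 0" by auto
      from chD[OF y[OF V(1)] this] have "s \<subseteq> {..<N}" "card s = Suc (Suc i)" by auto
      thus "s \<subseteq> ?E W \<and> card s = Suc (Suc i) \<and> U s \<union> {} = W" using Us by (auto simp: U_def)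
    qed
    thus False using z(2)[OF W] zd by blast
  qed
  \<comment> \<open>Independence of a set does not see repetitions; equal values would be a relation
    with coefficients 1 and -1.\<close>
  have inj: "inj_on g \<W>"
  proof (rule inj_onI)
    fix W W' assume W: "W \<in> \<W>" "W' \<in> \<W>" "g W = g W'"
    show "W = W'"
    proof (rule ccontr)
      assume ne: "W \<noteq> W'"
      let ?c = "\<lambda>V. if V = W then 1 else if V = W' then -1 else 0 :: 'k"
      have "(\<Sum>V\<in>\<W>. ?c V * g V s) = 0" for s
      proof -
        have "(\<Sum>V\<in>\<W>. ?c V * g V s) = (\<Sum>V\<in>{W, W'}. ?c V * g V s)"
          using fin W by (intro sum.mono_neutral_right) auto
        thus ?thesis using ne W(3) by simp
      qed
      from indep[OF this W(1)] show False by simp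
    qed
  qed
  have "fv.independent (g ` \<W>)"
  proof
    assume "fv.dependent (g ` \<W>)"
    then obtain u v where u: "(\<Sum>v\<in>g ` \<W>. (\<lambda>x. u v * v x)) = 0" and v: "v \<in> g ` \<W>" "u v \<noteq> 0"
      using fv.dependent_finite[of "g ` \<W>"] fin by auto
    obtain W where W: "W \<in> \<W>" "v = g W" using v by auto
    have "(\<Sum>V\<in>\<W>. u (g V) * g V s) = 0" for s
    proof -
      have "(\<Sum>v\<in>g ` \<W>. (\<lambda>x. u v * v x)) s = (\<Sum>V\<in>\<W>. u (g V) * g V s)"
        unfolding sum_fun_app by (simp add: sum.reindex[OF inj])
      thus ?thesis using u by simp
    qed
    from indep[OF this W(1)] show False using v W by simp
  qed
  moreover have "g ` \<W> \<subseteq> fv.span S" using g by auto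
  ultimately have "card (g ` \<W>) \<le> card S" using fv.independent_span_bound[OF S(1)] by blast
  thus ?thesis using card_image[OF inj] S(2) by simp
qed

end

section \<open>Colexsegment ideals\<close>

lemma pos_pairsE:
  assumes "A \<in> pos_pairs"
  obtains p q where "1 \<le> p" "p < q" "A = {p, q}" "Min A = p" "Max A = q"
proof -
  have A: "A \<subseteq> {1..}" "card A = 2" using assms unfolding pos_pairs_def by blast+
  obtain p q where pq: "A = {p, q}" "p \<noteq> q" using A(2) by (meson card_2_iff)
  show thesis
  proof (cases "p < q")
    case True
    then show thesis using A(1) pq by (intro that[of p q]) auto
  next
    case False
    then show thesis using A(1) pq by (intro that[of q p]) auto
  qed
qed

lemma pos_pairsI: "1 \<le> p \<Longrightarrow> p < q \<Longrightarrow> {p, q} \<in> pos_pairs"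
  unfolding pos_pairs_def by auto

lemma Min_Max_pair: "p < q \<Longrightarrow> Min {p, q} = (p::nat)" "p < q \<Longrightarrow> Max {p, q} = (q::nat)"
  by auto

text \<open>What lies outside an initial segment is not colex-smaller than what lies inside. So any
  bijection from \<open>C - K\<close> to \<open>K - C\<close> weakly raises the maximum.\<close>

lemma colex_sum_le:
  fixes f :: "nat set \<Rightarrow> nat"
  assumes C: "colexsegment C" and K: "finite K" "K \<subseteq> pos_pairs" "card K = card C"
    and f: "\<And>A B. A \<in> pos_pairs \<Longrightarrow> B \<in> pos_pairs \<Longrightarrow> Max A \<le> Max B \<Longrightarrow> f A \<le> f B"
  shows "sum f C \<le> sum f K"
proof -
  have fC: "finite C" and Cp: "C \<subseteq> pos_pairs" using C unfolding colexsegment_def by auto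
  have "card (C - K) = card (K - C)"
    using card_Int_Diff[OF fC, of K] card_Int_Diff[OF K(1), of C] K(3) by (simp add: Int_commute)
  then obtain h where h: "bij_betw h (C - K) (K - C)"
    using finite_same_card_bij[of "C - K" "K - C"] fC K(1) by blast
  have "sum f (C - K) \<le> (\<Sum>B\<in>C - K. f (h B))"
  proof (rule sum_mono)
    fix B assume B: "B \<in> C - K"
    have hB: "h B \<in> K - C" using h B unfolding bij_betw_def by blast
    have "\<not> colex_less (h B) B" using C B hB K(2) unfolding colexsegment_def by blast
    hence "Max B \<le> Max (h B)" unfolding colex_less_def by simp
    thus "f B \<le> f (h B)" using f B hB K(2) Cp by blast
  qed
  also have "\<dots> = sum f (K - C)" by (rule sum.reindex_bij_betw[OF h])
  finally have "sum f (C - K) \<le> sum f (K - C)" .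
  moreover have "sum f C = sum f (C \<inter> K) + sum f (C - K)" using sum.Int_Diff[OF fC] .
  moreover have "sum f K = sum f (C \<inter> K) + sum f (K - C)" using sum.Int_Diff[OF K(1), of f C] by (simp add: Int_commute)
  ultimately show ?thesis by simp
qed

locale colex_complex = covering_complex N m type_k
  for N :: nat and m :: "nat \<Rightarrow> nat set" and type_k :: "'k::field itself"
begin

text \<open>Let \<open>m e = {a < b}\<close>. Each vertex c < b other than a is joined to a or b by
  an earlier edge, and any other earlier edge contains such a vertex, hence is dominated. At most b
  - 2 edges matter.\<close>

lemma spanned_colon:
  assumes E: "E \<subseteq> {..<N}" "inj_on m E" "colexsegment (m ` E)"
    and e: "e \<in> E" "\<And>f. f \<in> E \<Longrightarrow> f \<noteq> e \<Longrightarrow> colex_less (m f) (m e)"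
  shows "spanned (\<lambda>_. True) (E - {e}) (m e) i ((Max (m e) - 2) choose i)"
proof -
  have pp: "m f \<in> pos_pairs" if "f \<in> E" for f using E(3) that unfolding colexsegment_def by blast
  obtain a b where ab: "1 \<le> a" "a < b" "m e = {a, b}" "Min (m e) = a" "Max (m e) = b"
    using pp[OF e(1)] by (rule pos_pairsE)
  \<comment> \<open>The edge at \<open>c\<close> that precedes \<open>{a, b}\<close>: for
    \<open>c < a\<close> it keeps the maximum and has a smaller minimum, otherwise it has a smaller
    maximum.\<close>
  define S where "S c = (if c < a then {c, b} else {a, c})" for c
  define X where "X = {1..<b} - {a}"
  have cX: "card X = b - 2" using ab by (simp add: X_def card_Diff_subset)
  define E' where "E' = {f \<in> E - {e}. m f \<in> S ` X}"
  have "card E' = card (m ` E')"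
    using E(2) by (intro card_image[symmetric]) (auto simp: E'_def intro: inj_on_subset)
  also have "\<dots> \<le> card (S ` X)" by (rule card_mono) (auto simp: E'_def X_def)
  also have "\<dots> \<le> card X" by (rule card_image_le) (simp add: X_def)
  finally have cE': "card E' \<le> b - 2" using cX by simp
  have S_in: "\<exists>g\<in>E'. m g = S c" if c: "c \<in> X" for c
  proof -
    have c': "1 \<le> c" "c < b" "c \<noteq> a" using c by (auto simp: X_def)
    have "S c \<in> pos_pairs \<and> colex_less (S c) (m e) \<and> S c \<noteq> {a, b}"
    proof (cases "c < a")
      case True
      hence S: "S c = {c, b}" by (simp add: S_def)
      show ?thesis unfolding S colex_less_def ab(4,5)
        using True c' ab(2) pos_pairsI[of c b] Min_Max_pair[of c b] by (auto simp: doubleton_eq_iff)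
    next
      case False
      hence S: "S c = {a, c}" by (simp add: S_def)
      show ?thesis unfolding S colex_less_def ab(4,5)
        using False c' ab(1,2) pos_pairsI[of a c] Min_Max_pair[of a c] by (auto simp: doubleton_eq_iff)
    qed
    hence 1: "S c \<in> pos_pairs" "colex_less (S c) (m e)" "S c \<noteq> m e" unfolding ab(3) by blast+
    hence "S c \<in> m ` E" using 1 E(3) e(1) unfolding colexsegment_def by blast
    with 1(3) show ?thesis using c by (auto simp: E'_def)
  qed
  have "spanned (\<lambda>_. True) (E - {e}) (m e) i (card E' choose i)"
  proof (rule spanned_dominated)
    show "E - {e} \<subseteq> {..<N}" using E by auto
    show "E' \<subseteq> E - {e}" by (auto simp: E'_def)
    show "spanned (\<lambda>_. True) E' (m e) i (card E' choose i)"
      using E by (intro spanned_choose) (auto simp: E'_def)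
    fix f assume f: "f \<in> E - {e} - E'"
    obtain p q where pq: "1 \<le> p" "p < q" "m f = {p, q}" "Min (m f) = p" "Max (m f) = q"
      using pp[of f] f by (blast elim: pos_pairsE)
    have le: "q \<le> b" using e(2)[of f] f pq ab unfolding colex_less_def by auto
    have "m f \<noteq> m e" using E(2) e(1) f by (auto simp: inj_on_def)
    \<comment> \<open>A different edge has a vertex outside \<open>{a, b}\<close>; it is below
      \<open>b\<close> because no edge of \<open>E\<close> has a larger maximum.\<close>
    hence "\<exists>c\<in>m f. c \<noteq> a \<and> c \<noteq> b" using pq ab by auto
    then obtain c where c: "c \<in> m f" "c \<noteq> a" "c \<noteq> b" by blast
    have "c \<in> X" using c pq le by (auto simp: X_def)
    from S_in[OF this] obtain g where "g \<in> E'" "m g = S c" by blast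
    thus "\<exists>g\<in>E'. m g \<subseteq> m e \<union> m f" using c(1) ab(3) by (intro bexI[of _ g]) (auto simp: S_def)
  qed
  thus ?thesis using spanned_mono cE' ab(5) binomial_right_mono by metis
qed

text \<open>Without its last edge a colexsegment is again one; the last edge contributes the bound
  for its colon.\<close>

lemma spanned_colexsegment:
  assumes "E \<subseteq> {..<N}" "inj_on m E" "colexsegment (m ` E)"
  shows "spanned (\<lambda>_. True) E {} (Suc i) (\<Sum>e\<in>E. (Max (m e) - 2) choose i)"
  using assms
proof (induction "card E" arbitrary: E rule: less_induct)
  case less
  have fE: "finite E" using less.prems(1) finite_subset by blast
  show ?case
  proof (cases "E = {}")
    case True
    then show ?thesis using spanned_choose[of "{}" "\<lambda>_. True" "{}" "Suc i"] by simp
  next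
    case False
    have pp: "m f \<in> pos_pairs" if "f \<in> E" for f using less.prems(3) that unfolding colexsegment_def by blast
    \<comment> \<open>The colex-last edge has the largest maximum and, among those, the largest
      minimum.\<close>
    define b where "b = Max ((\<lambda>f. Max (m f)) ` E)"
    define Eb where "Eb = {f \<in> E. Max (m f) = b}"
    have "b \<in> (\<lambda>f. Max (m f)) ` E" unfolding b_def using fE False by (intro Max_in) auto
    hence Eb: "Eb \<noteq> {}" "finite Eb" using fE by (auto simp: Eb_def)
    define a where "a = Max ((\<lambda>f. Min (m f)) ` Eb)"
    have "a \<in> (\<lambda>f. Min (m f)) ` Eb" unfolding a_def using Eb by (intro Max_in) auto
    then obtain e where e: "e \<in> Eb" "Min (m e) = a" by blast
    have eE: "e \<in> E" "Max (m e) = b" using e by (auto simp: Eb_def)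
    have less_e: "colex_less (m f) (m e)" if f: "f \<in> E" "f \<noteq> e" for f
    proof -
      have "m f \<noteq> m e" using less.prems(2) f eE by (auto simp: inj_on_def)
      obtain p q where pq: "p < q" "m f = {p, q}" "Min (m f) = p" "Max (m f) = q" using pp[OF f(1)] by (rule pos_pairsE)
      obtain p' q' where pq': "p' < q'" "m e = {p', q'}" "Min (m e) = p'" "Max (m e) = q'" using pp[OF eE(1)] by (rule pos_pairsE)
      have 1: "Max (m f) \<le> b" unfolding b_def using fE f by (intro Max_ge) auto
      have 2: "Min (m f) \<le> a" if "Max (m f) = b" unfolding a_def using Eb f that by (intro Max_ge) (auto simp: Eb_def)
      show ?thesis
      proof (cases "Max (m f) = b")
        case True
        hence "p \<noteq> p'" using \<open>m f \<noteq> m e\<close> pq pq' eE by auto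
        then show ?thesis using 2[OF True] True e(2) eE pq pq' unfolding colex_less_def by linarith
      next
        case False
        then show ?thesis using 1 eE unfolding colex_less_def by linarith
      qed
    qed
    have seg: "colexsegment (m ` (E - {e}))"
      unfolding colexsegment_def
    proof (intro conjI ballI impI)
      show "finite (m ` (E - {e}))" using fE by simp
      show "m ` (E - {e}) \<subseteq> pos_pairs" using pp by auto
      fix B A assume B: "B \<in> m ` (E - {e})" and A: "A \<in> pos_pairs" "colex_less A B"
      have "A \<in> m ` E" using less.prems(3) A B unfolding colexsegment_def by blast
      then obtain f where f: "f \<in> E" "A = m f" by blast
      have "f \<noteq> e"
      proof
        assume "f = e"
        with A(2) f have "colex_less (m e) B" by simp
        moreover have "colex_less B (m e)" using B less_e by blast
        ultimately show False unfolding colex_less_def by linarith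
      qed
      thus "A \<in> m ` (E - {e})" using f by blast
    qed
    have "spanned (\<lambda>_. True) (E - {e}) {} (Suc i) (\<Sum>f\<in>E - {e}. (Max (m f) - 2) choose i)"
    proof (rule less.hyps)
      show "card (E - {e}) < card E" using fE eE(1) by (rule card_Diff1_less)
      show "inj_on m (E - {e})" using less.prems(2) by (rule inj_on_subset) auto
    qed (use less.prems seg in auto)
    moreover have "spanned (\<lambda>_. True) (E - {e}) ({} \<union> m e) i ((Max (m e) - 2) choose i)"
      using spanned_colon[OF less.prems eE(1) less_e] by simp
    ultimately have "spanned (\<lambda>_. True) E {} (Suc i)
        ((\<Sum>f\<in>E - {e}. (Max (m f) - 2) choose i) + ((Max (m e) - 2) choose i))"
      by (rule spanned_split[OF less.prems(1) eE(1)])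
    thus ?thesis using fE eE(1) by (simp add: sum.remove add.commute)
  qed
qed

end

section \<open>Bipartite graphs of skew shapes\<close>

context covering_complex
begin

text \<open>All of \<open>g\<close> except \<open>t\<close> is covered, so \<open>g\<close>
  dominates the other edges at \<open>t\<close>. Once these are gone, nothing but \<open>g\<close>
  covers \<open>t\<close>, and the strand without \<open>g\<close> is zero.\<close>

lemma nonzero_single:
  assumes E: "E \<subseteq> {..<N}" "g \<in> E" and t: "t \<in> W" "t \<notin> Z" "t \<in> m g" "m g \<subseteq> insert t Z"
    and nz: "nonzero (\<lambda>V. V = W) {f \<in> E. t \<notin> m f} (insert t Z) n"
  shows "nonzero (\<lambda>V. V = W) E Z (Suc n)"
proof -
  let ?E = "insert g {f \<in> E. t \<notin> m f}"
  have del: "?E - {g} = {f \<in> E. t \<notin> m f}" using t(3) by auto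
  have Zg: "Z \<union> m g = insert t Z" using t by auto
  have "nonzero (\<lambda>V. V = W) ?E Z (Suc n)"
  proof (rule nonzero_wedge)
    show "acyc (\<lambda>V. V = W) (?E - {g}) Z"
      unfolding del using t by (intro acyc_uncovered) (auto simp: U_def)
    show "nonzero (\<lambda>V. V = W) (?E - {g}) (Z \<union> m g) n" unfolding del Zg by (rule nz)
  qed (use E in auto)
  thus ?thesis
    by (rule nonzero_dominated[rotated -1]) (use E t in auto)
qed

text \<open>Each leaf raises the homological degree by one and joins the covered vertices.\<close>

lemma nonzero_singles:
  assumes "finite T" "E \<subseteq> {..<N}" "T \<subseteq> W" "T \<inter> Z = {}"
    "\<And>t. t \<in> T \<Longrightarrow> \<exists>g\<in>E. t \<in> m g \<and> m g \<subseteq> insert t Z"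
    "nonzero (\<lambda>V. V = W) {f \<in> E. m f \<inter> T = {}} (Z \<union> T) n"
  shows "nonzero (\<lambda>V. V = W) E Z (card T + n)"
  using assms
proof (induction T arbitrary: E Z rule: finite_induct)
  case (insert t T)
  obtain g where g: "g \<in> E" "t \<in> m g" "m g \<subseteq> insert t Z" using insert.prems(4) by blast
  have "nonzero (\<lambda>V. V = W) {f \<in> E. t \<notin> m f} (insert t Z) (card T + n)"
  proof (rule insert.IH)
    show "T \<inter> insert t Z = {}" using insert by auto
    fix s assume s: "s \<in> T"
    then obtain g' where g': "g' \<in> E" "s \<in> m g'" "m g' \<subseteq> insert s Z" using insert.prems(4) by blast
    moreover have "t \<notin> m g'" using g' s insert by auto
    ultimately show "\<exists>g\<in>{f \<in> E. t \<notin> m f}. s \<in> m g \<and> m g \<subseteq> insert s (insert t Z)" by blast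
  next
    have "{f \<in> {f \<in> E. t \<notin> m f}. m f \<inter> T = {}} = {f \<in> E. m f \<inter> insert t T = {}}" by auto
    thus "nonzero (\<lambda>V. V = W) {f \<in> {f \<in> E. t \<notin> m f}. m f \<inter> T = {}} (insert t Z \<union> T) n"
      using insert.prems(5) by simp
  qed (use insert.prems in auto)
  hence "nonzero (\<lambda>V. V = W) E Z (Suc (card T + n))"
    using insert.prems by (intro nonzero_single[OF _ g(1) _ _ g(2,3)]) auto
  thus ?case using insert.hyps by simp
qed simp

end

text \<open>What the argument uses of the diagram: rows are intervals within \<open>Y\<close>, and
  their right ends weakly decrease with the row number. Rows are nonempty so that \<open>Max\<close>
  is meaningful.\<close>

locale skew_shape = covering_complex N m type_k
  for N :: nat and m :: "nat \<Rightarrow> (nat + nat) set" and type_k :: "'k::field itself" +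
  fixes X Y :: "nat set" and R :: "nat \<Rightarrow> nat set"
  assumes fin_X: "finite X" and fin_Y: "finite Y" and R_Y: "\<And>x. x \<in> X \<Longrightarrow> R x \<subseteq> Y"
    and R_ne: "\<And>x. x \<in> X \<Longrightarrow> R x \<noteq> {}"
    and R_Max: "\<And>a x. a \<in> X \<Longrightarrow> x \<in> X \<Longrightarrow> a < x \<Longrightarrow> Max (R x) \<le> Max (R a)"
    and R_convex: "\<And>x y y' y''. x \<in> X \<Longrightarrow> y \<in> R x \<Longrightarrow> y'' \<in> R x \<Longrightarrow> y' \<in> Y \<Longrightarrow> y \<le> y' \<Longrightarrow> y' \<le> y'' \<Longrightarrow> y' \<in> R x"
    and edges: "m ` {..<N} = {{Inl x, Inr y} | x y. x \<in> X \<and> y \<in> R x}"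
    and inj_m: "inj_on m {..<N}"
begin

lemma fin_R: "x \<in> X \<Longrightarrow> finite (R x)"
  using R_Y fin_Y finite_subset by blast

lemma Max_R: "x \<in> X \<Longrightarrow> Max (R x) \<in> R x"
  using fin_R R_ne by (intro Max_in)

lemma R_le_Max: "x \<in> X \<Longrightarrow> y \<in> R x \<Longrightarrow> y \<le> Max (R x)"
  using fin_R by (intro Max_ge)

lemma edgeE:
  assumes "f < N"
  obtains a d where "a \<in> X" "d \<in> R a" "m f = {Inl a, Inr d}"
proof -
  have "m f \<in> m ` {..<N}" using assms by simp
  thus thesis unfolding edges using that by blast
qed

lemma edge_exists: "a \<in> X \<Longrightarrow> d \<in> R a \<Longrightarrow> \<exists>f<N. m f = {Inl a, Inr d}"
proof -
  assume "a \<in> X" "d \<in> R a"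
  hence "{Inl a, Inr d} \<in> m ` {..<N}" unfolding edges by blast
  thus ?thesis by auto
qed

definition Ed :: "nat set \<Rightarrow> nat set \<Rightarrow> nat set" where
  "Ed A D = {f. f < N \<and> m f \<subseteq> Inl ` A \<union> Inr ` D}"

lemma Ed_N: "Ed A D \<subseteq> {..<N}"
  by (auto simp: Ed_def)

lemma EdE:
  assumes "f \<in> Ed A D"
  obtains a d where "a \<in> A" "d \<in> D" "a \<in> X" "d \<in> R a" "m f = {Inl a, Inr d}" "f < N"
proof -
  have f: "f < N" "m f \<subseteq> Inl ` A \<union> Inr ` D" using assms by (auto simp: Ed_def)
  obtain a d where ad: "a \<in> X" "d \<in> R a" "m f = {Inl a, Inr d}" using f(1) by (rule edgeE)
  have "a \<in> A" "d \<in> D" using f(2) unfolding ad(3) by auto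
  thus thesis using ad f(1) that by blast
qed

lemma Ed_exists: "a \<in> A \<Longrightarrow> a \<in> X \<Longrightarrow> d \<in> D \<Longrightarrow> d \<in> R a \<Longrightarrow> \<exists>f\<in>Ed A D. m f = {Inl a, Inr d}"
  using edge_exists[of a d] by (auto simp: Ed_def)

text \<open>The edges from \<open>x\<close> to the columns of \<open>B\<close> other than
  \<open>y\<close> are put back one at a time. With none of them \<open>x\<close> is uncovered. When
  \<open>{x, b}\<close> is split off, an edge at \<open>y\<close> comes from another row
  \<open>a\<close> and is dominated by \<open>{a, b}\<close>; without such edges \<open>y\<close> is
  uncovered.\<close>

lemma acyc_delete_edge:
  assumes x: "x \<in> A" and B: "finite B" "y \<in> B" "B \<subseteq> D"
    and Rx: "R x \<inter> D = B" and AX: "A \<subseteq> X"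
    and join: "\<And>a b. a \<in> A \<Longrightarrow> a \<noteq> x \<Longrightarrow> y \<in> R a \<Longrightarrow> b \<in> B \<Longrightarrow> b \<in> R a"
    and Z: "Z \<inter> (Inl ` A \<union> Inr ` D) = {}" and W: "Inl ` A \<union> Inr ` D \<subseteq> W"
    and e: "e \<in> Ed A D" "m e = {Inl x, Inr y}"
  shows "acyc (\<lambda>V. V = W) (Ed A D - {e}) Z"
proof -
  let ?P = "\<lambda>V. V = W"
  \<comment> \<open>\<open>B'\<close> lists the columns of \<open>B\<close> whose edge to
    \<open>x\<close> is present; \<open>y\<close> is never among them.\<close>
  define F where "F B' = {f \<in> Ed A D. \<forall>b\<in>B - B'. m f \<noteq> {Inl x, Inr b}}" for B'
  have F_N: "F B' \<subseteq> {..<N}" for B' using Ed_N by (auto simp: F_def)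
  have inj: "f = g" if "f \<in> Ed A D" "g \<in> Ed A D" "m f = m g" for f g
    using inj_onD[OF inj_m that(3)] that(1,2) Ed_N by blast
  have yD: "y \<in> D" using B by blast
  have xW: "Inl x \<in> W" "Inl x \<notin> Z" and yW: "Inr y \<in> W" "Inr y \<notin> Z" using W Z x yD by blast+
  have "acyc ?P (F B') Z" if B': "B' \<subseteq> B - {y}" for B'
  proof -
    have "finite B'" using B' B(1) finite_subset by blast
    thus ?thesis using B'
    proof (induction B' rule: finite_induct)
      case empty
      show ?case
      proof (rule acyc_uncovered)
        fix s assume s: "s \<subseteq> F {}"
        have "Inl x \<notin> m f" if "f \<in> s" for f
        proof -
          have f: "f \<in> Ed A D" "\<forall>b\<in>B. m f \<noteq> {Inl x, Inr b}" using s that by (auto simp: F_def)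
          obtain a d where ad: "a \<in> A" "d \<in> D" "d \<in> R a" "m f = {Inl a, Inr d}" using f(1) by (rule EdE)
          show ?thesis using ad f(2) Rx by auto
        qed
        hence "Inl x \<notin> U s" by (auto simp: U_def)
        thus "U s \<union> Z \<noteq> W" using xW by blast
      qed
    next
      case (insert b B')
      have b: "b \<in> B" "b \<noteq> y" "b \<in> D" "b \<in> R x" using insert.prems B(3) Rx by auto
      obtain g where g: "g \<in> Ed A D" "m g = {Inl x, Inr b}"
        using Ed_exists[of x A b D] x AX b by blast
      have gF: "g \<in> F (insert b B')" using g by (auto simp: F_def doubleton_eq_iff)
      have del: "F (insert b B') - {g} = F B'"
      proof
        show "F (insert b B') - {g} \<subseteq> F B'"
        proof
          fix f assume f: "f \<in> F (insert b B') - {g}"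
          hence "m f \<noteq> {Inl x, Inr b}" using inj[of f g] g by (auto simp: F_def)
          thus "f \<in> F B'" using f by (auto simp: F_def)
        qed
        show "F B' \<subseteq> F (insert b B') - {g}" using g(2) b(1) insert.hyps(2) by (auto simp: F_def)
      qed
      show ?case
      proof (rule acyc_split[OF F_N gF])
        show "acyc ?P (F (insert b B') - {g}) Z" unfolding del using insert by auto
        let ?E = "{f \<in> F B'. Inr y \<notin> m f}"
        show "acyc ?P (F (insert b B') - {g}) (Z \<union> m g)" unfolding del
        proof (rule acyc_dominated[OF F_N])
          show "?E \<subseteq> F B'" by blast
          show "acyc ?P ?E (Z \<union> m g)"
          proof (rule acyc_uncovered)
            fix s assume "s \<subseteq> ?E"
            hence "Inr y \<notin> U s" by (auto simp: U_def)
            moreover have "Inr y \<notin> m g" using g(2) b(2) by simp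
            ultimately show "U s \<union> (Z \<union> m g) \<noteq> W" using yW by blast
          qed
          fix f assume f: "f \<in> F B' - ?E"
          hence fE: "f \<in> Ed A D" "Inr y \<in> m f" "m f \<noteq> {Inl x, Inr y}"
            using B(2) insert.prems by (auto simp: F_def)
          obtain a d where ad: "a \<in> A" "d \<in> R a" "m f = {Inl a, Inr d}" using fE(1) by (rule EdE)
          have d: "d = y" and a: "a \<noteq> x" using fE(2,3) ad(3) by auto
          have "b \<in> R a" using join[OF ad(1) a _ b(1)] ad(2) d by simp
          then obtain h where h: "h \<in> Ed A D" "m h = {Inl a, Inr b}"
            using Ed_exists[of a A b D] ad(1) AX b(3) by blast
          have "h \<in> ?E" using h a b(2) by (auto simp: F_def doubleton_eq_iff)
          moreover have "m h \<subseteq> (Z \<union> m g) \<union> m f" using h(2) g(2) ad(3) by auto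
          ultimately show "\<exists>g'\<in>?E. m g' \<subseteq> Z \<union> m g \<union> m f" by blast
        qed
      qed
    qed
  qed
  moreover have "F (B - {y}) = Ed A D - {e}"
    using inj e B(2) by (auto simp: F_def)
  ultimately show ?thesis by (metis order_refl)
qed

text \<open>After splitting off the edge \<open>x y\<close>, the neighbours of \<open>x\<close> and \<open>y\<close> become leaves, and one is
  left with the rows of \<open>A\<close> that do not contain \<open>y\<close>, starting with the rightmost cell of the lowest one.\<close>

lemma nonzero_rows:
  assumes "A \<subseteq> X" "A \<noteq> {}" "x = Max A" "B \<subseteq> R x" "B \<noteq> {}" "y = Min B"
    "\<And>a. a \<in> A \<Longrightarrow> y \<notin> R a \<Longrightarrow> Max (R x) < Max (R a)"
  shows "\<exists>C. C \<subseteq> {Max (R x)<..} \<and> C \<subseteq> Y \<and> (\<forall>Z. Z \<inter> (Inl ` A \<union> Inr ` (B \<union> C)) = {} \<longrightarrow>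
    nonzero (\<lambda>V. V = Z \<union> Inl ` A \<union> Inr ` (B \<union> C)) (Ed A (B \<union> C)) Z (card A + card B - 1))"
  using assms
proof (induction "card A" arbitrary: A x B y rule: less_induct)
  case less
  have fA: "finite A" using less.prems(1) fin_X finite_subset by blast
  have xA: "x \<in> A" using less.prems(2,3) fA by simp
  hence xX: "x \<in> X" using less.prems(1) by blast
  have A_le: "a \<le> x" if "a \<in> A" for a using that less.prems(3) fA by simp
  have fB: "finite B" using less.prems(4) fin_R[OF xX] finite_subset by blast
  have yB: "y \<in> B" using less.prems(5,6) fB by simp
  have B_ge: "y \<le> b" if "b \<in> B" for b using that less.prems(6) fB by simp
  have BY: "B \<subseteq> Y" using less.prems(4) R_Y[OF xX] by blast
  \<comment> \<open>Once \<open>x\<close> and \<open>y\<close> are covered, the rows in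
    \<open>A'\<close> and the columns in \<open>B'\<close> are leaves. The rows in \<open>A2\<close>
    miss column \<open>y\<close>, and by hypothesis they end beyond row \<open>x\<close>.\<close>
  define A' where "A' = {a \<in> A - {x}. y \<in> R a}"
  define A2 where "A2 = {a \<in> A. y \<notin> R a}"
  define B' where "B' = B - {y}"
  have yx: "y \<in> R x" using yB less.prems(4) by blast
  have A_eq: "A = insert x (A' \<union> A2)" using xA yx by (auto simp: A'_def A2_def)
  have x_n: "x \<notin> A'" "x \<notin> A2" "A' \<inter> A2 = {}" using yx by (auto simp: A'_def A2_def)
  have cA: "card A = Suc (card A' + card A2)"
  proof -
    have f: "finite A'" "finite A2" using fA by (auto simp: A'_def A2_def)
    have "card (insert x (A' \<union> A2)) = Suc (card (A' \<union> A2))" using f x_n by simp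
    also have "card (A' \<union> A2) = card A' + card A2" using f x_n(3) by (rule card_Un_disjoint)
    finally show ?thesis using A_eq by simp
  qed
  have cB: "card B = Suc (card B')" using fB yB unfolding B'_def by (metis card_Suc_Diff1)
  have A2_sub: "A2 \<subseteq> A" by (auto simp: A2_def)
  \<comment> \<open>The recursion for \<open>A2\<close> starts from the last column of its lowest
    row. That column, too, joins \<open>C\<close>; it lies beyond the end of row
    \<open>x\<close>.\<close>
  obtain C where C: "C \<subseteq> {Max (R x)<..}" "C \<subseteq> Y"
    "\<And>Z. Z \<inter> (Inl ` A2 \<union> Inr ` C) = {} \<Longrightarrow>
      nonzero (\<lambda>V. V = Z \<union> Inl ` A2 \<union> Inr ` C) (Ed A2 C) Z (card A2)"
  proof (cases "A2 = {}")
    case True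
    have "nonzero (\<lambda>V. V = Z \<union> Inl ` A2 \<union> Inr ` {}) (Ed A2 {}) Z (card A2)" for Z
    proof -
      have "Ed A2 {} = {}" unfolding True by (auto elim: EdE)
      thus ?thesis using True nonzero_empty[of "\<lambda>V. V = Z" Z] by simp
    qed
    thus thesis by (intro that[of "{}"]) auto
  next
    case False
    let ?x2 = "Max A2"
    let ?y2 = "Max (R ?x2)"
    have x2: "?x2 \<in> A2" using False A2_sub fA finite_subset by (intro Max_in) blast+
    hence x2X: "?x2 \<in> X" using A2_sub less.prems(1) by blast
    have "\<exists>C. C \<subseteq> {?y2<..} \<and> C \<subseteq> Y \<and> (\<forall>Z. Z \<inter> (Inl ` A2 \<union> Inr ` ({?y2} \<union> C)) = {} \<longrightarrow>
      nonzero (\<lambda>V. V = Z \<union> Inl ` A2 \<union> Inr ` ({?y2} \<union> C)) (Ed A2 ({?y2} \<union> C)) Z (card A2 + card {?y2} - 1))"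
    proof (rule less.hyps[where y = ?y2])
      show "card A2 < card A" using cA by simp
      show "A2 \<subseteq> X" using A2_sub less.prems(1) by blast
      show "{?y2} \<subseteq> R ?x2" using Max_R[OF x2X] by blast
      fix a assume a: "a \<in> A2" "?y2 \<notin> R a"
      have aX: "a \<in> X" using a A2_sub less.prems(1) by blast
      have "a \<le> ?x2" using a(1) A2_sub fA finite_subset by (intro Max_ge) blast+
      moreover have "a \<noteq> ?x2" using a(2) Max_R[OF x2X] by auto
      ultimately have "?y2 \<le> Max (R a)" using R_Max[OF aX x2X] by simp
      moreover have "?y2 \<noteq> Max (R a)" using a(2) Max_R[OF aX] by auto
      ultimately show "?y2 < Max (R a)" by simp
    qed (use False in auto)
    then obtain C where C: "C \<subseteq> {?y2<..}" "C \<subseteq> Y" "\<And>Z. Z \<inter> (Inl ` A2 \<union> Inr ` ({?y2} \<union> C)) = {} \<Longrightarrow>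
      nonzero (\<lambda>V. V = Z \<union> Inl ` A2 \<union> Inr ` ({?y2} \<union> C)) (Ed A2 ({?y2} \<union> C)) Z (card A2)" by auto
    have "Max (R x) < ?y2" using less.prems(7)[of ?x2] x2 by (auto simp: A2_def)
    moreover have "?y2 \<in> Y" using Max_R[OF x2X] R_Y[OF x2X] by blast
    ultimately show thesis using C by (intro that[of "{?y2} \<union> C"]) auto
  qed
  have "nonzero (\<lambda>V. V = Z \<union> Inl ` A \<union> Inr ` (B \<union> C)) (Ed A (B \<union> C)) Z (card A + card B - 1)"
    if Z: "Z \<inter> (Inl ` A \<union> Inr ` (B \<union> C)) = {}" for Z
  proof -
    let ?W = "Z \<union> Inl ` A \<union> Inr ` (B \<union> C)"
    let ?P = "\<lambda>V. V = ?W"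
    let ?E = "Ed A (B \<union> C)"
    have Cx: "c \<notin> R x" if "c \<in> C" for c using that C(1) R_le_Max[OF xX] by force
    have CB: "C \<inter> B = {}" using Cx less.prems(4) by blast
    obtain e where e: "e \<in> ?E" "m e = {Inl x, Inr y}"
      using Ed_exists[OF xA xX _ yx, of "B \<union> C"] yB by blast
    \<comment> \<open>A row above \<open>x\<close> ends at least as far right as row
      \<open>x\<close>, so if it contains \<open>y\<close> it contains all of \<open>B\<close> by
      convexity.\<close>
    have join: "b \<in> R a" if a: "a \<in> A" "a \<noteq> x" "y \<in> R a" and b: "b \<in> B" for a b
    proof -
      have aX: "a \<in> X" using a less.prems(1) by blast
      have "b \<le> Max (R x)" using b less.prems(4) R_le_Max[OF xX] by blast
      also have "\<dots> \<le> Max (R a)" using R_Max[OF aX xX] A_le[OF a(1)] a(2) by simp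
      finally show ?thesis using R_convex[OF aX a(3) Max_R[OF aX], of b] b BY B_ge by blast
    qed
    have ac: "acyc ?P (?E - {e}) Z"
      using acyc_delete_edge[OF xA fB yB _ _ less.prems(1) join Z _ e, of ?W] Cx less.prems(4) by blast
    let ?T = "Inl ` A' \<union> Inr ` B' :: (nat + nat) set"
    let ?Z = "Z \<union> m e"
    have fT: "finite ?T" using fA fB by (auto simp: A'_def B'_def)
    have cT: "card ?T = card A' + card B'"
    proof -
      have "card ?T = card (Inl ` A' :: (nat + nat) set) + card (Inr ` B' :: (nat + nat) set)"
        using fT by (intro card_Un_disjoint) auto
      thus ?thesis by (simp add: card_image)
    qed
    have "nonzero ?P (?E - {e}) ?Z (card ?T + card A2)"
    proof (rule nonzero_singles[OF fT])
      show "?E - {e} \<subseteq> {..<N}" using Ed_N by blast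
      show "?T \<subseteq> ?W" by (auto simp: A'_def B'_def)
      show "?T \<inter> ?Z = {}" using Z e(2) x_n by (auto simp: A'_def B'_def)
      fix t assume "t \<in> ?T"
      then consider a where "t = Inl a" "a \<in> A'" | b where "t = Inr b" "b \<in> B'" by blast
      thus "\<exists>g\<in>?E - {e}. t \<in> m g \<and> m g \<subseteq> insert t ?Z"
      proof cases
        case 1
        hence a: "a \<in> A" "a \<noteq> x" "y \<in> R a" "a \<in> X" using less.prems(1) by (auto simp: A'_def)
        obtain g where g: "g \<in> ?E" "m g = {Inl a, Inr y}"
          using Ed_exists[OF a(1,4) _ a(3), of "B \<union> C"] yB by blast
        have "g \<noteq> e" using g(2) e(2) a(2) by (auto simp: doubleton_eq_iff)
        thus ?thesis using g e(2) 1 by (intro bexI[of _ g]) auto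
      next
        case 2
        hence b: "b \<in> B" "b \<noteq> y" "b \<in> R x" using less.prems(4) by (auto simp: B'_def)
        obtain g where g: "g \<in> ?E" "m g = {Inl x, Inr b}"
          using Ed_exists[OF xA xX _ b(3), of "B \<union> C"] b(1) by blast
        have "g \<noteq> e" using g(2) e(2) b(2) by (auto simp: doubleton_eq_iff)
        thus ?thesis using g e(2) 2 by (intro bexI[of _ g]) auto
      qed
    next
      \<comment> \<open>\<open>C\<close> misses row \<open>x\<close>, and the rows of
        \<open>A2\<close> miss \<open>y\<close>. So after the leaves are removed, only edges between
        \<open>A2\<close> and \<open>C\<close> remain.\<close>
      have "{f \<in> ?E - {e}. m f \<inter> ?T = {}} = Ed A2 C"
      proof (intro equalityI subsetI)
        fix f assume f: "f \<in> {f \<in> ?E - {e}. m f \<inter> ?T = {}}"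
        hence fE: "f \<in> ?E" "f \<noteq> e" "m f \<inter> ?T = {}" by auto
        obtain a d where ad: "a \<in> A" "d \<in> B \<union> C" "a \<in> X" "d \<in> R a" "m f = {Inl a, Inr d}" "f < N"
          using fE(1) by (rule EdE)
        have "m f \<noteq> m e" using inj_onD[OF inj_m, of f e] fE e(1) Ed_N by blast
        hence 1: "a \<noteq> x \<or> d \<noteq> y" using ad(5) e(2) by auto
        have 2: "a \<notin> A'" "d \<notin> B'" using fE(3) ad(5) by auto
        have "d \<notin> B" 
        proof
          assume "d \<in> B"
          hence "d = y" using 2(2) by (auto simp: B'_def)
          thus False using 1 2(1) ad(1,4) by (auto simp: A'_def)
        qed
        hence d: "d \<in> C" using ad(2) by blast
        have "a \<noteq> x" using Cx[OF d] ad(4) by auto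
        hence "a \<in> A2" using ad(1) 2(1) by (auto simp: A'_def A2_def)
        thus "f \<in> Ed A2 C" using d ad(5,6) by (auto simp: Ed_def)
      next
        fix f assume f: "f \<in> Ed A2 C"
        obtain a d where ad: "a \<in> A2" "d \<in> C" "m f = {Inl a, Inr d}" "f < N" using f by (rule EdE)
        have "f \<in> ?E" using ad A2_sub by (auto simp: Ed_def)
        moreover have "f \<noteq> e" using ad(1,3) e(2) x_n(2) by (auto simp: doubleton_eq_iff)
        moreover have "a \<notin> A'" "d \<notin> B'" using ad(1,2) x_n(3) CB by (auto simp: B'_def)
        hence "m f \<inter> ?T = {}" unfolding ad(3) by auto
        ultimately show "f \<in> {f \<in> ?E - {e}. m f \<inter> ?T = {}}" by blast
      qed
      moreover have "?Z \<union> ?T \<union> Inl ` A2 \<union> Inr ` C = ?W"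
        using A_eq yB unfolding e(2) B'_def by auto
      moreover have "(?Z \<union> ?T) \<inter> (Inl ` A2 \<union> Inr ` C) = {}"
        using Z A2_sub x_n CB yB unfolding e(2) B'_def by auto
      ultimately show "nonzero ?P {f \<in> ?E - {e}. m f \<inter> ?T = {}} (?Z \<union> ?T) (card A2)"
        using C(3)[of "?Z \<union> ?T"] by simp
    qed
    \<comment> \<open>One for the edge \<open>x y\<close>, \<open>card A' + card B'\<close> for the
      leaves and \<open>card A2\<close> from the recursion: together
      \<open>card A + card B - 1\<close>.\<close>
    hence "nonzero ?P ?E Z (Suc (card ?T + card A2))"
      by (rule nonzero_wedge[OF Ed_N e(1) ac])
    thus ?thesis unfolding cT cA cB by (simp add: add_ac)
  qed
  thus ?case using C(1,2) by (intro exI[of _ C]) blast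
qed

subsection \<open>Counting\<close>

definition cells :: "(nat \<times> nat) set" where
  "cells = (SIGMA x:X. R x)"

definition above :: "nat \<times> nat \<Rightarrow> nat set" where
  "above xy = {a \<in> X. a < fst xy \<and> (snd xy \<in> R a \<or> Max (R (fst xy)) < Max (R a))}"

definition right :: "nat \<times> nat \<Rightarrow> nat set" where
  "right xy = {b \<in> R (fst xy). snd xy < b}"

lemma fin_cells: "finite cells"
  unfolding cells_def using fin_X fin_R by blast

lemma fin_above: "finite (above xy)"
  unfolding above_def using fin_X by simp

lemma fin_right: "xy \<in> cells \<Longrightarrow> finite (right xy)"
  unfolding right_def cells_def using fin_R by auto

definition choices :: "nat \<Rightarrow> ((nat \<times> nat) \<times> (nat + nat) set) set" where
  "choices i = (SIGMA xy:cells. {S. S \<subseteq> Inl ` above xy \<union> Inr ` right xy \<and> card S = i})"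

lemma card_choices: "card (choices i) = (\<Sum>xy\<in>cells. (card (above xy) + card (right xy)) choose i)"
proof -
  have "card (choices i) = (\<Sum>xy\<in>cells. card {S. S \<subseteq> Inl ` above xy \<union> Inr ` right xy \<and> card S = i})"
    unfolding choices_def using fin_cells fin_above fin_right
    by (intro card_SigmaI ballI) auto
  also have "\<dots> = (\<Sum>xy\<in>cells. (card (above xy) + card (right xy)) choose i)"
  proof (rule sum.cong[OF refl])
    fix xy assume xy: "xy \<in> cells"
    have "card (Inl ` above xy \<union> Inr ` right xy :: (nat + nat) set) = card (above xy) + card (right xy)"
      using fin_above fin_right[OF xy] by (subst card_Un_disjoint) (auto simp: card_image)
    thus "card {S. S \<subseteq> Inl ` above xy \<union> Inr ` right xy \<and> card S = i} = (card (above xy) + card (right xy)) choose i"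
      using n_subsets[of "Inl ` above xy \<union> Inr ` right xy :: (nat + nat) set" i] fin_above fin_right[OF xy] by simp
  qed
  finally show ?thesis .
qed

text \<open>Chosen rows lie above \<open>x\<close> and chosen columns to the right of
  \<open>y\<close>, so \<open>x\<close> is the maximum and \<open>y\<close> the minimum, as
  \<open>nonzero_rows\<close> wants. The cell adds two to the \<open>i\<close> choices, giving sets
  of \<open>Suc i\<close> edges.\<close>

lemma nonzero_choice:
  assumes "(xy, S) \<in> choices i"
  shows "\<exists>C. C \<inter> R (fst xy) = {} \<and>
    nonzero (\<lambda>V. V = Inl ` insert (fst xy) (Inl -` S) \<union> Inr ` (insert (snd xy) (Inr -` S) \<union> C))
      {e. e < N \<and> m e \<subseteq> Inl ` insert (fst xy) (Inl -` S) \<union> Inr ` (insert (snd xy) (Inr -` S) \<union> C)} {} (Suc i)"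
proof -
  obtain x y where xy: "xy = (x, y)" by fastforce
  have x: "x \<in> X" "y \<in> R x" and S: "S \<subseteq> Inl ` above xy \<union> Inr ` right xy" "card S = i"
    using assms xy by (auto simp: choices_def cells_def)
  have fS: "finite S" using S(1) fin_above fin_right[of xy] x xy finite_subset
    by (fastforce simp: cells_def)
  let ?A = "insert x (Inl -` S)" and ?B = "insert y (Inr -` S)"
  have A: "a \<in> X" "a < x" "y \<in> R a \<or> Max (R x) < Max (R a)" if "Inl a \<in> S" for a
    using S(1) that xy by (auto simp: above_def)
  have B: "b \<in> R x" "y < b" if "Inr b \<in> S" for b
    using S(1) that xy by (auto simp: right_def)
  have f: "finite (Inl -` S)" "finite (Inr -` S)" using fS by (auto intro!: finite_vimageI)
  have S_eq: "S = Inl ` (Inl -` S) \<union> Inr ` (Inr -` S)"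
  proof (intro equalityI subsetI)
    fix t assume "t \<in> S"
    thus "t \<in> Inl ` (Inl -` S) \<union> Inr ` (Inr -` S)" by (cases t) auto
  qed auto
  have "card (Inl ` (Inl -` S) \<union> Inr ` (Inr -` S) :: (nat + nat) set) =
      card (Inl ` (Inl -` S) :: (nat + nat) set) + card (Inr ` (Inr -` S) :: (nat + nat) set)"
    using f fS by (intro card_Un_disjoint) auto
  hence "card S = card (Inl ` (Inl -` S) :: (nat + nat) set) + card (Inr ` (Inr -` S) :: (nat + nat) set)"
    unfolding S_eq[symmetric] .
  moreover have "card (Inl ` (Inl -` S) :: (nat + nat) set) = card (Inl -` S)" by (rule card_image) simp
  moreover have "card (Inr ` (Inr -` S) :: (nat + nat) set) = card (Inr -` S)" by (rule card_image) simp
  ultimately have cS: "card (Inl -` S) + card (Inr -` S) = i" using S(2) by metis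
  have c: "card ?A + card ?B - 1 = Suc i"
    using f cS A(2) B(2) by (auto simp: card_insert_if)
  have MaxA: "Max ?A = x" using f A(2) by (intro Max_eqI) (auto intro: less_imp_le)
  have MinB: "Min ?B = y" using f B(2) by (intro Min_eqI) (auto intro: less_imp_le)
  have "\<exists>C. C \<subseteq> {Max (R x)<..} \<and> C \<subseteq> Y \<and> (\<forall>Z. Z \<inter> (Inl ` ?A \<union> Inr ` (?B \<union> C)) = {} \<longrightarrow>
    nonzero (\<lambda>V. V = Z \<union> Inl ` ?A \<union> Inr ` (?B \<union> C)) (Ed ?A (?B \<union> C)) Z (card ?A + card ?B - 1))"
    by (rule nonzero_rows[where y = y]) (use x A B MaxA MinB in auto)
  then obtain C where C: "C \<subseteq> {Max (R x)<..}"
    "nonzero (\<lambda>V. V = {} \<union> Inl ` ?A \<union> Inr ` (?B \<union> C)) (Ed ?A (?B \<union> C)) {} (Suc i)"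
    unfolding c by blast
  have "C \<inter> R x = {}" using C(1) R_le_Max[OF x(1)] by force
  thus ?thesis using C(2) unfolding Ed_def xy by (intro exI[of _ C]) simp
qed

text \<open>The degree determines the choice: \<open>x\<close> is its largest row, and
  \<open>y\<close> is its smallest column within row \<open>x\<close>, as the extra columns avoid
  this row. The remaining rows, and the remaining columns within row \<open>x\<close>, are the
  chosen ones.\<close>

lemma nonzero_family:
  "\<exists>\<W>. finite \<W> \<and> card \<W> = (\<Sum>xy\<in>cells. (card (above xy) + card (right xy)) choose i) \<and>
    (\<forall>W\<in>\<W>. nonzero (\<lambda>V. V = W) {e. e < N \<and> m e \<subseteq> W} {} (Suc i))"
proof -
  define deg where "deg t C = Inl ` insert (fst (fst t)) (Inl -` snd t) \<union> Inr ` (insert (snd (fst t)) (Inr -` snd t) \<union> C)"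
    for t :: "(nat \<times> nat) \<times> (nat + nat) set" and C
  have "\<forall>t\<in>choices i. \<exists>C. C \<inter> R (fst (fst t)) = {} \<and> nonzero (\<lambda>V. V = deg t C) {e. e < N \<and> m e \<subseteq> deg t C} {} (Suc i)"
  proof
    fix t assume t: "t \<in> choices i"
    obtain xy S where "t = (xy, S)" by fastforce
    thus "\<exists>C. C \<inter> R (fst (fst t)) = {} \<and> nonzero (\<lambda>V. V = deg t C) {e. e < N \<and> m e \<subseteq> deg t C} {} (Suc i)"
      using nonzero_choice[of xy S i] t unfolding deg_def by simp
  qed
  from bchoice[OF this] obtain C where C: "\<And>t. t \<in> choices i \<Longrightarrow> C t \<inter> R (fst (fst t)) = {}"
    "\<And>t. t \<in> choices i \<Longrightarrow> nonzero (\<lambda>V. V = deg t (C t)) {e. e < N \<and> m e \<subseteq> deg t (C t)} {} (Suc i)" by blast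
  have inj: "inj_on (\<lambda>t. deg t (C t)) (choices i)"
  proof (rule inj_onI)
    fix t t' assume t: "t \<in> choices i" "t' \<in> choices i" and eq: "deg t (C t) = deg t' (C t')"
    obtain x y S where tt: "t = ((x, y), S)" by (metis prod.collapse)
    obtain x' y' S' where tt': "t' = ((x', y'), S')" by (metis prod.collapse)
    have info: "(\<forall>a\<in>Inl -` S. a < x) \<and> (\<forall>b\<in>Inr -` S. y < b \<and> b \<in> R x) \<and> y \<in> R x \<and> C ((x, y), S) \<inter> R x = {} \<and> finite S"
      if "((x, y), S) \<in> choices i" for x y S
    proof -
      have S: "S \<subseteq> Inl ` above (x, y) \<union> Inr ` right (x, y)" and cell: "(x, y) \<in> cells"
        using that by (auto simp: choices_def)
      have "finite S" using finite_subset[OF S] fin_above fin_right[OF cell] by blast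
      moreover have "C ((x, y), S) \<inter> R x = {}" using C(1)[OF that] by simp
      ultimately show ?thesis using S cell by (auto simp: above_def right_def cells_def)
    qed
    note i = info[OF t(1)[unfolded tt]] and i' = info[OF t(2)[unfolded tt']]
    have L: "insert x (Inl -` S) = insert x' (Inl -` S')"
    proof -
      have "Inl -` deg t (C t) = insert x (Inl -` S)" "Inl -` deg t' (C t') = insert x' (Inl -` S')"
        unfolding deg_def tt tt' by auto
      thus ?thesis using eq by simp
    qed
    have f: "finite (Inl -` S)" "finite (Inl -` S')" "finite (Inr -` S)" "finite (Inr -` S')"
      using i i' by (auto intro!: finite_vimageI)
    have "Max (insert x (Inl -` S)) = x" using f i by (intro Max_eqI) (auto intro: less_imp_le)
    moreover have "Max (insert x' (Inl -` S')) = x'" using f i' by (intro Max_eqI) (auto intro: less_imp_le)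
    ultimately have x: "x = x'" using L by simp
    hence LS: "Inl -` S = Inl -` S'" using L i i' by (metis insert_ident less_irrefl)
    have Rr: "insert y (Inr -` S) = insert y' (Inr -` S')"
    proof -
      have "Inr -` deg t (C t) \<inter> R x = insert y (Inr -` S)" unfolding deg_def tt using i by auto
      moreover have "Inr -` deg t' (C t') \<inter> R x' = insert y' (Inr -` S')" unfolding deg_def tt' using i' by auto
      ultimately show ?thesis using eq x by simp
    qed
    have "Min (insert y (Inr -` S)) = y" using f i by (intro Min_eqI) (auto intro: less_imp_le)
    moreover have "Min (insert y' (Inr -` S')) = y'" using f i' by (intro Min_eqI) (auto intro: less_imp_le)
    ultimately have y: "y = y'" using Rr by simp
    hence RS: "Inr -` S = Inr -` S'" using Rr i i' by (metis insert_ident less_irrefl)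
    have "S = S'"
    proof -
      have "s \<in> S \<longleftrightarrow> s \<in> S'" for s using LS RS by (cases s) (auto simp: set_eq_iff)
      thus ?thesis by blast
    qed
    thus "t = t'" using tt tt' x y by simp
  qed
  have fin: "finite (choices i)"
    unfolding choices_def using fin_cells fin_above fin_right by (intro finite_SigmaI) auto
  show ?thesis
  proof (intro exI[of _ "(\<lambda>t. deg t (C t)) ` choices i"] conjI ballI)
    show "finite ((\<lambda>t. deg t (C t)) ` choices i)" using fin by simp
    show "card ((\<lambda>t. deg t (C t)) ` choices i) = (\<Sum>xy\<in>cells. (card (above xy) + card (right xy)) choose i)"
      using card_image[OF inj] card_choices by simp
    fix W assume "W \<in> (\<lambda>t. deg t (C t)) ` choices i"
    then obtain t where t: "t \<in> choices i" "W = deg t (C t)" by blast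
    show "nonzero (\<lambda>V. V = W) {e. e < N \<and> m e \<subseteq> W} {} (Suc i)" unfolding t(2) by (rule C(2)[OF t(1)])
  qed
qed

definition pair_of :: "nat \<times> nat \<Rightarrow> nat set" where
  "pair_of xy = {Suc (card (above xy)), Suc (card (above xy)) + Suc (card (right xy))}"

lemma pair_of: "pair_of xy \<in> pos_pairs" "Max (pair_of xy) - 2 = card (above xy) + card (right xy)"
  unfolding pair_of_def by (intro pos_pairsI) auto

text \<open>A row that ends further right lies higher. It and all rows above it end beyond row
  \<open>x'\<close>, so they are all counted there. Consequently the size of \<open>above\<close>
  determines the right end of the row.\<close>

lemma above_less:
  assumes x: "x \<in> X" "x' \<in> X" and c: "y' \<in> R x'" and "Max (R x') < Max (R x)"
  shows "card (above (x, y)) < card (above (x', y'))"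
proof (rule psubset_card_mono[OF fin_above])
  have "x < x'"
  proof (rule ccontr)
    assume "\<not> x < x'"
    then show False using R_Max[OF x(2,1)] assms(4) by (cases "x = x'") auto
  qed
  have "a \<in> above (x', y')" if a: "a \<in> above (x, y)" for a
  proof -
    have "a \<in> X" "a < x" using a by (auto simp: above_def)
    moreover from this have "Max (R x) \<le> Max (R a)" using R_Max x(1) by blast
    ultimately show ?thesis using \<open>x < x'\<close> assms(4) by (auto simp: above_def)
  qed
  moreover have "x \<in> above (x', y')" "x \<notin> above (x, y)" using \<open>x < x'\<close> assms by (auto simp: above_def)
  ultimately show "above (x, y) \<subset> above (x', y')" by blast
qed

text \<open>The size of \<open>above\<close> fixes the right end, then the size of
  \<open>right\<close> fixes the column, and finally the size of \<open>above\<close> separates rows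
  with the same end that contain this column.\<close>

lemma inj_pair_of: "inj_on pair_of cells"
proof (rule inj_onI)
  fix t t' assume t: "t \<in> cells" "t' \<in> cells" and eq: "pair_of t = pair_of t'"
  obtain x y where tt: "t = (x, y)" by fastforce
  obtain x' y' where tt': "t' = (x', y')" by fastforce
  have x: "x \<in> X" "y \<in> R x" "x' \<in> X" "y' \<in> R x'" using t tt tt' by (auto simp: cells_def)
  have eqs: "card (above (x, y)) = card (above (x', y'))" "card (right (x, y)) = card (right (x', y'))"
    using eq unfolding tt tt' pair_of_def by (auto simp: doubleton_eq_iff)
  have M: "Max (R x) = Max (R x')"
    using above_less[OF x(1,3,4), of y] above_less[OF x(3,1,2), of y'] eqs(1) by fastforce
  \<comment> \<open>By convexity the row enters only through its right end, which makes cells of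
    different rows comparable.\<close>
  have right: "right (x, y) = {b \<in> Y. y < b \<and> b \<le> Max (R x)}" if "x \<in> X" "y \<in> R x" for x y
    using that R_Y[OF that(1)] R_le_Max[OF that(1)] R_convex[OF that Max_R[OF that(1)]]
    by (auto simp: right_def)
  have right_less: "card (right (x', y')) < card (right (x, y))"
    if "y < y'" "x \<in> X" "y \<in> R x" "x' \<in> X" "y' \<in> R x'" "Max (R x) = Max (R x')" for x y x' y'
  proof (rule psubset_card_mono)
    show "finite (right (x, y))" unfolding right[OF that(2,3)] using fin_Y by simp
    have "y' \<in> right (x, y)" unfolding right[OF that(2,3)]
      using that R_Y[OF that(4)] R_le_Max[OF that(4,5)] by auto
    moreover have "right (x', y') \<subseteq> right (x, y)" unfolding right[OF that(2,3)] right[OF that(4,5)] using that by auto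
    moreover have "y' \<notin> right (x', y')" by (simp add: right_def)
    ultimately show "right (x', y') \<subset> right (x, y)" by blast
  qed
  have y: "y = y'"
    using right_less[of y y' x x'] right_less[of y' y x' x] x M eqs(2) by (metis less_irrefl linorder_neqE_nat)
  have above_lt: "card (above (x, y)) < card (above (x', y))"
    if "x < x'" "x \<in> X" "y \<in> R x" "x' \<in> X" "Max (R x) = Max (R x')" for x x'
  proof (rule psubset_card_mono[OF fin_above])
    have "x \<in> above (x', y)" "x \<notin> above (x, y)" using that by (auto simp: above_def)
    moreover have "above (x, y) \<subseteq> above (x', y)" using that by (auto simp: above_def)
    ultimately show "above (x, y) \<subset> above (x', y)" by blast
  qed
  have "x = x'"
    using above_lt[of x x'] above_lt[of x' x] x M eqs(1) y by (metis less_irrefl linorder_neqE_nat)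
  thus "t = t'" using tt tt' y by simp
qed

end

section \<open>Edge ideals as monomial ideals\<close>

lemma poly_ring_simps [simp]:
  "mult (poly_ring V) = (*)" "one (poly_ring V) = 1" "zero (poly_ring V) = 0" "add (poly_ring V) = (+)"
  by (simp_all add: poly_ring_def)

lemma ring_poly_ring: "ring (poly_ring V :: ('v, 'k::comm_ring_1) mpol ring)"
proof (rule ringI)
  show "abelian_group (poly_ring V :: ('v, 'k) mpol ring)"
  proof (rule abelian_groupI)
    fix x :: "('v, 'k) mpol" assume x: "x \<in> carrier (poly_ring V)"
    have "- x \<in> carrier (poly_ring V)"
      using poly_ring_carrier_closed(3)[OF poly_ring_zero_one(1) x] by simp
    thus "\<exists>y\<in>carrier (poly_ring V). y \<oplus>\<^bsub>poly_ring V\<^esub> x = \<zero>\<^bsub>poly_ring V\<^esub>"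
      by (intro bexI[of _ "- x"]) simp_all
  qed (simp_all add: poly_ring_carrier_closed poly_ring_zero_one add.assoc add.commute)
  show "Group.monoid (poly_ring V :: ('v, 'k) mpol ring)"
    by (rule monoidI) (simp_all add: poly_ring_carrier_closed poly_ring_zero_one mult.assoc)
qed (simp_all add: distrib_left distrib_right)

definition mon_ideal :: "'v set \<Rightarrow> ('v \<Rightarrow>\<^sub>0 nat) set \<Rightarrow> ('v, 'k::comm_ring_1) mpol set" where
  "mon_ideal V M = {p \<in> carrier (poly_ring V). \<forall>t\<in>Poly_Mapping.keys p. \<exists>s\<in>M. mdvd s t}"

lemma ideal_mon_ideal: "ideal (mon_ideal V M :: ('v, 'k::comm_ring_1) mpol set) (poly_ring V)"
proof -
  let ?I = "mon_ideal V M :: ('v, 'k) mpol set"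
  interpret ring "poly_ring V :: ('v, 'k) mpol ring" by (rule ring_poly_ring)
  have uminus: "- p \<in> ?I" if p: "p \<in> ?I" for p
  proof -
    have "- p \<in> carrier (poly_ring V)"
      using poly_ring_carrier_closed(3)[OF poly_ring_zero_one(1), of p V] p by (simp add: mon_ideal_def)
    moreover have "Poly_Mapping.keys (- p) = Poly_Mapping.keys p" by (auto simp: in_keys_iff)
    ultimately show ?thesis using p by (simp add: mon_ideal_def)
  qed
  have l: "q * p \<in> ?I" if p: "p \<in> ?I" and q: "q \<in> carrier (poly_ring V)" for p q
  proof -
    have "\<exists>s\<in>M. mdvd s t" if t: "t \<in> Poly_Mapping.keys (q * p)" for t
    proof -
      obtain a b where ab: "t = a + b" "b \<in> Poly_Mapping.keys p"
        using t Poly_Mapping.keys_mult[of q p] by blast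
      obtain s where "s \<in> M" "mdvd s b" using p ab(2) by (auto simp: mon_ideal_def)
      thus ?thesis using mdvd_trans[of s b t] ab(1) by auto
    qed
    thus ?thesis using p q poly_ring_carrier_closed(2) by (auto simp: mon_ideal_def)
  qed
  show ?thesis
  proof (rule idealI[OF ring_poly_ring])
    show "subgroup ?I (add_monoid (poly_ring V))"
    proof
      show "?I \<subseteq> carrier (add_monoid (poly_ring V))" by (auto simp: mon_ideal_def)
      show "\<one>\<^bsub>add_monoid (poly_ring V)\<^esub> \<in> ?I" by (simp add: mon_ideal_def poly_ring_zero_one)
      fix p assume p: "p \<in> ?I"
      hence pc: "p \<in> carrier (poly_ring V)" "- p \<in> carrier (poly_ring V)" using uminus by (auto simp: mon_ideal_def)
      have "inv\<^bsub>add_monoid (poly_ring V)\<^esub> p = - p"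
        using minus_equality[of "- p" p] pc by (simp add: a_inv_def)
      thus "inv\<^bsub>add_monoid (poly_ring V)\<^esub> p \<in> ?I" using uminus[OF p] by simp
    next
      fix p q assume p: "p \<in> ?I" "q \<in> ?I"
      have "Poly_Mapping.keys (p + q) \<subseteq> Poly_Mapping.keys p \<union> Poly_Mapping.keys q" by (rule Poly_Mapping.keys_add)
      moreover have "p + q \<in> carrier (poly_ring V)" using p poly_ring_carrier_closed(1) by (auto simp: mon_ideal_def)
      ultimately show "p \<otimes>\<^bsub>add_monoid (poly_ring V)\<^esub> q \<in> ?I" using p by (auto simp: mon_ideal_def)
    qed
    fix p q :: "('v, 'k) mpol" assume "p \<in> ?I" "q \<in> carrier (poly_ring V)"
    from l[OF this] show "q \<otimes>\<^bsub>poly_ring V\<^esub> p \<in> ?I" "p \<otimes>\<^bsub>poly_ring V\<^esub> q \<in> ?I" by (simp_all add: mult.commute)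
  qed
qed

text \<open>A polynomial is the sum of its terms, and each term is a multiple of a
  generator.\<close>

lemma genideal_monomials:
  assumes V: "\<And>s. s \<in> M \<Longrightarrow> Poly_Mapping.keys s \<subseteq> V"
  shows "genideal (poly_ring V) ((\<lambda>s. Poly_Mapping.single s 1) ` M) = (mon_ideal V M :: ('v, 'k::field) mpol set)"
proof -
  interpret ring "poly_ring V :: ('v, 'k) mpol ring" by (rule ring_poly_ring)
  let ?S = "(\<lambda>s. Poly_Mapping.single s 1 :: ('v, 'k) mpol) ` M"
  have S: "?S \<subseteq> carrier (poly_ring V)" using V by (auto simp: poly_ring_carrier_iff)
  have "?S \<subseteq> mon_ideal V M"
  proof
    fix p assume "p \<in> ?S"
    then obtain s where s: "s \<in> M" "p = Poly_Mapping.single s 1" by blast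
    have "mdvd s s" by (simp add: mdvd_iff)
    thus "p \<in> mon_ideal V M" using s S by (auto simp: mon_ideal_def)
  qed
  hence 1: "genideal (poly_ring V) ?S \<subseteq> mon_ideal V M" by (rule genideal_minimal[OF ideal_mon_ideal])
  interpret J: ideal "genideal (poly_ring V) ?S" "poly_ring V" by (rule genideal_ideal[OF S])
  have "p \<in> genideal (poly_ring V) ?S" if p: "p \<in> mon_ideal V M" for p
  proof -
    have monom: "Poly_Mapping.single t c \<in> genideal (poly_ring V) ?S" if t: "t \<in> Poly_Mapping.keys p" for t c
    proof -
      obtain s v where s: "s \<in> M" "t = s + v" using p t by (auto simp: mon_ideal_def mdvd_def)
      have "Poly_Mapping.keys t \<subseteq> V" using p t by (auto simp: mon_ideal_def poly_ring_carrier_iff)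
      moreover have "Poly_Mapping.keys v \<subseteq> Poly_Mapping.keys t"
        unfolding s(2) add.commute[of s] by (rule keys_subset_keys_add)
      ultimately have "Poly_Mapping.single v c \<in> carrier (poly_ring V)" by (auto simp: poly_ring_carrier_iff)
      moreover have "Poly_Mapping.single s 1 \<in> genideal (poly_ring V) ?S" using genideal_self[OF S] s(1) by blast
      ultimately have "Poly_Mapping.single v c * Poly_Mapping.single s 1 \<in> genideal (poly_ring V) ?S"
        using J.I_l_closed by simp
      thus ?thesis unfolding s(2) by (simp add: mult_single add.commute)
    qed
    have "(\<Sum>t\<in>A. Poly_Mapping.single t (Poly_Mapping.lookup p t)) \<in> genideal (poly_ring V) ?S"
      if "finite A" "A \<subseteq> Poly_Mapping.keys p" for A
      using that
    proof (induction A rule: finite_induct)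
      case empty
      then show ?case using J.zero_closed by simp
    next
      case (insert t A)
      then show ?case using J.a_closed[OF monom[of t]] by simp
    qed
    moreover have "(\<Sum>t\<in>Poly_Mapping.keys p. Poly_Mapping.single t (Poly_Mapping.lookup p t)) = p"
      by (intro poly_mapping_eqI) (auto simp: lookup_sum lookup_single when_def in_keys_iff)
    ultimately show ?thesis by (metis finite_keys order_refl)
  qed
  with 1 show ?thesis by blast
qed

lemma min_gens_mon_ideal:
  assumes V: "\<And>s. s \<in> M \<Longrightarrow> Poly_Mapping.keys s \<subseteq> V"
    and anti: "\<And>s t. s \<in> M \<Longrightarrow> t \<in> M \<Longrightarrow> mdvd s t \<Longrightarrow> s = t"
  shows "min_gens (mon_ideal V M :: ('v, 'k::field) mpol set) = M"
proof -
  have single: "Poly_Mapping.single t 1 \<in> (mon_ideal V M :: ('v, 'k) mpol set) \<longleftrightarrow>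
      Poly_Mapping.keys t \<subseteq> V \<and> (\<exists>s\<in>M. mdvd s t)" for t
    by (simp add: mon_ideal_def poly_ring_carrier_iff)
  have antisym: "s = t" if "mdvd s t" "mdvd t s" for s t :: "'v \<Rightarrow>\<^sub>0 nat"
    using that unfolding mdvd_iff by (intro poly_mapping_eqI) (meson order_antisym)
  show ?thesis
  proof (intro equalityI subsetI)
    fix t assume "t \<in> min_gens (mon_ideal V M :: ('v, 'k) mpol set)"
    hence t: "Poly_Mapping.keys t \<subseteq> V" "\<exists>s\<in>M. mdvd s t"
      and min: "\<And>m' s. Poly_Mapping.keys m' \<subseteq> V \<Longrightarrow> \<exists>s\<in>M. mdvd s m' \<Longrightarrow> t = m' + s \<Longrightarrow> m' = t"
      unfolding min_gens_def single by blast+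
    obtain s v where s: "s \<in> M" "t = s + v" using t(2) by (auto simp: mdvd_def)
    have "mdvd s s" by (simp add: mdvd_iff)
    hence "s = t" using min[OF V[OF s(1)] _ s(2)] s(1) by blast
    thus "t \<in> M" using s(1) by simp
  next
    fix t assume t: "t \<in> M"
    have "m' = t" if ex: "\<exists>s\<in>M. mdvd s m'" and t_eq: "t = m' + s" for m' s
    proof -
      obtain s' where s': "s' \<in> M" "mdvd s' m'" using ex by blast
      have "mdvd m' t" using t_eq by simp
      hence "s' = t" using anti[OF s'(1) t] mdvd_trans s'(2) by blast
      thus ?thesis using antisym s'(2) \<open>mdvd m' t\<close> by blast
    qed
    moreover have "mdvd t t" by (simp add: mdvd_iff)
    ultimately show "t \<in> min_gens (mon_ideal V M :: ('v, 'k) mpol set)"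
      unfolding min_gens_def single using t V[OF t] by blast
  qed
qed

text \<open>The substitution keeps the ends of an edge apart and distinct edges distinct, so the
  labels of single edges generate an edge ideal. The last assumption carries the exactness of the
  substituted complex.\<close>

locale edge_ideal_resolution = edge_labels N m type_k sp
  for N :: nat and m :: "nat \<Rightarrow> 'w set" and type_k :: "'k::field itself" and sp :: "'w \<Rightarrow> 'v" +
  fixes V :: "'v set"
  assumes two: "\<And>e. e < N \<Longrightarrow> \<exists>a b. m e = {a, b} \<and> sp a \<noteq> sp b"
    and inj_sp: "inj_on (\<lambda>e. sp ` m e) {..<N}"
    and sp_V: "\<And>e. e < N \<Longrightarrow> sp ` m e \<subseteq> V"
    and cones: "\<And>t e. e < N \<Longrightarrow> mdvd (lab (m e)) t \<Longrightarrow> \<exists>e. cone t e"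
begin

abbreviation "I \<equiv> edge_ideal V ((\<lambda>e. sp ` m e) ` {..<N}) :: ('v, 'k) mpol set"

lemma keys_lab_edge: "s \<in> (\<lambda>e. lab (m e)) ` {..<N} \<Longrightarrow> Poly_Mapping.keys s \<subseteq> V"
  using sp_V fin_m by (auto simp: keys_lab image_subset_iff)

lemma edge_ideal_eq: "I = mon_ideal V ((\<lambda>e. lab (m e)) ` {..<N})"
proof -
  have Mvar2: "Mvar u * Mvar v = (Poly_Mapping.single (Poly_Mapping.single u 1 + Poly_Mapping.single v 1) 1 :: ('v, 'k) mpol)" for u v
    by (simp add: Mvar_def mult_single)
  have lab2: "lab {a, b} = Poly_Mapping.single (sp a) 1 + Poly_Mapping.single (sp b) 1" if "sp a \<noteq> sp b" for a b
  proof -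
    have "a \<noteq> b" using that by auto
    thus ?thesis by (simp add: lab_def)
  qed
  have "{Mvar u * Mvar v | u v. u \<noteq> v \<and> {u, v} \<in> (\<lambda>e. sp ` m e) ` {..<N}} =
      (\<lambda>s. Poly_Mapping.single s 1 :: ('v, 'k) mpol) ` (\<lambda>e. lab (m e)) ` {..<N}"
  proof (intro equalityI subsetI)
    fix p assume "p \<in> {Mvar u * Mvar v :: ('v, 'k) mpol | u v. u \<noteq> v \<and> {u, v} \<in> (\<lambda>e. sp ` m e) ` {..<N}}"
    then obtain u v e where p: "p = Mvar u * Mvar v" "u \<noteq> v" "{u, v} = sp ` m e" "e < N" by auto
    obtain a b where ab: "m e = {a, b}" "sp a \<noteq> sp b" using two[OF p(4)] by blast
    have "{u, v} = {sp a, sp b}" using p(3) ab(1) by simp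
    hence "p = Poly_Mapping.single (lab (m e)) 1"
      unfolding p(1) Mvar2 ab(1) lab2[OF ab(2)] by (auto simp: doubleton_eq_iff add.commute)
    thus "p \<in> (\<lambda>s. Poly_Mapping.single s 1) ` (\<lambda>e. lab (m e)) ` {..<N}" using p(4) by blast
  next
    fix p assume "p \<in> (\<lambda>s. Poly_Mapping.single s 1 :: ('v, 'k) mpol) ` (\<lambda>e. lab (m e)) ` {..<N}"
    then obtain e where e: "e < N" "p = Poly_Mapping.single (lab (m e)) 1" by auto
    obtain a b where ab: "m e = {a, b}" "sp a \<noteq> sp b" using two[OF e(1)] by blast
    have "p = Mvar (sp a) * Mvar (sp b)" unfolding e(2) Mvar2 ab(1) lab2[OF ab(2)] ..
    moreover have "{sp a, sp b} \<in> (\<lambda>e. sp ` m e) ` {..<N}" using e(1) ab(1) by (intro image_eqI[of _ _ e]) auto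
    ultimately show "p \<in> {Mvar u * Mvar v | u v. u \<noteq> v \<and> {u, v} \<in> (\<lambda>e. sp ` m e) ` {..<N}}"
      using ab(2) by blast
  qed
  thus ?thesis unfolding edge_ideal_def using genideal_monomials[OF keys_lab_edge] by simp
qed

text \<open>Divisibility of edge monomials is inclusion of two-element sets, hence equality.\<close>

lemma card_min_gens: "card (min_gens I) = N"
proof -
  have eq: "e = f" if ef: "e < N" "f < N" and d: "mdvd (lab (m e)) (lab (m f))" for e f
  proof -
    have "Poly_Mapping.keys (lab (m e)) \<subseteq> Poly_Mapping.keys (lab (m f))"
      using d unfolding mdvd_iff by (auto simp: in_keys_iff) (metis not_gr_zero not_le)
    hence sub: "sp ` m e \<subseteq> sp ` m f" using ef fin_m keys_lab by simp
    have "card (sp ` m g) = 2" if "g < N" for g using two[OF that] by auto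
    hence "sp ` m e = sp ` m f" using sub ef fin_m by (intro card_subset_eq) auto
    thus ?thesis using inj_onD[OF inj_sp] ef by simp
  qed
  have "min_gens I = (\<lambda>e. lab (m e)) ` {..<N}"
    unfolding edge_ideal_eq
    by (rule min_gens_mon_ideal[OF keys_lab_edge]) (use eq in auto)
  moreover have "inj_on (\<lambda>e. lab (m e)) {..<N}"
    using eq by (intro inj_onI) (auto simp: mdvd_iff)
  ultimately show ?thesis by (simp add: card_image)
qed

lemma betti_eq: "betti V I i = homology_dim taylor_rank (taylor_diff :: nat \<Rightarrow> ('v, 'k) mpol mat) i"
  and betti_le_iff: "betti V I i \<le> b \<longleftrightarrow> homology_spanned taylor_rank (taylor_diff :: nat \<Rightarrow> ('v, 'k) mpol mat) i b"
proof -
  have "free_resolution V {p \<in> carrier (poly_ring V). \<forall>t\<in>Poly_Mapping.keys p. \<exists>e<N. mdvd (lab (U {e})) t}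
    taylor_rank (taylor_aug :: ('v, 'k) mpol vec) taylor_diff"
  proof (rule taylor_resolution)
    fix e s assume "e < N" "s \<subseteq> {..<N}"
    thus "Poly_Mapping.keys (lab (m e - U s)) \<subseteq> V" using sp_V[of e] fin_m[of e] keys_lab[of "m e - U s"] by auto
  next
    fix t e assume "e < N" "mdvd (lab (U {e})) t"
    thus "\<exists>e. cone t e" using cones by simp
  qed (simp add: lab_def)
  moreover have "{p \<in> carrier (poly_ring V). \<forall>t\<in>Poly_Mapping.keys p. \<exists>e<N. mdvd (lab (U {e})) t} = I"
    unfolding edge_ideal_eq mon_ideal_def by auto
  ultimately have res: "free_resolution V I taylor_rank taylor_aug taylor_diff" by simp
  show eq: "betti V I i = homology_dim taylor_rank (taylor_diff :: nat \<Rightarrow> ('v, 'k) mpol mat) i"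
    by (rule betti_eq_homology_dim[OF res])
  show "betti V I i \<le> b \<longleftrightarrow> homology_spanned taylor_rank (taylor_diff :: nat \<Rightarrow> ('v, 'k) mpol mat) i b"
    unfolding eq by (rule homology_dim_le_iff[OF res])
qed

lemma betti_le: "spanned (\<lambda>_. True) {..<N} {} (Suc i) b \<Longrightarrow> betti V I i \<le> b"
  unfolding betti_le_iff by (rule homology_spanned_if_spanned)

lemma le_betti:
  assumes "finite \<W>" "\<And>W. W \<in> \<W> \<Longrightarrow> nonzero (\<lambda>X. X = W) {e. e < N \<and> m e \<subseteq> W} {} (Suc i)"
  shows "card \<W> \<le> betti V I i"
  by (rule card_le_if_homology_spanned[OF _ assms]) (use betti_le_iff in blast)

end

section \<open>The upper and the lower bound, and their comparison\<close>

text \<open>Without identifications the label of a union is the least common multiple, so any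
  generator dividing \<open>t\<close> is a cone point: the classical Taylor resolution.\<close>

lemma (in edge_labels) cone_if_inj:
  assumes "inj sp" "e < N" "mdvd (lab (m e)) t"
  shows "cone t e"
  unfolding cone_def
proof (intro conjI allI impI)
  fix s assume s: "s \<subseteq> {..<N} \<and> mdvd (lab (U s)) t"
  have f: "finite (U s)" "finite (m e)" using s fin_U fin_m assms(2) by auto
  hence fU: "finite (U (insert e s))" by simp
  show "mdvd (lab (U (insert e s))) t"
    unfolding mdvd_iff
  proof
    fix v
    have one: "card {w \<in> A. sp w = v} \<le> Poly_Mapping.lookup t v" if A: "finite A" "A \<subseteq> {w}" "w \<in> B" "finite B" "mdvd (lab B) t" "sp w = v"
      for A B w
    proof -
      have "card {w \<in> A. sp w = v} \<le> card {w \<in> B. sp w = v}"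
        using that by (intro card_mono) auto
      also have "\<dots> \<le> Poly_Mapping.lookup t v" using that(4,5) lookup_lab[of B v] unfolding mdvd_iff by metis
      finally show ?thesis .
    qed
    show "Poly_Mapping.lookup (lab (U (insert e s))) v \<le> Poly_Mapping.lookup t v"
    proof (cases "\<exists>w\<in>U (insert e s). sp w = v")
      case False
      hence "{w \<in> U (insert e s). sp w = v} = {}" by blast
      hence "Poly_Mapping.lookup (lab (U (insert e s))) v = 0" using lookup_lab[OF fU, of v] by (simp only: card.empty)
      then show ?thesis by simp
    next
      case True
      then obtain w where w: "w \<in> m e \<union> U s" "sp w = v" by auto
      have "w' = w" if "sp w' = v" for w' using injD[OF assms(1), of w' w] that w(2) by simp
      moreover have "w \<in> U (insert e s)" using w(1) by simp
      ultimately have "{w' \<in> U (insert e s). sp w' = v} = {w' \<in> {w}. sp w' = v}" by blast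
      moreover have "card {w' \<in> {w}. sp w' = v} \<le> Poly_Mapping.lookup t v"
      proof (cases "w \<in> m e")
        case True
        show ?thesis by (rule one[OF _ order_refl True f(2) assms(3) w(2)]) simp
      next
        case False
        hence "w \<in> U s" using w(1) by blast
        then show ?thesis by (rule one[OF _ order_refl _ f(1) conjunct2[OF s] w(2), rotated]) simp
      qed
      ultimately show ?thesis unfolding lookup_lab[OF fU] by (simp only:)
    qed
  qed
qed (rule assms(2))

lemma colexsegment_betti:
  fixes W :: "nat set"
  assumes C: "colexsegment C" and W: "\<Union>C \<subseteq> W"
  shows "card (min_gens (edge_ideal W C :: (nat, 'k::field) mpol set)) = card C"
    and "betti W (edge_ideal W C :: (nat, 'k) mpol set) i \<le> (\<Sum>S\<in>C. (Max S - 2) choose i)"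
proof -
  have fC: "finite C" and Cp: "C \<subseteq> pos_pairs" using C by (auto simp: colexsegment_def)
  obtain m where m: "bij_betw m {..<card C} C"
    using ex_bij_betw_nat_finite[OF fC] by (auto simp: lessThan_atLeast0)
  have mC: "m e \<in> C" if "e < card C" for e using m that by (auto simp: bij_betw_def)
  have pair: "\<exists>a b. m e = {a, b} \<and> id a \<noteq> id b" if "e < card C" for e
  proof -
    have "m e \<in> pos_pairs" using mC[OF that] Cp by blast
    thus ?thesis by (rule pos_pairsE) (metis id_apply nat_neq_iff)
  qed
  interpret edge_labels "card C" m "TYPE('k)" "id :: nat \<Rightarrow> nat"
    using pair by unfold_locales (metis finite.emptyI finite_insert, metis insert_not_empty)
  interpret edge_ideal_resolution "card C" m "TYPE('k)" "id :: nat \<Rightarrow> nat" W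
  proof
    show "inj_on (\<lambda>e. id ` m e) {..<card C}" using m by (simp add: bij_betw_def)
    show "id ` m e \<subseteq> W" if "e < card C" for e using mC[OF that] W by auto
    show "\<exists>e. cone t e" if "e < card C" "mdvd (lab (m e)) t" for t e using cone_if_inj[OF _ that] by auto
  qed (rule pair)
  interpret colex_complex "card C" m "TYPE('k)" .
  have img: "m ` {..<card C} = C" using m by (simp add: bij_betw_def)
  hence I: "(\<lambda>e. id ` m e) ` {..<card C} = C" by simp
  show "card (min_gens (edge_ideal W C :: (nat, 'k) mpol set)) = card C"
    using card_min_gens unfolding I .
  have "spanned (\<lambda>_. True) {..<card C} {} (Suc i) (\<Sum>e<card C. (Max (m e) - 2) choose i)"
    using m C img by (intro spanned_colexsegment) (auto simp: bij_betw_def)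
  also have "(\<Sum>e<card C. (Max (m e) - 2) choose i) = (\<Sum>S\<in>C. (Max S - 2) choose i)"
    by (rule sum.reindex_bij_betw[OF m])
  finally show "betti W (edge_ideal W C :: (nat, 'k) mpol set) i \<le> (\<Sum>S\<in>C. (Max S - 2) choose i)"
    using betti_le unfolding I by blast
qed

locale skew_ideal = skew_shape N m type_k X Y R + edge_ideal_resolution N m type_k sp V
  for N :: nat and m :: "nat \<Rightarrow> (nat + nat) set" and type_k :: "'k::field itself"
    and X Y :: "nat set" and R :: "nat \<Rightarrow> nat set" and sp :: "nat + nat \<Rightarrow> 'v" and V :: "'v set"
begin

lemma card_cells: "card cells = N"
proof -
  have "m ` {..<N} = (\<lambda>(x, y). {Inl x, Inr y}) ` cells" unfolding edges cells_def by auto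
  moreover have "inj_on (\<lambda>(x, y). {Inl x, Inr y} :: (nat + nat) set) cells"
    by (rule inj_onI) (auto simp: doubleton_eq_iff)
  ultimately have "card (m ` {..<N}) = card cells" by (simp add: card_image)
  thus ?thesis using card_image[OF inj_m] by simp
qed

theorem obeys: "obeys_colex_lower_bound V I"
  unfolding obeys_colex_lower_bound_def
proof (intro allI impI, elim conjE)
  fix C W i and J :: "(nat, 'k) mpol set"
  assume C: "colexsegment C" and W: "\<Union>C \<subseteq> W" and J: "J = edge_ideal W C"
    and card: "card (min_gens J) = card (min_gens I)"
  \<comment> \<open>Both ideals have one minimal generator per edge, so equal numbers of generators
    mean equally many pairs and cells.\<close>
  have cC: "card C = N" using card colexsegment_betti(1)[OF C W, where 'k = 'k] card_min_gens J by simp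
  obtain \<W> where \<W>: "finite \<W>" "card \<W> = (\<Sum>xy\<in>cells. (card (above xy) + card (right xy)) choose i)"
    "\<And>W. W \<in> \<W> \<Longrightarrow> nonzero (\<lambda>V. V = W) {e. e < N \<and> m e \<subseteq> W} {} (Suc i)"
    using nonzero_family[of i] by (elim exE conjE) (rule that, assumption+, rule bspec)
  have "betti W J i \<le> (\<Sum>S\<in>C. (Max S - 2) choose i)" unfolding J by (rule colexsegment_betti(2)[OF C W])
  also have "\<dots> \<le> (\<Sum>S\<in>pair_of ` cells. (Max S - 2) choose i)"
  proof (rule colex_sum_le[OF C])
    show "finite (pair_of ` cells)" using fin_cells by simp
    show "pair_of ` cells \<subseteq> pos_pairs" using pair_of by blast
    show "card (pair_of ` cells) = card C" using card_image[OF inj_pair_of] card_cells cC by simp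
    show "(Max A - 2) choose i \<le> (Max B - 2) choose i" if "Max A \<le> Max B" for A B :: "nat set"
      using that by (intro binomial_right_mono) simp
  qed
  also have "\<dots> = (\<Sum>xy\<in>cells. (card (above xy) + card (right xy)) choose i)"
    by (simp add: sum.reindex[OF inj_pair_of] pair_of(2))
  also have "\<dots> \<le> betti V I i" using le_betti[OF \<W>(1,3)] \<W>(2) by simp
  finally show "betti W J i \<le> betti V I i" .
qed

end

section \<open>Shifted skew diagrams\<close>

text \<open>For the third claim, \<open>lam\<close> drops by at least one per row, which offsets the
  shift of the rows: the right ends \<open>i + lam i\<close> weakly decrease. The cell
  \<open>(a, y')\<close> supplies the left bound.\<close>

lemma shifted_skew_diagramD:
  assumes "shifted_skew_diagram D"
  shows "(x, y) \<in> D \<Longrightarrow> x < y"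
    and "(x, y) \<in> D \<Longrightarrow> (x, y'') \<in> D \<Longrightarrow> y \<le> y' \<Longrightarrow> y' \<le> y'' \<Longrightarrow> (x, y') \<in> D"
    and "a < x \<Longrightarrow> (a, y') \<in> D \<Longrightarrow> (x, y) \<in> D \<Longrightarrow> y' \<le> y \<Longrightarrow> (a, y) \<in> D"
proof -
  obtain l :: nat and lam mu :: "nat \<Rightarrow> nat" where
    lam: "\<And>i j. 1 \<le> i \<and> i < j \<and> j \<le> l \<Longrightarrow> lam j < lam i" and
    D: "D = {(i, j). 1 \<le> i \<and> i \<le> l \<and> i + mu i + 1 \<le> j \<and> j \<le> i + lam i}"
    using assms unfolding shifted_skew_diagram_def by blast
  show "(x, y) \<in> D \<Longrightarrow> x < y"
    and "(x, y) \<in> D \<Longrightarrow> (x, y'') \<in> D \<Longrightarrow> y \<le> y' \<Longrightarrow> y' \<le> y'' \<Longrightarrow> (x, y') \<in> D"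
    unfolding D by auto
  have dec: "a + k \<le> l \<Longrightarrow> 1 \<le> a \<Longrightarrow> lam (a + k) + k \<le> lam a" for k
  proof (induction k)
    case (Suc k)
    then show ?case using lam[of "a + k" "a + Suc k"] by simp
  qed simp
  show "a < x \<Longrightarrow> (a, y') \<in> D \<Longrightarrow> (x, y) \<in> D \<Longrightarrow> y' \<le> y \<Longrightarrow> (a, y) \<in> D"
    unfolding D using dec[of "x - a"] by auto
qed

text \<open>Rows that have no cell in a column of \<open>Y\<close> contribute no edge and are
  discarded.\<close>

lemma skew_shape_of_diagram:
  fixes D :: "(nat \<times> nat) set" and X Y :: "nat set"
  assumes D: "shifted_skew_diagram D" and fin: "finite X" "finite Y"
  defines "R \<equiv> \<lambda>x. {y \<in> Y. (x, y) \<in> D}"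
  defines "X' \<equiv> {x \<in> X. R x \<noteq> {}}"
  shows "\<exists>N m. skew_shape N m X' Y R \<and> m ` {..<N} = bip_edges X Y D"
proof -
  have B: "bip_edges X Y D = {{Inl x, Inr y} | x y. x \<in> X' \<and> y \<in> R x}"
    unfolding bip_edges_def X'_def R_def by blast
  have "bip_edges X Y D = (\<lambda>(x, y). {Inl x, Inr y}) ` (SIGMA x:X'. R x)" unfolding B by auto
  moreover have "finite (SIGMA x:X'. R x)" using fin by (intro finite_SigmaI) (auto simp: X'_def R_def)
  ultimately have "finite (bip_edges X Y D)" by simp
  from ex_bij_betw_nat_finite[OF this] obtain m where m: "bij_betw m {..<card (bip_edges X Y D)} (bip_edges X Y D)"
    by (auto simp: lessThan_atLeast0)
  have "skew_shape (card (bip_edges X Y D)) m X' Y R"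
  proof
    show "finite X'" "finite Y" using fin by (auto simp: X'_def)
    show "R x \<subseteq> Y" for x by (auto simp: R_def)
    show "R x \<noteq> {}" if "x \<in> X'" for x using that by (simp add: X'_def)
    have finR: "finite (R x)" for x using fin by (simp add: R_def)
    show "Max (R x) \<le> Max (R a)" if a: "a \<in> X'" and x: "x \<in> X'" and less: "a < x" for a x
    proof (rule ccontr)
      assume n: "\<not> Max (R x) \<le> Max (R a)"
      have Mx: "Max (R x) \<in> R x" using x finR by (intro Max_in) (auto simp: X'_def)
      have Ma: "Max (R a) \<in> R a" using a finR by (intro Max_in) (auto simp: X'_def)
      \<comment> \<open>Row \<open>a\<close> has a cell to the left of this column and reaches at
        least as far as row \<open>x\<close> in the diagram.\<close>
      have "(a, Max (R x)) \<in> D"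
        using shifted_skew_diagramD(3)[OF D less, of "Max (R a)" "Max (R x)"] Mx Ma n by (simp add: R_def)
      hence "Max (R x) \<in> R a" using Mx by (simp add: R_def)
      hence "Max (R x) \<le> Max (R a)" using finR by (intro Max_ge)
      thus False using n by simp
    qed
    show "y' \<in> R x" if "y \<in> R x" "y'' \<in> R x" "y' \<in> Y" "y \<le> y'" "y' \<le> y''" for x y y' y''
      using that shifted_skew_diagramD(2)[OF D, of x y y'' y'] by (simp add: R_def)
    show "m ` {..<card (bip_edges X Y D)} = {{Inl x, Inr y} | x y. x \<in> X' \<and> y \<in> R x}"
      using m unfolding B[symmetric] by (simp add: bij_betw_def)
    show "inj_on m {..<card (bip_edges X Y D)}" using m by (simp add: bij_betw_def)
  qed
  thus ?thesis using m by (auto simp: bij_betw_def)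
qed

lemma bip_obeys:
  fixes D :: "(nat \<times> nat) set" and X Y :: "nat set"
  assumes D: "shifted_skew_diagram D" and fin: "finite X" "finite Y"
  shows "obeys_colex_lower_bound (Inl ` X \<union> Inr ` Y)
    (edge_ideal (Inl ` X \<union> Inr ` Y) (bip_edges X Y D) :: (nat + nat, 'k::field) mpol set)"
proof -
  define R where "R x = {y \<in> Y. (x, y) \<in> D}" for x
  define X' where "X' = {x \<in> X. R x \<noteq> {}}"
  obtain N m where sk: "skew_shape N m X' Y R" and img: "m ` {..<N} = bip_edges X Y D"
    using skew_shape_of_diagram[OF D fin] unfolding R_def[symmetric] X'_def[symmetric] by blast
  interpret skew_shape N m "TYPE('k)" X' Y R by (rule sk)
  interpret edge_labels N m "TYPE('k)" "id :: nat + nat \<Rightarrow> nat + nat"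
    by unfold_locales (metis edgeE finite.emptyI finite_insert, metis edgeE insert_not_empty)
  interpret skew_ideal N m "TYPE('k)" X' Y R id "Inl ` X \<union> Inr ` Y"
  proof
    show "\<exists>a b. m e = {a, b} \<and> id a \<noteq> id b" if "e < N" for e
      using that by (rule edgeE) (metis id_apply sum.distinct(1))
    show "inj_on (\<lambda>e. id ` m e) {..<N}" using inj_m by simp
    show "id ` m e \<subseteq> Inl ` X \<union> Inr ` Y" if "e < N" for e
      using that by (rule edgeE) (auto simp: X'_def R_def)
    show "\<exists>e. cone t e" if "e < N" "mdvd (lab (m e)) t" for t e using cone_if_inj[OF _ that] by auto
  qed
  show ?thesis using obeys img by simp
qed

text \<open>All cells satisfy x < y, so the identification collapses no edge and merges no two of
  them; the edges of the bipartite graph on \<open>X\<close> and \<open>X\<close> correspond to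
  those of the nonbipartite graph. What has to be proved is the existence of cone points.\<close>

lemma nonbip_obeys:
  fixes D :: "(nat \<times> nat) set" and X :: "nat set"
  assumes D: "shifted_skew_diagram D" and fin: "finite X"
  shows "obeys_colex_lower_bound X (edge_ideal X (nonbip_edges X D) :: (nat, 'k::field) mpol set)"
proof -
  define R where "R x = {y \<in> X. (x, y) \<in> D}" for x
  define X' where "X' = {x \<in> X. R x \<noteq> {}}"
  obtain N m where sk: "skew_shape N m X' X R" and img: "m ` {..<N} = bip_edges X X D"
    using skew_shape_of_diagram[OF D fin fin] unfolding R_def[symmetric] X'_def[symmetric] by blast
  define sp :: "nat + nat \<Rightarrow> nat" where "sp = case_sum id id"
  have sp: "sp (Inl x) = x" "sp (Inr x) = x" for x by (simp_all add: sp_def)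
  interpret skew_shape N m "TYPE('k)" X' X R by (rule sk)
  interpret edge_labels N m "TYPE('k)" sp
    by unfold_locales (metis edgeE finite.emptyI finite_insert, metis edgeE insert_not_empty)
  have less: "x < y" if "y \<in> R x" for x y using that shifted_skew_diagramD(1)[OF D] by (simp add: R_def)
  have two: "\<exists>a b. m e = {a, b} \<and> sp a \<noteq> sp b" if e: "e < N" for e
  proof -
    obtain a d where "d \<in> R a" "m e = {Inl a, Inr d}" using e by (rule edgeE)
    thus ?thesis using less[of d a] sp by (intro exI[of _ "Inl a"] exI[of _ "Inr d"]) simp
  qed
  have lab_edge: "mdvd (lab {Inl x, Inr y}) t \<longleftrightarrow> 0 < Poly_Mapping.lookup t x \<and> 0 < Poly_Mapping.lookup t y"
    if "x \<noteq> y" for x y t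
  proof -
    have L: "Poly_Mapping.lookup (lab {Inl x, Inr y}) v = (if x = v then 1 else 0) + (if y = v then 1 else 0)" for v
      by (simp add: lab_def sp lookup_add lookup_single when_def)
    show ?thesis
    proof
      assume "mdvd (lab {Inl x, Inr y}) t"
      hence le: "Poly_Mapping.lookup (lab {Inl x, Inr y}) v \<le> Poly_Mapping.lookup t v" for v
        unfolding mdvd_iff by (rule spec)
      show "0 < Poly_Mapping.lookup t x \<and> 0 < Poly_Mapping.lookup t y"
        using le[of x] le[of y] that unfolding L by simp
    next
      assume pos: "0 < Poly_Mapping.lookup t x \<and> 0 < Poly_Mapping.lookup t y"
      show "mdvd (lab {Inl x, Inr y}) t"
        unfolding mdvd_iff L
      proof
        fix v show "(if x = v then 1 else 0) + (if y = v then 1 else 0) \<le> Poly_Mapping.lookup t v"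
          using pos that by (cases "x = v"; cases "y = v") simp_all
      qed
    qed
  qed
  have cones: "\<exists>e. cone t e" if e: "e < N" "mdvd (lab (m e)) t" for t e
  proof -
    define Q where "Q x y \<longleftrightarrow> x \<in> X' \<and> y \<in> R x \<and> 0 < Poly_Mapping.lookup t x \<and> 0 < Poly_Mapping.lookup t y" for x y
    have QD: "x \<in> X'" "y \<in> R x" "0 < Poly_Mapping.lookup t x" "0 < Poly_Mapping.lookup t y" if "Q x y" for x y
      using that by (simp_all add: Q_def)
    have Q: "Q a d" if f: "f < N" "mdvd (lab (m f)) t" "m f = {Inl a, Inr d}" for f a d
    proof -
      obtain a' d' where "a' \<in> X'" "d' \<in> R a'" "m f = {Inl a', Inr d'}" using f(1) by (rule edgeE)
      hence ad: "a \<in> X'" "d \<in> R a" using f(3) by (auto simp: doubleton_eq_iff)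
      thus ?thesis using f(2) less[OF ad(2)] lab_edge[of a d t] unfolding Q_def f(3) by simp
    qed
    obtain a d where ad: "m e = {Inl a, Inr d}" using e(1) by (rule edgeE)
    have ex: "\<exists>x y. Q x y" by (intro exI) (rule Q[OF e ad])
    \<comment> \<open>The rightmost cell \<open>(x, y)\<close> of the first row present in degree \<open>t\<close> is a cone point: no cell present in
      degree \<open>t\<close> lies in column \<open>x\<close>, since \<open>x\<close> is the first row, or in row \<open>y\<close>, since the right ends of rows
      weakly decrease. So adding \<open>(x, y)\<close> leaves both variables with exponent one.\<close>
    define x where "x = (LEAST x. \<exists>y. Q x y)"
    have "\<exists>y. Q x y" unfolding x_def by (rule LeastI_ex[OF ex])
    hence ne: "{y. Q x y} \<noteq> {}" by blast
    have xmin: "x \<le> x'" if "Q x' y" for x' y unfolding x_def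
      by (rule Least_le) (rule exI, rule that)
    define y where "y = Max {y. Q x y}"
    have fQ: "finite {y. Q x y}" using fin by (rule finite_subset[rotated]) (auto simp: Q_def R_def)
    have Qxy: "Q x y" using Max_in[OF fQ ne] unfolding y_def[symmetric] by simp
    note xX = QD(1)[OF Qxy] and yR = QD(2)[OF Qxy]
    have ymax: "y' \<le> y" if "Q x y'" for y' unfolding y_def using fQ that by (intro Max_ge) auto
    have xy: "x < y" using yR by (rule less)
    obtain f where f: "f < N" "m f = {Inl x, Inr y}" using edge_exists[OF xX yR] by blast
    have "cone t f" unfolding cone_def
    proof (intro conjI allI impI)
      fix s assume s: "s \<subseteq> {..<N} \<and> mdvd (lab (U s)) t"
      have fU: "finite (U s)" using s fin_U by blast
      have Qs: "Q a d" if g: "g \<in> s" "m g = {Inl a, Inr d}" for g a d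
      proof (rule Q[OF _ _ g(2)])
        show gN: "g < N" using g s by auto
        have "{w \<in> m g. sp w = v} \<subseteq> {w \<in> U s. sp w = v}" for v using g(1) by (auto simp: U_def)
        hence "card {w \<in> m g. sp w = v} \<le> card {w \<in> U s. sp w = v}" for v using fU by (intro card_mono) auto
        hence "mdvd (lab (m g)) (lab (U s))"
          unfolding mdvd_iff using lookup_lab[OF fU] lookup_lab[OF fin_m[OF gN]] by simp
        thus "mdvd (lab (m g)) t" using s mdvd_trans by blast
      qed
      have x_col: "Inr x \<notin> U s"
      proof
        assume "Inr x \<in> U s"
        then obtain g where g: "g \<in> s" "Inr x \<in> m g" by (auto simp: U_def)
        have "g < N" using g s by auto
        then obtain a d where ad: "d \<in> R a" "m g = {Inl a, Inr d}" by (rule edgeE)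
        have d: "d = x" using g(2) ad(2) by auto
        have "x \<le> a" by (rule xmin) (rule Qs[OF g(1) ad(2)])
        thus False using less[OF ad(1)] d by simp
      qed
      have y_row: "Inl y \<notin> U s"
      proof
        assume "Inl y \<in> U s"
        then obtain g where g: "g \<in> s" "Inl y \<in> m g" by (auto simp: U_def)
        have "g < N" using g s by auto
        then obtain a d where ad: "d \<in> R a" "m g = {Inl a, Inr d}" by (rule edgeE)
        have a: "a = y" using g(2) ad(2) by auto
        have q: "Q y d" by (rule Qs[OF g(1) ad(2)[unfolded a]])
        have yd: "y < d" using less[OF ad(1)] a by simp
        have "d \<le> Max (R y)" by (rule R_le_Max[OF QD(1,2)[OF q]])
        also have "\<dots> \<le> Max (R x)" by (rule R_Max[OF xX QD(1)[OF q] xy])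
        finally have "d \<in> R x"
          using R_convex[OF xX yR Max_R[OF xX], of d] QD(2)[OF q] yd R_Y[OF QD(1)[OF q]] by auto
        hence "Q x d" using QD[OF q] QD[OF Qxy] xX by (simp add: Q_def)
        hence "d \<le> y" by (rule ymax)
        thus False using yd by simp
      qed
      show "mdvd (lab (U (insert f s))) t"
        unfolding mdvd_iff
      proof
        fix v
        have fU': "finite (U (insert f s))" using fU f(2) by simp
        have le: "card {w \<in> U s. sp w = v} \<le> Poly_Mapping.lookup t v"
          using s lookup_lab[OF fU, of v] unfolding mdvd_iff by metis
        consider "v = x" | "v = y" | "v \<noteq> x" "v \<noteq> y" by blast
        hence "card {w \<in> U (insert f s). sp w = v} \<le> Poly_Mapping.lookup t v"
        proof cases
          case 1
          have "{w \<in> U (insert f s). sp w = v} \<subseteq> {Inl x}"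
          proof
            fix w assume "w \<in> {w \<in> U (insert f s). sp w = v}"
            thus "w \<in> {Inl x}" using 1 x_col f(2) xy sp by (cases w) auto
          qed
          from card_mono[OF _ this] have "card {w \<in> U (insert f s). sp w = v} \<le> 1" by simp
          then show ?thesis using QD(3)[OF Qxy] unfolding 1 by simp
        next
          case 2
          have "{w \<in> U (insert f s). sp w = v} \<subseteq> {Inr y}"
          proof
            fix w assume "w \<in> {w \<in> U (insert f s). sp w = v}"
            thus "w \<in> {Inr y}" using 2 y_row f(2) xy sp by (cases w) auto
          qed
          from card_mono[OF _ this] have "card {w \<in> U (insert f s). sp w = v} \<le> 1" by simp
          then show ?thesis using QD(4)[OF Qxy] unfolding 2 by simp
        next
          case 3
          hence "{w \<in> U (insert f s). sp w = v} = {w \<in> U s. sp w = v}" using f(2) sp by auto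
          then show ?thesis using le by simp
        qed
        thus "Poly_Mapping.lookup (lab (U (insert f s))) v \<le> Poly_Mapping.lookup t v"
          using lookup_lab[OF fU', of v] by simp
      qed
    qed (rule f(1))
    thus ?thesis by blast
  qed
  have sp_edge: "sp ` m e = {x, y}" if "m e = {Inl x, Inr y}" for e x y using that sp by simp
  interpret skew_ideal N m "TYPE('k)" X' X R sp X
  proof
    show "inj_on (\<lambda>e. sp ` m e) {..<N}"
    proof (rule inj_onI)
      fix e f assume ef: "e \<in> {..<N}" "f \<in> {..<N}" "sp ` m e = sp ` m f"
      obtain x y where e: "y \<in> R x" "m e = {Inl x, Inr y}" using ef(1) by (auto elim: edgeE)
      obtain x' y' where f: "y' \<in> R x'" "m f = {Inl x', Inr y'}" using ef(2) by (auto elim: edgeE)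
      have "{x, y} = {x', y'}" using ef(3) sp_edge[OF e(2)] sp_edge[OF f(2)] by simp
      hence "m e = m f" using less[OF e(1)] less[OF f(1)] e(2) f(2) by (auto simp: doubleton_eq_iff)
      thus "e = f" using inj_onD[OF inj_m] ef by blast
    qed
    show "sp ` m e \<subseteq> X" if e: "e < N" for e
    proof -
      obtain x y where "x \<in> X'" "y \<in> R x" "m e = {Inl x, Inr y}" using e by (rule edgeE)
      thus ?thesis using sp_edge by (auto simp: X'_def R_def)
    qed
  qed (use two cones in auto)
  have "(\<lambda>e. sp ` m e) ` {..<N} = (\<lambda>B. sp ` B) ` bip_edges X X D"
    unfolding img[symmetric] by (simp add: image_image)
  also have "\<dots> = nonbip_edges X D"
  proof (intro equalityI subsetI)
    fix A assume "A \<in> (\<lambda>B. sp ` B) ` bip_edges X X D"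
    then obtain x y where xy: "x \<in> X" "y \<in> X" "(x, y) \<in> D" "A = sp ` {Inl x, Inr y}"
      unfolding bip_edges_def by blast
    have "A = {x, y}" using xy(4) sp by simp
    thus "A \<in> nonbip_edges X D" using xy shifted_skew_diagramD(1)[OF D xy(3)] unfolding nonbip_edges_def by blast
  next
    fix A assume "A \<in> nonbip_edges X D"
    then obtain x y where xy: "x \<in> X" "y \<in> X" "(x, y) \<in> D" "A = {x, y}" unfolding nonbip_edges_def by blast
    have "A = sp ` {Inl x, Inr y}" using xy(4) sp by simp
    thus "A \<in> (\<lambda>B. sp ` B) ` bip_edges X X D" using xy unfolding bip_edges_def by blast
  qed
  finally show ?thesis using obeys by simp
qed

theorem proposition4p3:
  fixes D :: "(nat \<times> nat) set" and X Y :: "nat set"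
  assumes "shifted_skew_diagram D"
    and "finite X" and "\<forall>x\<in>X. 0 < x"
    and "finite Y" and "\<forall>y\<in>Y. 0 < y"
  shows "obeys_colex_lower_bound (Inl ` X \<union> Inr ` Y)
           (edge_ideal (Inl ` X \<union> Inr ` Y) (bip_edges X Y D) :: (nat + nat, 'k::field) mpol set) \<and>
         obeys_colex_lower_bound X (edge_ideal X (nonbip_edges X D) :: (nat, 'k) mpol set)"
  using bip_obeys[OF assms(1,2,4)] nonbip_obeys[OF assms(1,2)] by blast

end
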